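(* Let $n=3$ and $m=1$, and let all notation be as in the context. Fix $i\ge d_1-1$ and set $c=d_2-i$. Let $U=\Bbbk[T_1,T_2,T_3]$, and let $\Omega_c$ and $\mathcal{B}_c$ be as defined in the context. For each $0\le\ell\le d_1-2$, choose elements $p_{\ell,1},\dots,p_{\ell,d_1-\ell-1}\in F_\ell=\mathcal{R}(F)_{\ell,1}$ whose images in $F_\ell/E_\ell$ form a basis over $\Bbbk$. Then $$\{g_1x_0^{i-d_1},\dots,g_1x_1^{i-d_1}\}\ \cup\ g_2\mathcal{B}_c\ \cup\ \{g_2\,p_{\underline{\alpha}\cdot\underline{\sigma}-c,\,j}\,\underline{w}^{\underline{\alpha}}\mid\underline{\alpha}\in\Omega_c,\ 1\le j\le d_1-\underline{\alpha}\cdot\underline{\sigma}+c-1\}$$ is a generating set (not necessarily minimal) for $\mathcal{K}_{i,*}$ as a $U$-module. Here the first set consists of the products of $g_1$ with all monomials of degree $i-d_1$ in $x_0,x_1$ (it is empty if $i=d_1-1$), and elements of the last two sets, which lie in $\mathcal{R}(E)=S/(g_1)\subset\mathcal{R}(F)$, stand for bihomogeneous lifts to $S$.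
   Context: Let $\Bbbk$ be a field, $R=\Bbbk[x_0,x_1]$ with the standard grading, $\mathbb{N}=\{0,1,2,\dots\}$. For a finitely generated $R$-module $E$, the Rees algebra $\mathcal{R}(E)$ is the symmetric algebra of $E$ modulo its $R$-torsion. Let $I\subset R$ be a height two ideal minimally generated by $n=3$ forms $f_1,f_2,f_3$ of degree $d$, with graded free (Hilbert-Burch) resolution $0\to R(-d_1)\oplus R(-d_2)\xrightarrow{\varphi}R^3\to I(d)\to0$, $1\le d_1\le d_2$. Let $S=R[T_1,T_2,T_3]$, bigraded by $\deg x_i=(1,0)$, $\deg T_i=(0,1)$. Let $[g_1\ g_2]=[T_1\ T_2\ T_3]\varphi$, so $g_i\in S$ has bidegree $(d_i,1)$. Let $\mathcal{K}\subset S$ be the kernel of the surjection $S\to\mathcal{R}(I(d))$, $T_i\mapsto f_i$. For a bigraded object $A$, $A_{i,*}=\bigoplus_jA_{i,j}$. Let $\varphi_1$ be the first column of $\varphi$ (this is the case $m=1$ of taking the first $m$ columns), $E=\operatorname{coker}\varphi_1$ (a torsionfree $R$-module of rank 2 generated in degree 0), $F=E^{**}$ where $-^*=\operatorname{Hom}_R(-,R)$. $F$ is graded free; fix $F\cong R(\sigma_1)\oplus R(\sigma_2)$ with $\sigma_1\ge\sigma_2\ge0$; one has $\sigma_1>0$. Let $r=2$ if $\sigma_2>0$ and $r=1$ if $\sigma_2=0$. Let $\xi:R^3\twoheadrightarrow E\hookrightarrow F$ be the composite, viewed as a $2\times3$ matrix. Then $\mathcal{R}(F)=R[w_1,w_2]$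 is a polynomial ring with $w_i$ corresponding to the $i$th basis element of $F$, bigraded by $\deg x_i=(1,0)$, $\deg w_i=(-\sigma_i,1)$; $E\subset F$ induces an inclusion of bigraded rings $\mathcal{R}(E)=S/(g_1)\subset\mathcal{R}(F)$ with $[T_1\ T_2\ T_3]=[w_1\ w_2]\xi$. The quotient $F_\ell/E_\ell$ has $\Bbbk$-dimension $d_1-\ell-1$ for $0\le\ell\le d_1-2$. For $\underline{\alpha}\in\mathbb{N}^2$: $\underline{w}^{\underline{\alpha}}=w_1^{\alpha_1}w_2^{\alpha_2}$, $\underline{\alpha}\cdot\underline{\sigma}=\alpha_1\sigma_1+\alpha_2\sigma_2$. For $c\ge0$ and $1\le k\le r$ let $\Omega_{c,k}=\{\underline{\alpha}\in\mathbb{N}^2\mid\alpha_k>0,\ \alpha_j=0\text{ for }j>k,\ c\le\underline{\alpha}\cdot\underline{\sigma}<c+\sigma_k\}$, let $\Omega_c=\bigcup_{k=1}^r\Omega_{c,k}$, and let $\mathcal{B}_c=\{x_0^jx_1^k\underline{w}^{\underline{\alpha}}\mid\underline{\alpha}\in\Omega_c,\ j,k\in\mathbb{N},\ j+k=\underline{\alpha}\cdot\underline{\sigma}-c\}$.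
   Formalization: For c = d_2 − i ≤ 0 the set Ω_c is taken to be {0}; the literal formula gives the empty set for c = 0 (and is not defined for c < 0), and the claim would then fail, e.g. g_2 ∈ K_{d_2,*} is not a multiple of g_1. For c > 0, Ω_c is as given. *)

theory Defs
  imports
    "HOL-Analysis.Finite_Cartesian_Product"
    "HOL-Library.Poly_Mapping"
    "HOL-Library.Numeral_Type"
    "HOL-Library.Extended_Nat"
    "HOL-Algebra.Module"
    "HOL-Algebra.Ideal"
    "HOL-Algebra.Algebraic_Closure_Type"
begin

section \<open>Polynomial rings\<close>

text \<open>
  Polynomials are finitely supported coefficient functions on exponent vectors. The numeral type
  2 has the elements 0 and 1, with 2 = 0; the numeral type 3 has the elements 1, 2 and 3, with
  3 = 0. The variables of \<open>R\<close> are indexed by 0, 1 (as in $x_0, x_1$), those of \<open>R[w\<^sub>1, w\<^sub>2]\<close> by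
  1, 2, those of \<open>S\<close> and \<open>U\<close> by 1, 2, 3.
\<close>

type_synonym ('v, 'a) mpoly = "('v \<Rightarrow>\<^sub>0 nat) \<Rightarrow>\<^sub>0 'a"
type_synonym 'k polR = "(2, 'k) mpoly"  \<comment> \<open>\<open>R = k[x\<^sub>0, x\<^sub>1]\<close>\<close>
type_synonym 'k polS = "(3, 'k polR) mpoly"  \<comment> \<open>\<open>S = R[T\<^sub>1, T\<^sub>2, T\<^sub>3]\<close>\<close>
type_synonym 'k polF = "(2, 'k polR) mpoly"  \<comment> \<open>\<open>R[w\<^sub>1, w\<^sub>2]\<close>, the Rees algebra of \<open>F\<close>\<close>
type_synonym 'k polU = "(3, 'k) mpoly"  \<comment> \<open>\<open>U = k[T\<^sub>1, T\<^sub>2, T\<^sub>3]\<close>\<close>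

definition Const :: "'a \<Rightarrow> ('v, 'a::zero) mpoly"
  where "Const a = Poly_Mapping.single 0 a"

definition Monom :: "('v \<Rightarrow>\<^sub>0 nat) \<Rightarrow> ('v, 'a::zero_neq_one) mpoly"
  where "Monom m = Poly_Mapping.single m 1"

definition Var :: "'v \<Rightarrow> ('v, 'a::zero_neq_one) mpoly"
  where "Var v = Monom (Poly_Mapping.single v 1)"

definition mdeg :: "('v \<Rightarrow>\<^sub>0 nat) \<Rightarrow> nat"
  where "mdeg m = (\<Sum>v\<in>Poly_Mapping.keys m. Poly_Mapping.lookup m v)"

definition mpoly_eval :: "('a::zero \<Rightarrow> 'b::comm_ring_1) \<Rightarrow> ('v \<Rightarrow> 'b) \<Rightarrow> ('v, 'a) mpoly \<Rightarrow> 'b"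
  where "mpoly_eval c t p =
    (\<Sum>m\<in>Poly_Mapping.keys p. c (Poly_Mapping.lookup p m) *
      (\<Prod>v\<in>Poly_Mapping.keys m. t v ^ Poly_Mapping.lookup m v))"

definition forms :: "int \<Rightarrow> ('v, 'a::zero) mpoly set"
  where "forms e = {p. \<forall>m\<in>Poly_Mapping.keys p. int (mdeg m) = e}"

text \<open>
  The component of bidegree \<open>(i, q)\<close> of a polynomial ring over a standard graded polynomial ring,
  where the variable \<open>v\<close> has bidegree \<open>(s v, 1)\<close>.
\<close>

definition bigraded :: "('v \<Rightarrow> int) \<Rightarrow> int \<Rightarrow> nat \<Rightarrow> ('v, ('x, 'a::zero) mpoly) mpoly set"
  where "bigraded s i q =
    {p. \<forall>m\<in>Poly_Mapping.keys p. mdeg m = q \<and>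
      Poly_Mapping.lookup p m \<in>
        forms (i - (\<Sum>v\<in>Poly_Mapping.keys m. int (Poly_Mapping.lookup m v) * s v))}"

abbreviation S_comp :: "int \<Rightarrow> nat \<Rightarrow> 'k::zero polS set"
  where "S_comp \<equiv> bigraded (\<lambda>_. 0)"

abbreviation F_comp :: "(2 \<Rightarrow> nat) \<Rightarrow> int \<Rightarrow> nat \<Rightarrow> 'k::zero polF set"
  where "F_comp \<sigma> \<equiv> bigraded (\<lambda>i. - int (\<sigma> i))"

text \<open>\<open>A\<^sub>i\<^sub>,\<^sub>* = \<Oplus>\<^sub>j A\<^sub>i\<^sub>,\<^sub>j\<close> for a bigraded ideal \<open>A\<close> of \<open>S\<close>.\<close>

definition S_row :: "'k::comm_ring_1 polS set \<Rightarrow> int \<Rightarrow> 'k polS set"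
  where "S_row A i = {(\<Sum>j\<le>N. h j) | h N. \<forall>j\<le>N. h j \<in> A \<inter> S_comp i j}"

text \<open>The \<open>j\<close>-th entry of the row vector \<open>[v\<^sub>1 v\<^sub>2 \<dots>] A\<close>, where the \<open>v\<^sub>i\<close> are the variables.\<close>

definition vars_mult :: "'a::comm_ring_1 ^ 'n ^ 'm \<Rightarrow> 'n \<Rightarrow> ('m::finite, 'a) mpoly"
  where "vars_mult A j = (\<Sum>i\<in>UNIV. Var i * Const (A $ i $ j))"

definition U_smult :: "'k::comm_ring_1 polU \<Rightarrow> 'k polS \<Rightarrow> 'k polS"
  where "U_smult u s = mpoly_eval (\<lambda>a. Const (Const a)) Var u * s"


section \<open>Height\<close>

definition prime_height :: "('a, 'b) ring_scheme \<Rightarrow> 'a set \<Rightarrow> enat"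
  where "prime_height R P =
    Sup {enat n | n. \<exists>Q. (\<forall>i\<le>n. primeideal (Q i) R) \<and> (\<forall>i<n. Q i \<subset> Q (Suc i)) \<and> Q n = P}"

definition height :: "('a, 'b) ring_scheme \<Rightarrow> 'a set \<Rightarrow> enat"
  where "height R I = (INF P\<in>{P. primeideal P R \<and> I \<subseteq> P}. prime_height R P)"


section \<open>Graded modules\<close>

text \<open>
  Scalars always range over a whole type. The ring fields \<open>mult\<close> and \<open>one\<close> that the record
  \<open>module\<close> inherits have no meaning for modules.
\<close>

record ('r, 'm) gmodule = "('r, 'm) module" +
  grade :: "int \<Rightarrow> 'm set"

definition base_gmod :: "(('v, 'a::comm_ring_1) mpoly, ('v, 'a) mpoly) gmodule"
  where "base_gmod = \<lparr>carrier = UNIV, monoid.mult = (*), one = 1, ring.zero = 0, add = (+),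
    module.smult = (*), grade = forms\<rparr>"

text \<open>\<open>\<Oplus>\<^sub>j R(s j)\<close>, where \<open>R(a)\<^sub>e = R\<^bsub>e + a\<^esub>\<close>.\<close>

definition free_gmod ::
    "('n \<Rightarrow> int) \<Rightarrow> (('v, 'a::comm_ring_1) mpoly, ('v, 'a) mpoly ^ 'n) gmodule"
  where "free_gmod s = \<lparr>carrier = UNIV, monoid.mult = undefined, one = undefined, ring.zero = 0,
    add = (+), module.smult = (*s), grade = (\<lambda>e. {v. \<forall>j. v $ j \<in> forms (e + s j)})\<rparr>"

definition quot_gmod :: "('r, 'm) gmodule \<Rightarrow> 'm set \<Rightarrow> ('r, 'm set) gmodule"
  where "quot_gmod M N = \<lparr>carrier = a_rcosets\<^bsub>M\<^esub> N, monoid.mult = undefined, one = undefined,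
    ring.zero = N, add = set_add M, module.smult = (\<lambda>r C. \<Union>x\<in>C. N +>\<^bsub>M\<^esub> (r \<odot>\<^bsub>M\<^esub> x)),
    grade = (\<lambda>e. (\<lambda>x. N +>\<^bsub>M\<^esub> x) ` grade M e)\<rparr>"

definition hom_gmod :: "('r, 'm) gmodule \<Rightarrow> ('r, 'n) gmodule \<Rightarrow> ('r, 'm \<Rightarrow> 'n) gmodule"
  where "hom_gmod M N = (let H = {h \<in> carrier M \<rightarrow>\<^sub>E carrier N.
      (\<forall>x\<in>carrier M. \<forall>y\<in>carrier M. h (x \<oplus>\<^bsub>M\<^esub> y) = h x \<oplus>\<^bsub>N\<^esub> h y) \<and>
      (\<forall>r. \<forall>x\<in>carrier M. h (r \<odot>\<^bsub>M\<^esub> x) = r \<odot>\<^bsub>N\<^esub> h x)}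
    in \<lparr>carrier = H, monoid.mult = undefined, one = undefined,
      ring.zero = (\<lambda>x\<in>carrier M. \<zero>\<^bsub>N\<^esub>),
      add = (\<lambda>g h. \<lambda>x\<in>carrier M. g x \<oplus>\<^bsub>N\<^esub> h x),
      module.smult = (\<lambda>r h. \<lambda>x\<in>carrier M. r \<odot>\<^bsub>N\<^esub> h x),
      grade = (\<lambda>e. {h \<in> H. \<forall>n. \<forall>x\<in>grade M n. h x \<in> grade N (n + e)})\<rparr>)"

definition gmod_iso :: "('r, 'm) gmodule \<Rightarrow> ('r, 'n) gmodule \<Rightarrow> ('m \<Rightarrow> 'n) \<Rightarrow> bool"
  where "gmod_iso M N h \<longleftrightarrow> h \<in> carrier (hom_gmod M N) \<and>
    bij_betw h (carrier M) (carrier N) \<and> (\<forall>e. h ` grade M e = grade N e)"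

definition dual ::
    "(('v, 'a::comm_ring_1) mpoly, 'm) gmodule \<Rightarrow>
      (('v, 'a) mpoly, 'm \<Rightarrow> ('v, 'a) mpoly) gmodule"
  where "dual M = hom_gmod M base_gmod"

definition bidual_map ::
    "(('v, 'a::comm_ring_1) mpoly, 'm) gmodule \<Rightarrow> 'm \<Rightarrow> ('m \<Rightarrow> ('v, 'a) mpoly) \<Rightarrow> ('v, 'a) mpoly"
  where "bidual_map M x = (\<lambda>l\<in>carrier (dual M). l x)"

text \<open>The free module \<open>R\<^sup>3\<close>, the image of the first column of \<open>\<phi>\<close>, and \<open>E = coker \<phi>\<^sub>1\<close>.\<close>

definition R3 :: "('k::comm_ring_1 polR, 'k polR ^ 3) gmodule"
  where "R3 = free_gmod (\<lambda>_. 0)"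

definition im_col1 :: "'k::comm_ring_1 polR ^ 2 ^ 3 \<Rightarrow> ('k polR ^ 3) set"
  where "im_col1 \<phi> = range (\<lambda>r. r *s column 1 \<phi>)"

definition E_mod :: "'k::comm_ring_1 polR ^ 2 ^ 3 \<Rightarrow> ('k polR, ('k polR ^ 3) set) gmodule"
  where "E_mod \<phi> = quot_gmod R3 (im_col1 \<phi>)"


section \<open>Rees algebras\<close>

text \<open>
  \<open>Sym(M)\<close> is the polynomial ring on variables \<open>X\<^sub>m\<close>, \<open>m \<in> M\<close>, modulo the ideal generated by all
  \<open>X\<^sub>x\<^sub>+\<^sub>y - X\<^sub>x - X\<^sub>y\<close> and \<open>X\<^sub>r\<^sub>x - r X\<^sub>x\<close>. Variables indexed by elements outside the carrier of \<open>M\<close>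
  do not occur in the relations and are not used below. The Rees algebra is \<open>Sym(M)\<close> modulo its
  \<open>R\<close>-torsion; \<open>rees_ideal M\<close> is the corresponding ideal of the polynomial ring (for a domain \<open>R\<close>).
\<close>

definition sym_ideal :: "('r::comm_ring_1, 'm, 'z) module_scheme \<Rightarrow> ('m, 'r) mpoly set"
  where "sym_ideal M = Modules.module.span (*)
    ({Var (x \<oplus>\<^bsub>M\<^esub> y) - Var x - Var y | x y. x \<in> carrier M \<and> y \<in> carrier M} \<union>
     {Var (r \<odot>\<^bsub>M\<^esub> x) - Const r * Var x | r x. x \<in> carrier M})"

definition rees_ideal :: "('r::comm_ring_1, 'm, 'z) module_scheme \<Rightarrow> ('m, 'r) mpoly set"
  where "rees_ideal M = {h. \<exists>r. r \<noteq> 0 \<and> Const r * h \<in> sym_ideal M}"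

definition ideal3 :: "'k::comm_ring_1 polR ^ 3 \<Rightarrow> 'k polR set"
  where "ideal3 f = genideal ring_of_type_algebra (range (\<lambda>i. f $ i))"

text \<open>
  The kernel of \<open>S \<rightarrow> \<R>(I(d))\<close>, \<open>T\<^sub>i \<mapsto> f\<^sub>i\<close>. The shift by \<open>d\<close> does not affect the kernel.
\<close>

definition rees_kernel :: "'k::comm_ring_1 polR ^ 3 \<Rightarrow> 'k polS set"
  where "rees_kernel f =
    {h. mpoly_eval Const (\<lambda>i. Var (f $ i)) h \<in> rees_ideal (base_gmod\<lparr>carrier := ideal3 f\<rparr>)}"

text \<open>
  The map \<open>S \<rightarrow> R[w\<^sub>1, w\<^sub>2]\<close> with \<open>[T\<^sub>1 T\<^sub>2 T\<^sub>3] \<mapsto> [w\<^sub>1 w\<^sub>2] \<xi>\<close>. Its image is \<open>\<R>(E)\<close>.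
\<close>

definition to_ReesF :: "'k::comm_ring_1 polR ^ 3 ^ 2 \<Rightarrow> 'k polS \<Rightarrow> 'k polF"
  where "to_ReesF \<xi> = mpoly_eval Const (vars_mult \<xi>)"

text \<open>The family \<open>p 1, \<dots>, p n\<close> in \<open>V\<close> maps to a \<open>k\<close>-basis of \<open>V / W\<close>.\<close>

definition basis_mod :: "'k::comm_ring_1 polF set \<Rightarrow> 'k polF set \<Rightarrow> nat \<Rightarrow> (nat \<Rightarrow> 'k polF) \<Rightarrow> bool"
  where "basis_mod V W n p \<longleftrightarrow> (\<forall>j\<in>{1..n}. p j \<in> V) \<and>
    (\<forall>y\<in>V. \<exists>!a. a \<in> {1..n} \<rightarrow>\<^sub>E UNIV \<and> y - (\<Sum>j\<in>{1..n}. Const (Const (a j)) * p j) \<in> W)"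


section \<open>The index set and the monomials\<close>

definition wdot :: "(2 \<Rightarrow>\<^sub>0 nat) \<Rightarrow> (2 \<Rightarrow> nat) \<Rightarrow> int"
  where "wdot \<alpha> \<sigma> = int (Poly_Mapping.lookup \<alpha> 1 * \<sigma> 1 + Poly_Mapping.lookup \<alpha> 2 * \<sigma> 2)"

text \<open>The condition \<open>\<alpha>\<^sub>j = 0\<close> for \<open>j > k\<close> only says something for \<open>k = 1\<close>.\<close>

definition Omega_part :: "(2 \<Rightarrow> nat) \<Rightarrow> int \<Rightarrow> 2 \<Rightarrow> (2 \<Rightarrow>\<^sub>0 nat) set"
  where "Omega_part \<sigma> c k = {\<alpha>. Poly_Mapping.lookup \<alpha> k > 0 \<and>
    (k = 1 \<longrightarrow> Poly_Mapping.lookup \<alpha> 2 = 0) \<and>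
    c \<le> wdot \<alpha> \<sigma> \<and> wdot \<alpha> \<sigma> < c + int (\<sigma> k)}"

text \<open>
  For \<open>c > 0\<close> this is the union of the \<open>Omega_part \<sigma> c k\<close>, \<open>1 \<le> k \<le> r\<close>, with \<open>r = 2\<close> if
  \<open>\<sigma>\<^sub>2 > 0\<close> and \<open>r = 1\<close> otherwise. For \<open>c \<le> 0\<close> all \<open>Omega_part \<sigma> c k\<close> are empty, because
  \<open>\<alpha>\<^sub>k > 0\<close> forces \<open>\<alpha>\<cdot>\<sigma> \<ge> \<sigma>\<^sub>k\<close>; there the minimal exponent vector with \<open>c \<le> \<alpha>\<cdot>\<sigma>\<close> is \<open>\<alpha> = 0\<close>,
  and the convention is that the set is \<open>{0}\<close>. (With the empty set the generators of bidegree
  \<open>(i, 1)\<close> that are multiples of \<open>g\<^sub>2\<close> would be missing for \<open>i \<ge> d\<^sub>2\<close>.)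
\<close>

definition Omega :: "(2 \<Rightarrow> nat) \<Rightarrow> int \<Rightarrow> (2 \<Rightarrow>\<^sub>0 nat) set"
  where "Omega \<sigma> c = (\<Union>k\<in>(if \<sigma> 2 > 0 then {1, 2} else {1}). Omega_part \<sigma> c k) \<union>
    (if c \<le> 0 then {0} else {})"

definition Bset :: "(2 \<Rightarrow> nat) \<Rightarrow> int \<Rightarrow> 'k::comm_ring_1 polF set"
  where "Bset \<sigma> c = {Const (Var 0 ^ j * Var 1 ^ k) * Monom \<alpha> | \<alpha> j k.
    \<alpha> \<in> Omega \<sigma> c \<and> int j + int k = wdot \<alpha> \<sigma> - c}"

end

theory Submission
  imports Defs "HOL-Analysis.Cartesian_Space"
begin

text \<open>
  Let \<open>a\<close> be the first column of \<open>\<phi>\<close>, let \<open>e \<in> F\<close> be the image of the second column, and let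
  \<open>\<psi> : S \<rightarrow> \<R>(F) = R[w\<^sub>1, w\<^sub>2]\<close> be the map \<open>[T\<^sub>1 T\<^sub>2 T\<^sub>3] \<mapsto> [w\<^sub>1 w\<^sub>2] \<xi>\<close>. Then \<open>\<psi>(g\<^sub>1) = 0\<close> and \<open>\<psi>(g\<^sub>2) = e\<^sub>1 w\<^sub>1 + e\<^sub>2 w\<^sub>2\<close>.
  The theorem reduces the row \<open>\<K>\<^sub>i\<^sub>,\<^sub>*\<close> to the row \<open>\<R>(F)\<^sub>-\<^sub>c\<^sub>,\<^sub>*\<close> of a polynomial ring, where generators can be read off
  from monomials. It rests on four facts.

  \<^item> The kernel of \<open>\<psi>\<close> is \<open>(g\<^sub>1)\<close> (\<open>ker_\<psi>\<close>).
  \<^item> A bihomogeneous \<open>h\<close> lies in \<open>\<K>\<close> if and only if it vanishes at \<open>f\<close>, and then \<open>\<psi>(h)\<close> is a multiple of \<open>\<psi>(g\<^sub>2)\<close> in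
    \<open>\<R>(F)\<close> (\<open>bihomogeneous_rees_kernel_iff\<close>, \<open>value_f_zero_imp_multiple\<close>). Conversely every preimage of a multiple of
    \<open>\<psi>(g\<^sub>2)\<close> vanishes at \<open>f\<close>.
  \<^item> In the rows \<open>l \<ge> d\<^sub>1 - 1\<close> the map \<open>\<psi>\<close> is surjective (\<open>\<psi>_surj_high_rows\<close>).
  \<^item> A row \<open>\<R>(F)\<^sub>l\<^sub>,\<^sub>*\<close> with \<open>l \<ge> 0\<close> is generated over \<open>U\<close> by \<open>R\<^sub>l\<close> and \<open>F\<^sub>l\<close> (\<open>nonneg_row_generators\<close>).

  By the first three facts, \<open>\<psi>\<close> induces for \<open>i \<ge> d\<^sub>1 - 1\<close> an isomorphism of \<open>\<K>\<^sub>i\<^sub>,\<^sub>* / (g\<^sub>1)\<^sub>i\<^sub>,\<^sub>*\<close> with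
  \<open>\<psi>(g\<^sub>2) \<R>(F)\<^sub>-\<^sub>c\<^sub>,\<^sub>*\<close>. A monomial in \<open>\<R>(F)\<^sub>-\<^sub>c\<^sub>,\<^sub>*\<close> has a factor \<open>w\<^sup>\<alpha>\<close> with \<open>\<alpha> \<in> \<Omega>\<^sub>c\<close> (\<open>Omega_factor\<close>), and the cofactor lies in
  a row \<open>l = \<alpha> \<cdot> \<sigma> - c \<ge> 0\<close>. By the fourth fact that row is generated by the monomials of \<open>R\<^sub>l\<close>, which give \<open>\<B>\<^sub>c\<close>, and by
  \<open>F\<^sub>l\<close>. The part \<open>E\<^sub>l\<close> of \<open>F\<^sub>l\<close> consists of combinations of the \<open>T\<^sub>j\<close> with coefficients in \<open>R\<^sub>l\<close>, so only the
  elements \<open>p\<^sub>l\<^sub>,\<^sub>j\<close> have to be added; they exist for \<open>l \<le> d\<^sub>1 - 2\<close> only, because \<open>E\<^sub>l = F\<^sub>l\<close> otherwise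
  (\<open>Omega_multiple_in_span\<close>, \<open>row_generators\<close>).

  The third and the fourth fact are statements on the local cohomology module \<open>\<R>(F)/\<R>(E)\<close> of \<open>S/(g\<^sub>1)\<close> and its embedding
  into \<open>H\<^sup>2(S)(-d\<^sub>1, -1)\<close>. They are proved on cocycles: if \<open>x\<^sub>0\<^sup>M s\<close> and \<open>x\<^sub>1\<^sup>M s\<close> lift to \<open>S\<close>, the lifts of
  \<open>x\<^sub>0\<^sup>M x\<^sub>1\<^sup>M s\<close> differ by a multiple \<open>g\<^sub>1 t\<close>, and the class of \<open>t\<close> modulo \<open>(x\<^sub>0\<^sup>M, x\<^sub>1\<^sup>M)\<close> is the obstruction to lifting \<open>s\<close>
  (\<open>obstruction\<close>). The same principle proves the first two facts: an assertion is shown after multiplication by powers of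
  \<open>x\<^sub>0\<close> and of \<open>x\<^sub>1\<close>, where \<open>F/E\<close> vanishes and all sequences split, and the powers are removed because \<open>x\<^sub>0, x\<^sub>1\<close> is a regular
  sequence (\<open>dvd_of_dvd_Var_multiples\<close>). That \<open>F/E\<close> is annihilated by such powers follows from the description of the
  linear forms on \<open>E\<close> by the rows of \<open>\<xi>\<close> (\<open>bidual_presentation\<close>) and the Koszul relations on \<open>a\<close> (\<open>coker_\<xi>_finite\<close>).
\<close>

section \<open>Polynomials as finitely supported functions\<close>

abbreviation coef :: "('a \<Rightarrow>\<^sub>0 'b::zero) \<Rightarrow> 'a \<Rightarrow> 'b"
  where "coef \<equiv> Poly_Mapping.lookup"

abbreviation supp :: "('a \<Rightarrow>\<^sub>0 'b::zero) \<Rightarrow> 'a set"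
  where "supp \<equiv> Poly_Mapping.keys"

lemma Const_0 [simp]: "Const 0 = 0"
  by (simp add: Const_def)

lemma Const_1 [simp]: "Const 1 = 1"
  by (simp add: Const_def)

lemma Const_add: "Const (a + b) = Const a + (Const b :: ('v, 'a::comm_ring_1) mpoly)"
  by (simp add: Const_def single_add)

lemma Const_uminus: "Const (- a) = - (Const a :: ('v, 'a::comm_ring_1) mpoly)"
  by (simp add: Const_def single_uminus)

lemma Const_diff: "Const (a - b) = Const a - (Const b :: ('v, 'a::comm_ring_1) mpoly)"
  by (simp add: Const_def single_diff)

lemma Const_mult: "Const (a * b) = Const a * (Const b :: ('v, 'a::comm_ring_1) mpoly)"
  by (simp add: Const_def mult_single)

lemma Const_power: "Const (a ^ n) = (Const a :: ('v, 'a::comm_ring_1) mpoly) ^ n"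
  by (induction n) (simp_all add: Const_mult)

lemma Const_sum: "Const (sum h I) = (\<Sum>i\<in>I. Const (h i) :: ('v, 'a::comm_ring_1) mpoly)"
  by (induction I rule: infinite_finite_induct) (simp_all add: Const_add)

lemma Const_eq_iff [simp]: "Const a = Const b \<longleftrightarrow> a = b"
  by (metis Const_def lookup_single_eq)

lemma Const_eq_0_iff [simp]: "Const a = 0 \<longleftrightarrow> a = 0"
  by (metis Const_0 Const_eq_iff)

lemma Monom_0 [simp]: "Monom 0 = 1"
  by (simp add: Monom_def)

lemma Monom_add: "Monom (m + n) = Monom m * (Monom n :: ('v, 'a::comm_ring_1) mpoly)"
  by (simp add: Monom_def mult_single)

lemma Const_Monom: "Const r * Monom m = Poly_Mapping.single m (r :: 'a::comm_ring_1)"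
  by (simp add: Const_def Monom_def mult_single)

lemma coef_Const_mult [simp]: "coef (Const r * p) m = r * coef p (m :: 'v \<Rightarrow>\<^sub>0 nat)"
  for p :: "('v, 'a::comm_ring_1) mpoly"
  by (simp add: Const_def mult_map_scale_conv_mult[symmetric] Poly_Mapping.map.rep_eq when_def)

lemma mpoly_induct [case_names monom add zero]:
  fixes p :: "('v, 'a::comm_ring_1) mpoly"
  assumes monom: "\<And>r m. m \<in> supp p \<Longrightarrow> r = coef p m \<Longrightarrow> P (Const r * Monom m)"
    and add: "\<And>p q. P p \<Longrightarrow> P q \<Longrightarrow> P (p + q)" and zero: "P 0"
  shows "P p"
proof -
  have "P (\<Sum>m\<in>K. Const (coef p m) * Monom m)" if "finite K" "K \<subseteq> supp p" for K
    using that by (induction K) (auto intro: add zero monom)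
  moreover have "(\<Sum>m\<in>supp p. Const (coef p m) * Monom m) = p"
  proof (rule poly_mapping_eqI)
    fix k
    show "coef (\<Sum>m\<in>supp p. Const (coef p m) * Monom m) k = coef p k"
      by (simp add: lookup_sum Const_Monom lookup_single when_def in_keys_iff)
  qed
  ultimately show ?thesis
    by (metis finite_keys order_refl)
qed

section \<open>Evaluation of polynomials\<close>

definition mon_eval :: "('v \<Rightarrow> 'b::comm_ring_1) \<Rightarrow> ('v \<Rightarrow>\<^sub>0 nat) \<Rightarrow> 'b"
  where "mon_eval t m = (\<Prod>v\<in>supp m. t v ^ coef m v)"

lemma mon_superset: "finite A \<Longrightarrow> supp m \<subseteq> A \<Longrightarrow> mon_eval t m = (\<Prod>v\<in>A. t v ^ coef m v)"
  unfolding mon_eval_def by (rule prod.mono_neutral_left) (auto simp: in_keys_iff)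

lemma mon_0 [simp]: "mon_eval t 0 = 1"
  by (simp add: mon_eval_def)

lemma mon_add: "mon_eval t (m + n) = mon_eval t m * mon_eval t n"
proof -
  let ?A = "supp m \<union> supp n"
  have "supp (m + n) \<subseteq> ?A" by (rule Poly_Mapping.keys_add)
  then show ?thesis
    by (simp add: mon_superset[of ?A] lookup_add power_add prod.distrib)
qed

lemma mon_single [simp]: "mon_eval t (Poly_Mapping.single v n) = t v ^ n"
  by (simp add: mon_superset[of "{v}"])

lemma mdeg_superset: "finite A \<Longrightarrow> supp m \<subseteq> A \<Longrightarrow> mdeg m = (\<Sum>v\<in>A. coef m v)"
  unfolding mdeg_def by (rule sum.mono_neutral_left) (auto simp: in_keys_iff)

lemma mdeg_0 [simp]: "mdeg 0 = 0"
  by (simp add: mdeg_def)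

lemma mdeg_single [simp]: "mdeg (Poly_Mapping.single v n) = n"
  by (simp add: mdeg_superset[of "{v}"])

lemma mdeg_add: "mdeg (m + n) = mdeg m + mdeg n"
proof -
  let ?A = "supp m \<union> supp n"
  have "supp (m + n) \<subseteq> ?A" by (rule Poly_Mapping.keys_add)
  then show ?thesis
    by (simp add: mdeg_superset[of ?A] lookup_add sum.distrib)
qed

lemma mon_scale: "mon_eval (\<lambda>v. z * t v) m = z ^ mdeg m * mon_eval t m"
  by (simp add: mon_eval_def mdeg_def power_mult_distrib prod.distrib power_sum)

text \<open>
  A ring homomorphism on the coefficients makes evaluation a ring homomorphism. It is used for constant embeddings
  (\<open>Const\<close>, twice iterated for \<open>U \<rightarrow> S\<close>), for the identity (values in the coefficient ring), and for evaluations themselves.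
\<close>

locale coeff_hom =
  fixes c :: "'a::comm_ring_1 \<Rightarrow> 'b::comm_ring_1"
  assumes c_1 [simp]: "c 1 = 1" and c_add: "c (x + y) = c x + c y" and c_mult: "c (x * y) = c x * c y"
begin

lemma c_0 [simp]: "c 0 = 0"
  using c_add[of 0 0] by simp

lemma c_uminus: "c (- x) = - c x"
  using c_add[of x "- x"] by (simp add: eq_neg_iff_add_eq_0 add.commute)

lemma eval_superset:
  "finite A \<Longrightarrow> supp p \<subseteq> A \<Longrightarrow> mpoly_eval c t p = (\<Sum>m\<in>A. c (coef p m) * mon_eval t m)"
  unfolding mpoly_eval_def mon_eval_def by (rule sum.mono_neutral_left) (auto simp: in_keys_iff)

lemma eval_0 [simp]: "mpoly_eval c t 0 = 0"
  by (simp add: mpoly_eval_def)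

lemma eval_add: "mpoly_eval c t (p + q) = mpoly_eval c t p + mpoly_eval c t q"
proof -
  let ?A = "supp p \<union> supp q"
  have "supp (p + q) \<subseteq> ?A" by (rule Poly_Mapping.keys_add)
  then show ?thesis
    by (simp add: eval_superset[of ?A] lookup_add c_add distrib_right sum.distrib)
qed

lemma eval_monom: "mpoly_eval c t (Const r * Monom m) = c r * mon_eval t m"
  by (simp add: Const_Monom eval_superset[of "{m}"])

lemma eval_mult: "mpoly_eval c t (p * q) = mpoly_eval c t p * mpoly_eval c t q"
proof (induction p rule: mpoly_induct)
  case (monom r m)
  show ?case
  proof (induction q rule: mpoly_induct)
    case (monom s n)
    have "Const r * Monom m * (Const s * Monom n) = Const (r * s) * Monom (m + n)"
      by (simp add: Const_mult Monom_add)
    then show ?case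
      by (simp only: eval_monom c_mult mon_add) simp
  qed (simp_all add: eval_add distrib_left)
qed (simp_all add: eval_add distrib_right)

lemma eval_Const [simp]: "mpoly_eval c t (Const r) = c r"
  using eval_monom[of t r 0] by simp

lemma eval_Monom: "mpoly_eval c t (Monom m) = mon_eval t m"
  using eval_monom[of t 1 m] by simp

lemma eval_Var [simp]: "mpoly_eval c t (Var v) = t v"
  by (simp add: Var_def eval_Monom)

lemma eval_1 [simp]: "mpoly_eval c t 1 = 1"
  using eval_Const[of t 1] by simp

lemma eval_hom: "coeff_hom (mpoly_eval c t)"
  by standard (simp_all add: eval_add eval_mult)

lemma eval_uminus: "mpoly_eval c t (- p) = - mpoly_eval c t p"
  by (rule coeff_hom.c_uminus[OF eval_hom])

lemma eval_diff: "mpoly_eval c t (p - q) = mpoly_eval c t p - mpoly_eval c t q"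
  using eval_add[of t p "- q"] by (simp add: eval_uminus)

lemma eval_sum: "mpoly_eval c t (sum h I) = (\<Sum>i\<in>I. mpoly_eval c t (h i))"
  by (induction I rule: infinite_finite_induct) (simp_all add: eval_add)

text \<open>
  For polynomials of degree \<open>q\<close> a common factor of the values of the variables comes out as a \<open>q\<close>-th power. This is what
  turns maps that split only up to a power of a variable into statements on all of a symmetric algebra.
\<close>

lemma eval_scale:
  assumes "\<And>m. m \<in> supp p \<Longrightarrow> mdeg m = q"
  shows "mpoly_eval c (\<lambda>v. z * t v) p = z ^ q * mpoly_eval c t p"
proof -
  have "c (coef p m) * mon_eval (\<lambda>v. z * t v) m = z ^ q * (c (coef p m) * mon_eval t m)"
    if "m \<in> supp p" for m
    using assms[OF that] by (simp add: mon_scale)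
  then show ?thesis
    by (simp add: eval_superset[of "supp p"] sum_distrib_left)
qed

end

lemma coeff_hom_id: "coeff_hom (\<lambda>x. x)"
  by standard simp_all

lemma coeff_hom_Const: "coeff_hom (Const :: 'a::comm_ring_1 \<Rightarrow> ('v, 'a) mpoly)"
  by standard (simp_all add: Const_add Const_mult)

lemma coeff_hom_comp: "coeff_hom h \<Longrightarrow> coeff_hom c \<Longrightarrow> coeff_hom (\<lambda>x. h (c x))"
  by (simp add: coeff_hom_def)

lemma hom_mpoly_eval:
  assumes h: "coeff_hom h" and c: "coeff_hom c"
  shows "h (mpoly_eval c t p) = mpoly_eval (\<lambda>x. h (c x)) (\<lambda>v. h (t v)) p"
proof -
  interpret h: coeff_hom h by fact
  interpret c: coeff_hom c by fact
  interpret hc: coeff_hom "\<lambda>x. h (c x)" by (rule coeff_hom_comp[OF h c])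
  have pow: "h (x ^ n) = h x ^ n" for x n
    by (induction n) (simp_all add: h.c_mult)
  have m: "h (mon_eval t m) = mon_eval (\<lambda>v. h (t v)) m" for m
  proof -
    have "h (\<Prod>v\<in>V. t v ^ coef m v) = (\<Prod>v\<in>V. h (t v) ^ coef m v)" for V
      by (induction V rule: infinite_finite_induct) (simp_all add: h.c_mult pow)
    then show ?thesis by (simp add: mon_eval_def)
  qed
  show ?thesis
    by (induction p rule: mpoly_induct)
      (simp_all add: c.eval_add hc.eval_add h.c_add c.eval_monom hc.eval_monom h.c_mult m)
qed

lemma eval_cong_dvd:
  assumes c: "coeff_hom c" and d: "\<And>v. g dvd t v - t' v"
  shows "g dvd mpoly_eval c t p - mpoly_eval c t' p"
proof -
  interpret c: coeff_hom c by fact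
  have mult: "g dvd x * y - x' * y'" if "g dvd x - x'" "g dvd y - y'" for x y x' y' :: 'b
  proof -
    have "x * y - x' * y' = (x - x') * y + x' * (y - y')" by (simp add: algebra_simps)
    then show ?thesis using that by simp
  qed
  have pow: "g dvd t v ^ n - t' v ^ n" for v n
    by (induction n) (auto intro: mult d)
  have prod: "g dvd (\<Prod>v\<in>V. t v ^ coef m v) - (\<Prod>v\<in>V. t' v ^ coef m v)" for V m
    by (induction V rule: infinite_finite_induct) (auto intro: mult pow)
  have m: "g dvd mon_eval t m - mon_eval t' m" for m
    unfolding mon_eval_def by (rule prod)
  show ?thesis
  proof (induction p rule: mpoly_induct)
    case (monom r m)
    then show ?case using m[of m] by (simp add: c.eval_monom right_diff_distrib[symmetric])
  next
    case (add p q)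
    then show ?case using dvd_add[OF add] by (simp add: c.eval_add algebra_simps)
  qed simp
qed

section \<open>Powers of a variable\<close>

lemma Var_power: "Var v ^ n = (Monom (Poly_Mapping.single v n) :: ('v, 'a::comm_ring_1) mpoly)"
  by (induction n) (simp_all add: Var_def Monom_add[symmetric] single_add[symmetric])

lemma Monom_eq_prod: "Monom m = (\<Prod>v\<in>supp m. Var v ^ coef m v :: ('v, 'a::comm_ring_1) mpoly)"
proof -
  have "Monom (\<Sum>v\<in>V. Poly_Mapping.single v (coef m v)) = (\<Prod>v\<in>V. Var v ^ coef m v :: ('v, 'a) mpoly)" for V
    by (induction V rule: infinite_finite_induct) (simp_all add: Monom_add Var_power)
  moreover have "(\<Sum>v\<in>supp m. Poly_Mapping.single v (coef m v)) = m"
    by (rule poly_mapping_eqI) (simp add: lookup_sum lookup_single when_def in_keys_iff)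
  ultimately show ?thesis by metis
qed

lemma mon_Var: "mon_eval Var m = (Monom m :: ('v, 'a::comm_ring_1) mpoly)"
  by (simp add: mon_eval_def Monom_eq_prod)

lemma eval_Const_Var [simp]: "mpoly_eval Const Var p = (p :: ('v, 'a::comm_ring_1) mpoly)"
proof -
  interpret coeff_hom "Const :: 'a \<Rightarrow> ('v, 'a) mpoly" by (rule coeff_hom_Const)
  show ?thesis
    by (induction p rule: mpoly_induct) (simp_all add: eval_add eval_monom mon_Var)
qed

lemma supp_monom: "supp (Const r * Monom m) = (if r = 0 then {} else {m :: 'v \<Rightarrow>\<^sub>0 nat})"
  for r :: "'a::comm_ring_1"
  by (simp add: Const_Monom)

lemma supp_multE:
  fixes p q :: "('v, 'a::comm_ring_1) mpoly"
  assumes "m \<in> supp (p * q)"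
  obtains a b where "a \<in> supp p" "b \<in> supp q" "m = a + b"
  using Poly_Mapping.keys_mult[of p q] assms by auto

lemma Var_power_dvd_iff:
  fixes p :: "('v, 'a::comm_ring_1) mpoly"
  shows "Var v ^ N dvd p \<longleftrightarrow> (\<forall>m\<in>supp p. N \<le> coef m v)"
proof
  assume "Var v ^ N dvd p"
  then obtain q where "p = Monom (Poly_Mapping.single v N) * q"
    unfolding Var_power by (elim dvdE)
  then show "\<forall>m\<in>supp p. N \<le> coef m v"
    by (auto simp: Monom_def lookup_add elim!: supp_multE)
next
  assume N: "\<forall>m\<in>supp p. N \<le> coef m v"
  show "Var v ^ N dvd p"
  proof (induction p rule: mpoly_induct)
    case (monom r m)
    define n where "n = m - Poly_Mapping.single v N"
    have "Poly_Mapping.single v N + n = m"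
      using N monom
      by (intro poly_mapping_eqI) (auto simp: n_def lookup_add lookup_minus lookup_single when_def)
    then have "Const r * Monom m = Var v ^ N * (Const r * Monom n :: ('v, 'a) mpoly)"
      by (metis Monom_add Var_power mult.left_commute)
    then show ?case by simp
  qed auto
qed

lemma Var_ne_0 [simp]: "Var v \<noteq> (0 :: ('v, 'a::comm_ring_1) mpoly)"
  by (simp add: Var_def Monom_def) (metis lookup_single_eq lookup_zero zero_neq_one)

lemma Monom_ne_0 [simp]: "Monom m \<noteq> (0 :: ('v, 'a::comm_ring_1) mpoly)"
  by (simp add: Monom_def) (metis lookup_single_eq lookup_zero zero_neq_one)

lemma coef_Var_power_mult:
  fixes p :: "('v, 'a::comm_ring_1) mpoly"
  shows "coef (Var u ^ M * p) (Poly_Mapping.single u M + m) = coef p m"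
proof (induction p rule: mpoly_induct)
  case (monom r n)
  have "Var u ^ M * (Const r * Monom n) = (Const r * Monom (Poly_Mapping.single u M + n) :: ('v, 'a) mpoly)"
    by (simp add: Var_power Monom_add)
  then show ?case by (simp add: Const_Monom lookup_single when_def)
qed (simp_all add: lookup_add distrib_left)

text \<open>Powers of two different variables form a regular sequence.\<close>

lemma Var_power_dvd_cancel:
  fixes p q :: "('v, 'a::comm_ring_1) mpoly"
  assumes "Var u ^ M * p = Var v ^ N * q" "u \<noteq> v"
  shows "Var v ^ N dvd p"
proof -
  have "N \<le> coef m v" if m: "m \<in> supp p" for m
  proof -
    let ?k = "Poly_Mapping.single u M + m"
    have "coef (Var u ^ M * p) ?k = coef p m" by (rule coef_Var_power_mult)
    with m have "?k \<in> supp (Var u ^ M * p)" by (simp add: in_keys_iff)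
    moreover have "Var v ^ N dvd Var u ^ M * p" using assms by simp
    ultimately have "N \<le> coef ?k v" by (auto simp: Var_power_dvd_iff)
    then show ?thesis using assms(2) by (simp add: lookup_add lookup_single)
  qed
  then show ?thesis by (simp add: Var_power_dvd_iff)
qed

lemma Const_dvd_iff:
  fixes p :: "('v, 'a::comm_ring_1) mpoly"
  shows "Const r dvd p \<longleftrightarrow> (\<forall>m. r dvd coef p m)"
proof
  assume r: "\<forall>m. r dvd coef p m"
  show "Const r dvd p"
  proof (induction p rule: mpoly_induct)
    case (monom s m)
    then obtain u where "s = r * u" using r by (auto elim: dvdE)
    then show ?case by (simp add: Const_mult mult.assoc)
  qed auto
qed (auto elim!: dvdE)

section \<open>Bigraded parts\<close>

lemma forms_0 [simp]: "0 \<in> forms i"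
  by (simp add: forms_def)

lemma forms_add: "p \<in> forms i \<Longrightarrow> q \<in> forms i \<Longrightarrow> p + q \<in> forms i"
  for p :: "('v, 'a::comm_ring_1) mpoly"
  using Poly_Mapping.keys_add[of p q] by (auto simp: forms_def)

lemma forms_mult: "p \<in> forms i \<Longrightarrow> q \<in> forms j \<Longrightarrow> p * q \<in> forms (i + j)"
  for p :: "('v, 'a::comm_ring_1) mpoly"
  by (auto simp: forms_def mdeg_add elim!: supp_multE)

lemma forms_uminus: "p \<in> forms i \<Longrightarrow> - p \<in> forms i"
  for p :: "('v, 'a::comm_ring_1) mpoly"
  by (auto simp: forms_def)

lemma forms_diff: "p \<in> forms i \<Longrightarrow> q \<in> forms i \<Longrightarrow> p - q \<in> forms i"
  for p :: "('v, 'a::comm_ring_1) mpoly"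
  using forms_add[of p i "- q"] forms_uminus[of q i] by simp

lemma forms_sum: "(\<And>j. j \<in> J \<Longrightarrow> h j \<in> forms i) \<Longrightarrow> sum h J \<in> forms i"
  for h :: "'j \<Rightarrow> ('v, 'a::comm_ring_1) mpoly"
  by (induction J rule: infinite_finite_induct) (auto intro: forms_add)

lemma forms_Const [simp]: "Const r \<in> forms 0"
  by (simp add: forms_def Const_def)

lemma forms_monom: "int (mdeg m) = i \<Longrightarrow> Const r * Monom m \<in> forms i"
  for r :: "'a::comm_ring_1"
  by (auto simp: forms_def supp_monom split: if_splits)

lemma forms_Monom: "int (mdeg m) = i \<Longrightarrow> (Monom m :: ('v, 'a::comm_ring_1) mpoly) \<in> forms i"
  using forms_monom[of m i 1] by simp

lemma forms_Var_power: "(Var v ^ n :: ('v, 'a::comm_ring_1) mpoly) \<in> forms (int n)"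
  by (simp add: Var_power forms_Monom)

definition wt :: "('v \<Rightarrow> int) \<Rightarrow> ('v \<Rightarrow>\<^sub>0 nat) \<Rightarrow> int"
  where "wt s m = (\<Sum>v\<in>supp m. int (coef m v) * s v)"

lemma wt_superset: "finite A \<Longrightarrow> supp m \<subseteq> A \<Longrightarrow> wt s m = (\<Sum>v\<in>A. int (coef m v) * s v)"
  unfolding wt_def by (rule sum.mono_neutral_left) (auto simp: in_keys_iff)

lemma wt_add: "wt s (m + n) = wt s m + wt s n"
proof -
  let ?A = "supp m \<union> supp n"
  have "supp (m + n) \<subseteq> ?A" by (rule Poly_Mapping.keys_add)
  then show ?thesis
    by (simp add: wt_superset[of ?A] lookup_add distrib_right sum.distrib)
qed

lemma wt_0 [simp]: "wt s 0 = 0"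
  by (simp add: wt_def)

lemma wt_zero [simp]: "wt (\<lambda>_. 0) m = 0"
  by (simp add: wt_def)

lemma wt_single [simp]: "wt s (Poly_Mapping.single v n) = int n * s v"
  by (simp add: wt_superset[of "{v}"])

text \<open>
  Sets of bidegrees are given by predicates, so that single bidegrees, rows \<open>A\<^sub>i\<^sub>,\<^sub>*\<close> and polynomials of
  fixed degree in the outer variables are all of the form \<open>homog\<close>, and \<open>part\<close> projects onto any of them.
\<close>

definition homog :: "('v \<Rightarrow> int) \<Rightarrow> (int \<Rightarrow> nat \<Rightarrow> bool) \<Rightarrow> ('v, ('x, 'a::zero) mpoly) mpoly set"
  where "homog s P = {p. \<forall>m\<in>supp p. \<forall>k\<in>supp (coef p m). P (int (mdeg k) + wt s m) (mdeg m)}"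

definition part :: "('v \<Rightarrow> int) \<Rightarrow> (int \<Rightarrow> nat \<Rightarrow> bool) \<Rightarrow>
    ('v, ('x, 'a::zero) mpoly) mpoly \<Rightarrow> ('v, ('x, 'a) mpoly) mpoly"
  where "part s P p = Poly_Mapping.mapp (\<lambda>m. Poly_Mapping.mapp
    (\<lambda>k x. x when P (int (mdeg k) + wt s m) (mdeg m))) p"

abbreviation full_row :: "('v \<Rightarrow> int) \<Rightarrow> int \<Rightarrow> ('v, ('x, 'a::zero) mpoly) mpoly set"
  where "full_row s i \<equiv> homog s (\<lambda>i' _. i' = i)"

lemma coef_part: "coef (coef (part s P p) m) k =
    (if P (int (mdeg k) + wt s m) (mdeg m) then coef (coef p m) k else 0)"
  by (auto simp: part_def lookup_mapp when_def in_keys_iff)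

lemma homog_iff:
  "p \<in> homog s P \<longleftrightarrow> (\<forall>m k. coef (coef p m) k \<noteq> 0 \<longrightarrow> P (int (mdeg k) + wt s m) (mdeg m))"
proof -
  have "coef p m \<noteq> 0" if "coef (coef p m) k \<noteq> 0" for m k
    using that by auto
  then show ?thesis unfolding homog_def mem_Collect_eq Ball_def in_keys_iff by blast
qed

lemma bigraded_iff:
  "p \<in> bigraded s i q \<longleftrightarrow> (\<forall>m\<in>supp p. mdeg m = q \<and> coef p m \<in> forms (i - wt s m))"
  by (simp add: bigraded_def wt_def)

lemma bigraded_eq_homog: "bigraded s i q = homog s (\<lambda>i' q'. i' = i \<and> q' = q)"
proof (rule Set.set_eqI, rule iffI)
  fix p :: "('a, ('b, 'c) mpoly) mpoly"
  assume "p \<in> bigraded s i q"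
  then show "p \<in> homog s (\<lambda>i' q'. i' = i \<and> q' = q)"
    by (force simp: bigraded_iff forms_def homog_def)
next
  fix p :: "('a, ('b, 'c) mpoly) mpoly"
  assume p: "p \<in> homog s (\<lambda>i' q'. i' = i \<and> q' = q)"
  have "mdeg m = q \<and> coef p m \<in> forms (i - wt s m)" if m: "m \<in> supp p" for m
  proof -
    from m have "coef p m \<noteq> 0" by (simp add: in_keys_iff)
    then obtain k where "coef (coef p m) k \<noteq> 0" by (metis lookup_zero poly_mapping_eqI)
    then have "mdeg m = q" using p by (auto simp: homog_iff)
    moreover have "int (mdeg k) = i - wt s m" if "k \<in> supp (coef p m)" for k
      using p m that by (force simp: homog_def)
    ultimately show ?thesis by (simp add: forms_def)
  qed
  then show "p \<in> bigraded s i q" by (simp add: bigraded_iff)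
qed

lemma coef_coef_eqI: "(\<And>m k. coef (coef p m) k = coef (coef q m) k) \<Longrightarrow> p = q"
  by (intro poly_mapping_eqI)

lemma part_homog [simp]: "part s P p \<in> homog s P"
  by (auto simp: homog_iff coef_part split: if_splits)

lemma part_id: "p \<in> homog s P \<Longrightarrow> part s P p = p"
  by (rule coef_coef_eqI) (auto simp: homog_iff coef_part)

lemma part_none: "p \<in> homog s Q \<Longrightarrow> (\<And>i q. Q i q \<Longrightarrow> \<not> P i q) \<Longrightarrow> part s P p = 0"
  by (rule coef_coef_eqI) (auto simp: homog_iff coef_part)

lemma part_add: "part s P (p + q) = part s P p + part s P q"
  for p :: "('v, ('x, 'a::comm_ring_1) mpoly) mpoly"
  by (rule coef_coef_eqI) (simp add: coef_part lookup_add)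

lemma part_0 [simp]: "part s P 0 = 0"
  by (rule coef_coef_eqI) (simp add: coef_part)

lemma homog_mono: "p \<in> homog s P \<Longrightarrow> (\<And>i q. P i q \<Longrightarrow> Q i q) \<Longrightarrow> p \<in> homog s Q"
  by (auto simp: homog_iff)

lemma bigraded_row: "p \<in> bigraded s i q \<Longrightarrow> p \<in> full_row s i"
  unfolding bigraded_eq_homog by (auto elim: homog_mono)

lemma homog_0 [simp]: "0 \<in> homog s P"
  by (simp add: homog_iff)

lemma homog_add: "p \<in> homog s P \<Longrightarrow> q \<in> homog s P \<Longrightarrow> p + q \<in> homog s P"
  for p :: "('v, ('x, 'a::comm_ring_1) mpoly) mpoly"
  unfolding homog_iff lookup_add by (metis add_0)

lemma homog_diff: "p \<in> homog s P \<Longrightarrow> q \<in> homog s P \<Longrightarrow> p - q \<in> homog s P"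
  for p :: "('v, ('x, 'a::comm_ring_1) mpoly) mpoly"
  unfolding homog_iff lookup_minus by (metis diff_0_right diff_self)

lemma homog_sum: "(\<And>j. j \<in> J \<Longrightarrow> h j \<in> homog s P) \<Longrightarrow> sum h J \<in> homog s P"
  for h :: "'j \<Rightarrow> ('v, ('x, 'a::comm_ring_1) mpoly) mpoly"
  by (induction J rule: infinite_finite_induct) (auto intro: homog_add)

lemma bigraded_0 [simp]: "0 \<in> bigraded s i q"
  by (simp add: bigraded_eq_homog)

lemma bigraded_add: "p \<in> bigraded s i q \<Longrightarrow> p' \<in> bigraded s i q \<Longrightarrow> p + p' \<in> bigraded s i q"
  for p :: "('v, ('x, 'a::comm_ring_1) mpoly) mpoly"
  by (simp add: bigraded_eq_homog homog_add)

lemma bigraded_diff: "p \<in> bigraded s i q \<Longrightarrow> p' \<in> bigraded s i q \<Longrightarrow> p - p' \<in> bigraded s i q"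
  for p :: "('v, ('x, 'a::comm_ring_1) mpoly) mpoly"
  by (simp add: bigraded_eq_homog homog_diff)

lemma bigraded_sum: "(\<And>j. j \<in> J \<Longrightarrow> h j \<in> bigraded s i q) \<Longrightarrow> sum h J \<in> bigraded s i q"
  for h :: "'j \<Rightarrow> ('v, ('x, 'a::comm_ring_1) mpoly) mpoly"
  by (simp add: bigraded_eq_homog homog_sum)

lemma bigraded_mdeg: "p \<in> bigraded s i q \<Longrightarrow> m \<in> supp p \<Longrightarrow> mdeg m = q"
  by (simp add: bigraded_def)

lemma bigraded_mult:
  fixes p :: "('v, ('x, 'a::comm_ring_1) mpoly) mpoly"
  assumes "p \<in> bigraded s i q" "p' \<in> bigraded s i' q'"
  shows "p * p' \<in> bigraded s (i + i') (q + q')"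
proof (induction p rule: mpoly_induct)
  case (monom r m)
  show ?case
  proof (induction p' rule: mpoly_induct)
    case inner: (monom r' m')
    have r: "mdeg m = q" "r \<in> forms (i - wt s m)" "mdeg m' = q'" "r' \<in> forms (i' - wt s m')"
      using monom inner assms by (simp_all add: bigraded_iff)
    have "r * r' \<in> forms (i + i' - wt s (m + m'))"
      using forms_mult[OF r(2,4)] by (simp add: wt_add algebra_simps)
    moreover have "Const r * Monom m * (Const r' * Monom m') = Const (r * r') * Monom (m + m')"
      by (simp add: Const_mult Monom_add)
    ultimately show ?case
      using r by (simp add: bigraded_iff Const_Monom mdeg_add)
  qed (simp_all add: distrib_left bigraded_add)
qed (simp_all add: distrib_right bigraded_add)

lemma bigraded_Const: "r \<in> forms i \<Longrightarrow> Const r \<in> bigraded s i 0"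
  by (simp add: bigraded_iff Const_def)

lemma bigraded_Monom: "(Monom m :: ('v, ('x, 'a::comm_ring_1) mpoly) mpoly) \<in> bigraded s (wt s m) (mdeg m)"
  by (simp add: bigraded_iff Monom_def) (simp add: forms_def)

lemma bigraded_Const_Monom:
  "r \<in> forms i \<Longrightarrow> i + wt s m = j \<Longrightarrow> mdeg m = q \<Longrightarrow> Const r * Monom m \<in> bigraded s j q"
  for r :: "('x, 'a::comm_ring_1) mpoly"
  using bigraded_mult[OF bigraded_Const[of r i s] bigraded_Monom[of m s]] by auto

lemma bigraded_Var: "(Var v :: ('v, ('x, 'a::comm_ring_1) mpoly) mpoly) \<in> bigraded s (s v) 1"
  using bigraded_Monom[of "Poly_Mapping.single v 1" s] by (simp add: Var_def)

lemma bigraded_1: "(1 :: ('v, ('x, 'a::comm_ring_1) mpoly) mpoly) \<in> bigraded s 0 0"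
  using bigraded_Const[of "1 :: ('x, 'a) mpoly" 0 s] by (simp add: forms_def)

lemma bigraded_power: "p \<in> bigraded s i q \<Longrightarrow> p ^ n \<in> bigraded s (int n * i) (n * q)"
  for p :: "('v, ('x, 'a::comm_ring_1) mpoly) mpoly"
proof (induction n)
  case (Suc n)
  then show ?case
    using bigraded_mult[OF Suc.prems Suc.IH[OF Suc.prems]] by (simp add: algebra_simps)
qed (simp add: bigraded_1)

lemma bigraded_eval:
  fixes t :: "'v \<Rightarrow> ('w, ('x, 'a::comm_ring_1) mpoly) mpoly"
  assumes t: "\<And>v. t v \<in> bigraded s' (s v) 1" and p: "p \<in> bigraded s i q"
  shows "mpoly_eval Const t p \<in> bigraded s' i q"
proof -
  interpret coeff_hom "Const :: ('x, 'a) mpoly \<Rightarrow> ('w, ('x, 'a) mpoly) mpoly"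
    by (rule coeff_hom_Const)
  have prod: "(\<Prod>v\<in>V. t v ^ coef m v) \<in> bigraded s' (\<Sum>v\<in>V. int (coef m v) * s v) (\<Sum>v\<in>V. coef m v)"
    for V m
  proof (induction V rule: infinite_finite_induct)
    case (insert v V)
    then show ?case
      using bigraded_mult[OF bigraded_power[OF t[of v], of "coef m v"] insert.IH] by simp
  qed (simp_all add: bigraded_1)
  show ?thesis
  proof (induction p rule: mpoly_induct)
    case (monom r m)
    then have r: "mdeg m = q" "r \<in> forms (i - wt s m)"
      using p by (simp_all add: bigraded_iff)
    have "mon_eval t m \<in> bigraded s' (wt s m) (mdeg m)"
      using prod[where V = "supp m" and m = m] by (simp add: mon_eval_def wt_def mdeg_def)
    from bigraded_mult[OF bigraded_Const[OF r(2)] this] show ?case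
      using r by (simp add: eval_monom)
  qed (simp_all add: eval_add bigraded_add)
qed

lemma bihomogeneous_induct [case_names bihom add]:
  fixes p :: "('v, ('x, 'a::comm_ring_1) mpoly) mpoly"
  assumes bihom: "\<And>i q x. x \<in> bigraded s i q \<Longrightarrow> P x" and add: "\<And>p q. P p \<Longrightarrow> P q \<Longrightarrow> P (p + q)"
  shows "P p"
proof (induction p rule: mpoly_induct)
  case (monom r m)
  show ?case
  proof (induction r rule: mpoly_induct)
    case (monom a k)
    have "Const (Const a * Monom k) * Monom m \<in> bigraded s (int (mdeg k) + wt s m) (mdeg m)"
      by (rule bigraded_Const_Monom[OF forms_monom]) simp_all
    then show ?case by (rule bihom)
  next
    case (add r r')
    then show ?case using assms(2) by (simp add: Const_add distrib_right)
  next
    case zero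
    then show ?case using bihom[OF bigraded_0] by simp
  qed
next
  case zero
  then show ?case using bihom[OF bigraded_0] by simp
qed (rule add)

text \<open>
  Enough to check on bihomogeneous elements, which span. Applied to multiplication by a bihomogeneous element and to graded
  ring homomorphisms, this makes solutions of the equations below bihomogeneous after the fact: project both sides.
\<close>

lemma part_graded_map:
  fixes \<Phi> :: "('v, ('x, 'a::comm_ring_1) mpoly) mpoly \<Rightarrow> ('w, ('x, 'a) mpoly) mpoly"
  assumes add: "\<And>p q. \<Phi> (p + q) = \<Phi> p + \<Phi> q"
    and graded: "\<And>i q x. x \<in> bigraded s i q \<Longrightarrow> \<Phi> x \<in> bigraded s' (i + a) (q + b)"
  shows "part s' P (\<Phi> p) = \<Phi> (part s (\<lambda>i q. P (i + a) (q + b)) p)"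
proof (induction p rule: bihomogeneous_induct[where s = s])
  case (bihom i q x)
  have 0: "\<Phi> 0 = 0" using add[of 0 0] by simp
  note x = bihom[unfolded bigraded_eq_homog] graded[OF bihom, unfolded bigraded_eq_homog]
  show ?case
  proof (cases "P (i + a) (q + b)")
    case True
    then have "part s (\<lambda>i q. P (i + a) (q + b)) x = x" "part s' P (\<Phi> x) = \<Phi> x"
      using x by (auto intro!: part_id elim!: homog_mono)
    then show ?thesis by simp
  next
    case False
    then have "part s (\<lambda>i q. P (i + a) (q + b)) x = 0" "part s' P (\<Phi> x) = 0"
      using part_none[OF x(1), of "\<lambda>i q. P (i + a) (q + b)"] part_none[OF x(2), of P] by auto
    then show ?thesis by (simp add: 0)
  qed
qed (simp add: add part_add)

lemma part_mult:
  fixes g t :: "('v, ('x, 'a::comm_ring_1) mpoly) mpoly"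
  assumes "g \<in> bigraded s a b"
  shows "part s P (g * t) = g * part s (\<lambda>i q. P (i + a) (q + b)) t"
proof (rule part_graded_map)
  fix i q and x :: "('v, ('x, 'a) mpoly) mpoly"
  assume "x \<in> bigraded s i q"
  from bigraded_mult[OF assms this] show "g * x \<in> bigraded s (i + a) (q + b)"
    by (simp add: add.commute)
qed (simp add: distrib_left)

lemma homog_multE:
  fixes g t :: "('v, ('x, 'a::comm_ring_1) mpoly) mpoly"
  assumes "g \<in> bigraded s a b" "g * t \<in> homog s P"
  obtains t' where "t' \<in> homog s (\<lambda>i q. P (i + a) (q + b))" "g * t = g * t'"
  using part_mult[OF assms(1), of P t] part_id[OF assms(2)] part_homog by metis

lemma part_eval:
  fixes t :: "'v \<Rightarrow> ('w, ('x, 'a::comm_ring_1) mpoly) mpoly"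
  assumes "\<And>v. t v \<in> bigraded s' (s v) 1"
  shows "part s' P (mpoly_eval Const t p) = mpoly_eval Const t (part s P p)"
proof -
  interpret coeff_hom "Const :: ('x, 'a) mpoly \<Rightarrow> ('w, ('x, 'a) mpoly) mpoly"
    by (rule coeff_hom_Const)
  show ?thesis
    using part_graded_map[where \<Phi> = "mpoly_eval Const t" and s = s and s' = s' and a = 0 and b = 0]
    by (simp add: eval_add bigraded_eval[OF assms])
qed

section \<open>Forms in two variables\<close>

lemma UNIV_2_01: "(UNIV :: 2 set) = {0, 1}"
proof -
  have "(0 :: 2) \<in> {1, 2}" using UNIV_2 by blast
  then have "(2 :: 2) = 0" by simp
  then show ?thesis using UNIV_2 by auto
qed

lemma mdeg_2: "mdeg (m :: 2 \<Rightarrow>\<^sub>0 nat) = coef m 0 + coef m 1"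
  using mdeg_superset[OF finite subset_UNIV, of m] by (simp add: UNIV_2_01)

lemma index_2_cases: "(v :: 2) = 0 \<or> v = 1"
  using UNIV_2_01 by auto

lemma coeff_eq_0_imp_Var_dvd:
  fixes p :: "'k::comm_ring_1 polR"
  assumes "u \<noteq> v" "p \<in> forms (int n)" "coef p (Poly_Mapping.single u n) = 0"
  shows "Var v dvd p"
proof -
  have "1 \<le> coef m v" if m: "m \<in> supp p" for m
  proof (rule ccontr)
    assume "\<not> 1 \<le> coef m v"
    then have v: "coef m v = 0" by simp
    have n: "coef m 0 + coef m 1 = n" using assms(2) m by (auto simp: forms_def mdeg_2)
    have "m = Poly_Mapping.single u n"
    proof (rule poly_mapping_eqI)
      fix k show "coef m k = coef (Poly_Mapping.single u n) k"
        using v n assms(1) index_2_cases[of u] index_2_cases[of v] index_2_cases[of k]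
        by (auto simp: lookup_single)
    qed
    then show False using assms(3) m by (simp add: in_keys_iff)
  qed
  then show ?thesis using Var_power_dvd_iff[of v 1 p] by simp
qed

lemma forms_Var_mult_cancel:
  fixes p :: "'k::comm_ring_1 polR"
  assumes "Var v * p \<in> forms i"
  shows "p \<in> forms (i - 1)"
  unfolding forms_def
proof safe
  fix m assume m: "m \<in> supp p"
  have "coef (Var v * p) (Poly_Mapping.single v 1 + m) = coef p m"
    using coef_Var_power_mult[of v 1 p m] by simp
  then have "Poly_Mapping.single v 1 + m \<in> supp (Var v * p)" using m by (simp add: in_keys_iff)
  then show "int (mdeg m) = i - 1" using assms by (auto simp: forms_def mdeg_add)
qed

lemma forms_neg: "i < 0 \<Longrightarrow> p \<in> forms i \<Longrightarrow> p = 0"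
  for p :: "('v, 'a::comm_ring_1) mpoly"
  by (rule ccontr) (auto simp: forms_def simp flip: keys_eq_empty)

text \<open>
  The saturation of a homogeneous ideal of \<open>k[x\<^sub>0, x\<^sub>1]\<close> with respect to a variable is principal: a form
  \<open>G\<close> of least degree in it is not divisible by that variable, so every other form can be reduced modulo \<open>G\<close>
  to a multiple of the variable, and the cofactor again lies in the saturation.
\<close>

lemma saturation_principal:
  fixes a :: "'i::finite \<Rightarrow> 'k::field polR"
  assumes forms: "\<And>j. a j \<in> forms (D j)" and nz: "a j0 \<noteq> 0"
  shows "\<exists>G N c. (\<forall>j. G dvd a j) \<and> Var v ^ N * G = (\<Sum>j\<in>UNIV. c j * a j)"
proof -
  \<comment> \<open>the other variable: the indices 0 and 1 are exchanged\<close>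
  define u where "u = 1 - v"
  have uv: "u \<noteq> v" using index_2_cases[of v] by (auto simp: u_def)
  define J where "J = {p. \<exists>N c. Var v ^ N * p = (\<Sum>j\<in>UNIV. c j * a j)}"
  have J_mult: "q * p \<in> J" if "p \<in> J" for p q
  proof -
    from that obtain N c where "Var v ^ N * p = (\<Sum>j\<in>UNIV. c j * a j)" by (auto simp: J_def)
    then have "Var v ^ N * (q * p) = (\<Sum>j\<in>UNIV. q * c j * a j)"
      by (simp add: mult.left_commute mult.assoc sum_distrib_left[symmetric])
    then show ?thesis unfolding J_def by (intro CollectI exI[of _ N] exI[of _ "\<lambda>j. q * c j"])
  qed
  have J_diff: "p - q \<in> J" if "p \<in> J" "q \<in> J" for p q
  proof -
    from that obtain N c M c' where *: "Var v ^ N * p = (\<Sum>j\<in>UNIV. c j * a j)"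
        "Var v ^ M * q = (\<Sum>j\<in>UNIV. c' j * a j)" by (auto simp: J_def)
    have "Var v ^ (N + M) * (p - q) = Var v ^ M * (Var v ^ N * p) - Var v ^ N * (Var v ^ M * q)"
      by (simp add: algebra_simps power_add)
    also have "\<dots> = (\<Sum>j\<in>UNIV. (Var v ^ M * c j - Var v ^ N * c' j) * a j)"
      unfolding * by (simp add: sum_distrib_left left_diff_distrib sum_subtractf mult.assoc)
    finally show ?thesis
      unfolding J_def by (intro CollectI exI)
  qed
  have J_cancel: "p \<in> J" if "Var v * p \<in> J" for p
  proof -
    from that obtain N c where "Var v ^ N * (Var v * p) = (\<Sum>j\<in>UNIV. c j * a j)" by (auto simp: J_def)
    then have "Var v ^ Suc N * p = (\<Sum>j\<in>UNIV. c j * a j)" by (simp add: mult_ac)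
    then show ?thesis unfolding J_def by blast
  qed
  have J_a: "a j \<in> J" for j
  proof -
    have "Var v ^ 0 * a j = (\<Sum>i\<in>UNIV. (if i = j then 1 else 0) * a i)"
      by (simp add: if_distrib[of "\<lambda>z. z * _"] cong: if_cong)
    then show ?thesis unfolding J_def by (intro CollectI exI)
  qed
  define Q where "Q n \<longleftrightarrow> (\<exists>G. G \<in> J \<and> G \<in> forms (int n) \<and> G \<noteq> 0)" for n
  have deg: "\<exists>n. D j = int n" if "a j \<noteq> 0" for j
    using forms_neg[of "D j" "a j"] forms that by (metis int_nat_eq not_le)
  then have "\<exists>n. Q n" using nz forms[of j0] J_a[of j0] by (metis Q_def)
  define n0 where "n0 = (LEAST n. Q n)"
  have "Q n0" unfolding n0_def by (rule LeastI_ex) fact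
  then obtain G where G: "G \<in> J" "G \<in> forms (int n0)" "G \<noteq> 0" by (auto simp: Q_def)
  have least: "p = 0" if "p \<in> J" "p \<in> forms (int n)" "n < n0" for p n
  proof -
    have "\<not> Q n" using not_less_Least[of n Q] that(3) by (simp only: n0_def not_False_eq_True)
    then show ?thesis using that unfolding Q_def by blast
  qed
  have reduce: "\<exists>p'. p = Var v * p' \<and> p' \<in> J \<and> p' \<in> forms (int n - 1)"
    if p: "p \<in> J" "p \<in> forms (int n)" "coef p (Poly_Mapping.single u n) = 0" for p n
  proof -
    from coeff_eq_0_imp_Var_dvd[OF uv p(2,3)] obtain p' where p': "p = Var v * p'" by (elim dvdE)
    then show ?thesis using J_cancel[of p'] forms_Var_mult_cancel[of v p'] p by blast
  qed
  have lead: "coef G (Poly_Mapping.single u n0) \<noteq> 0"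
  proof
    assume "coef G (Poly_Mapping.single u n0) = 0"
    from reduce[OF G(1,2) this] obtain p' where p': "G = Var v * p'" "p' \<in> J" "p' \<in> forms (int n0 - 1)"
      by blast
    then have "p' = 0"
      using forms_neg[of "int n0 - 1" p'] least[of p' "n0 - 1"] by (cases n0) auto
    then show False using p' G by simp
  qed
  have dvd: "G dvd p" if "p \<in> J" "p \<in> forms (int n)" for p n
    using that
  proof (induction n arbitrary: p rule: less_induct)
    case (less n)
    show ?case
    proof (cases "n < n0")
      case True
      then show ?thesis using least less.prems by auto
    next
      case False
      \<comment> \<open>one step of division by \<open>G\<close>: remove the pure power of the other variable from \<open>p\<close>\<close>
      define c where "c = coef p (Poly_Mapping.single u n) / coef G (Poly_Mapping.single u n0)"
      define q where "q = Const c * Var u ^ (n - n0)"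
      have q: "q \<in> forms (int n - int n0)"
        using forms_mult[OF forms_Const forms_Var_power, of c u "n - n0"] False
        by (simp add: q_def of_nat_diff)
      have "coef (Var u ^ (n - n0) * G) (Poly_Mapping.single u (n - n0) + Poly_Mapping.single u n0)
          = coef G (Poly_Mapping.single u n0)"
        by (rule coef_Var_power_mult)
      moreover have "Poly_Mapping.single u (n - n0) + Poly_Mapping.single u n0 = Poly_Mapping.single u n"
        using False by (simp add: single_add[symmetric])
      ultimately have 0: "coef (p - q * G) (Poly_Mapping.single u n) = 0"
        using lead by (simp add: lookup_minus q_def c_def mult.assoc)
      have "q * G \<in> forms (int n)" using forms_mult[OF q G(2)] by simp
      then have f: "p - q * G \<in> forms (int n)" using less.prems forms_diff by blast
      have "p - q * G \<in> J" using less.prems G(1) J_mult J_diff by blast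
      from reduce[OF this f 0] obtain p' where p': "p - q * G = Var v * p'" "p' \<in> J"
          "p' \<in> forms (int n - 1)" by blast
      have "G dvd p'"
      proof (cases n)
        case 0
        then show ?thesis using forms_neg[of "int n - 1" p'] p' by simp
      next
        case (Suc k)
        then show ?thesis using less.IH[of k p'] p' by simp
      qed
      moreover have "p = q * G + Var v * p'" using p'(1) by (simp add: algebra_simps)
      ultimately show ?thesis by simp
    qed
  qed
  have "G dvd a j" for j
    using dvd[of "a j"] J_a[of j] forms[of j] deg[of j] by (cases "a j = 0") auto
  moreover have "\<exists>N c. Var v ^ N * G = (\<Sum>j\<in>UNIV. c j * a j)" using G(1) by (simp add: J_def)
  ultimately show ?thesis by blast
qed

text \<open>
  For forms without a common factor the generator \<open>G\<close> of the saturation is a unit, so the ideal contains a power of the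
  variable.
\<close>

lemma coprime_forms_Var_power:
  fixes a :: "'i::finite \<Rightarrow> 'k::field polR"
  assumes "\<And>j. a j \<in> forms (D j)" "a j0 \<noteq> 0" "\<And>G. (\<And>j. G dvd a j) \<Longrightarrow> G dvd 1"
  shows "\<exists>N c. (\<Sum>j\<in>UNIV. c j * a j) = Var v ^ N"
proof -
  from saturation_principal[of a D j0 v] assms(1,2) obtain G N c where G: "\<And>j. G dvd a j"
    and eq: "Var v ^ N * G = (\<Sum>j\<in>UNIV. c j * a j)" by blast
  from assms(3)[OF G] obtain h where h: "1 = G * h" by (elim dvdE)
  have "(\<Sum>j\<in>UNIV. (h * c j) * a j) = h * (Var v ^ N * G)"
    unfolding eq by (simp add: sum_distrib_left mult.assoc)
  also have "\<dots> = Var v ^ N * (G * h)" by (simp add: mult_ac)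
  finally have "(\<Sum>j\<in>UNIV. (h * c j) * a j) = Var v ^ N" by (simp add: h[symmetric])
  then show ?thesis by (intro exI)
qed

text \<open>
  Since powers of the two variables form a regular sequence, on \<open>R\<close> and on polynomial rings over \<open>R\<close>, divisibility can be
  tested after multiplication by a power of each.
\<close>

lemma dvd_of_dvd_Var_multiples:
  fixes g s :: "('w::linorder, 'k::field polR) mpoly"
  assumes "u \<noteq> v" "g dvd Const (Var u ^ M) * s" "g dvd Const (Var v ^ N) * s"
  shows "g dvd s"
proof (cases "g = 0")
  case True
  then show ?thesis using assms by simp
next
  case False
  obtain t0 t1 where t: "Const (Var u ^ M) * s = g * t0" "Const (Var v ^ N) * s = g * t1"
    using assms(2,3) by (elim dvdE)
  have "g * (Const (Var v ^ N) * t0) = g * (Const (Var u ^ M) * t1)"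
  proof -
    have "g * (Const (Var v ^ N) * t0) = Const (Var v ^ N) * (g * t0)" by (rule mult.left_commute)
    also have "\<dots> = Const (Var u ^ M) * (Const (Var v ^ N) * s)"
      unfolding t(1)[symmetric] by (rule mult.left_commute)
    also have "\<dots> = g * (Const (Var u ^ M) * t1)" unfolding t(2) by (rule mult.left_commute)
    finally show ?thesis .
  qed
  then have eq: "Const (Var v ^ N) * t0 = Const (Var u ^ M) * t1" using False by simp
  have "Var u ^ M dvd coef t0 m" for m
  proof -
    have "Var v ^ N * coef t0 m = Var u ^ M * coef t1 m"
      using eq by (metis coef_Const_mult)
    then show ?thesis by (rule Var_power_dvd_cancel) (use assms in simp)
  qed
  then have "Const (Var u ^ M) dvd t0" by (simp add: Const_dvd_iff)
  then obtain t where "t0 = Const (Var u ^ M) * t" by (elim dvdE)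
  then have "Const (Var u ^ M) * s = Const (Var u ^ M) * (g * t)"
    using t(1) by (simp only: mult.left_commute)
  then show ?thesis by simp
qed

lemma multiple_of_Var_multiples:
  fixes a y :: "'k::field polR ^ 'n"
  assumes "u \<noteq> v" "a \<noteq> 0" "\<And>j. Var u ^ M * y $ j = r * a $ j" "\<And>j. Var v ^ N * y $ j = s * a $ j"
  shows "\<exists>t. y = t *s a"
proof -
  obtain j where j: "a $ j \<noteq> 0" using assms(2) by (auto simp: vec_eq_iff)
  have "a $ j * (Var v ^ N * r) = a $ j * (Var u ^ M * s)"
  proof -
    have "a $ j * (Var v ^ N * r) = Var v ^ N * (Var u ^ M * y $ j)"
      unfolding assms(3) by (simp only: mult_ac)
    also have "\<dots> = Var u ^ M * (Var v ^ N * y $ j)" by (rule mult.left_commute)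
    also have "\<dots> = a $ j * (Var u ^ M * s)" unfolding assms(4) by (simp only: mult_ac)
    finally show ?thesis .
  qed
  then have "Var v ^ N * r = Var u ^ M * s" using j by simp
  then have "Var u ^ M dvd r" by (rule Var_power_dvd_cancel) (use assms in simp)
  then obtain t where "r = Var u ^ M * t" by (elim dvdE)
  then have "y $ i = t * a $ i" for i using assms(3)[of i] by (simp add: mult.assoc)
  then have "y = t *s a" by (simp add: vec_eq_iff)
  then show ?thesis by blast
qed

section \<open>The presentation of \<open>E\<close> inside its reflexive hull\<close>

lemma det2_mult:
  fixes p q r s x y z t :: "'r::comm_ring_1"
  shows "(p * s - r * q) * (x * t - y * z) =
    (p * x + q * z) * (r * y + s * t) - (p * y + q * t) * (r * x + s * z)"
  by (simp add: algebra_simps)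

lemma det2_kernel:
  fixes p q r s w1 w2 :: "'r::comm_ring_1"
  assumes "p * w1 + q * w2 = 0" "r * w1 + s * w2 = 0"
  shows "w1 * (p * s - r * q) = 0 \<and> w2 * (p * s - r * q) = 0"
proof -
  have "w1 * (p * s - r * q) = s * (p * w1 + q * w2) - q * (r * w1 + s * w2)"
    "w2 * (p * s - r * q) = p * (r * w1 + s * w2) - r * (p * w1 + q * w2)"
    by (simp_all add: algebra_simps)
  then show ?thesis using assms by simp
qed

text \<open>
  In the following three lemmas the matrix of the map \<open>u \<mapsto> a \<times> u\<close> is the product of a matrix \<open>B\<close> with rows
  \<open>(p\<^sub>i, q\<^sub>i)\<close> and a matrix with rows \<open>x\<close> and \<open>y\<close>. Both factors have rank two, because the squares of the entries of \<open>a\<close> are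
  among the \<open>2 \<times> 2\<close> minors of the product.
\<close>

lemma koszul_factor:
  fixes a1 a2 a3 :: "'r::idom"
  assumes a: "a1 \<noteq> 0 \<or> a2 \<noteq> 0 \<or> a3 \<noteq> 0"
    and r1: "p1 * x1 + q1 * y1 = 0" "p1 * x2 + q1 * y2 = - a3" "p1 * x3 + q1 * y3 = a2"
    and r2: "p2 * x1 + q2 * y1 = a3" "p2 * x2 + q2 * y2 = 0" "p2 * x3 + q2 * y3 = - a1"
    and r3: "p3 * x1 + q3 * y1 = - a2" "p3 * x2 + q3 * y2 = a1" "p3 * x3 + q3 * y3 = 0"
  shows koszul_factor_left: "p1 * w1 + q1 * w2 = 0 \<Longrightarrow> p2 * w1 + q2 * w2 = 0 \<Longrightarrow> p3 * w1 + q3 * w2 = 0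
      \<Longrightarrow> w1 = 0 \<and> w2 = 0" (is "?l1 \<Longrightarrow> ?l2 \<Longrightarrow> ?l3 \<Longrightarrow> _")
    and koszul_factor_right: "b1 * x1 + b2 * y1 = 0 \<Longrightarrow> b1 * x2 + b2 * y2 = 0 \<Longrightarrow> b1 * x3 + b2 * y3 = 0
      \<Longrightarrow> b1 = 0 \<and> b2 = 0" (is "?r1 \<Longrightarrow> ?r2 \<Longrightarrow> ?r3 \<Longrightarrow> _")
proof -
  have m1: "(p2 * q3 - p3 * q2) * (x2 * y3 - x3 * y2) = a1 * a1"
    and m2: "(p1 * q3 - p3 * q1) * (x1 * y3 - x3 * y1) = a2 * a2"
    and m3: "(p1 * q2 - p2 * q1) * (x1 * y2 - x2 * y1) = a3 * a3"
    unfolding det2_mult r1 r2 r3 by simp_all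
  show "w1 = 0 \<and> w2 = 0" if w: ?l1 ?l2 ?l3
  proof -
    have d1: "w1 * (p2 * q3 - p3 * q2) = 0 \<and> w2 * (p2 * q3 - p3 * q2) = 0"
      using w by (intro det2_kernel)
    have d2: "w1 * (p1 * q3 - p3 * q1) = 0 \<and> w2 * (p1 * q3 - p3 * q1) = 0"
      using w by (intro det2_kernel)
    have d3: "w1 * (p1 * q2 - p2 * q1) = 0 \<and> w2 * (p1 * q2 - p2 * q1) = 0"
      using w by (intro det2_kernel)
    show ?thesis
    proof (rule ccontr)
      assume "\<not> ?thesis"
      then have "p2 * q3 - p3 * q2 = 0" "p1 * q3 - p3 * q1 = 0" "p1 * q2 - p2 * q1 = 0"
        using d1 d2 d3 by auto
      then show False using a m1 m2 m3 by auto
    qed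
  qed
  show "b1 = 0 \<and> b2 = 0" if w: ?r1 ?r2 ?r3
  proof -
    have d1: "b1 * (x2 * y3 - x3 * y2) = 0 \<and> b2 * (x2 * y3 - x3 * y2) = 0"
      using w det2_kernel[of x2 b1 y2 b2 x3 y3] by (simp add: mult.commute)
    have d2: "b1 * (x1 * y3 - x3 * y1) = 0 \<and> b2 * (x1 * y3 - x3 * y1) = 0"
      using w det2_kernel[of x1 b1 y1 b2 x3 y3] by (simp add: mult.commute)
    have d3: "b1 * (x1 * y2 - x2 * y1) = 0 \<and> b2 * (x1 * y2 - x2 * y1) = 0"
      using w det2_kernel[of x1 b1 y1 b2 x2 y2] by (simp add: mult.commute)
    show ?thesis
    proof (rule ccontr)
      assume "\<not> ?thesis"
      then have "x2 * y3 - x3 * y2 = 0" "x1 * y3 - x3 * y1 = 0" "x1 * y2 - x2 * y1 = 0"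
        using d1 d2 d3 by auto
      then show False using a m1 m2 m3 by auto
    qed
  qed
qed

text \<open>
  Let \<open>\<kappa> = c \<cdot> a\<close>. For \<open>u = (B w) \<times> c\<close> one has \<open>a \<times> u = \<kappa> B w - (a \<cdot> B w) c\<close>, and \<open>a \<cdot> B w = 0\<close> because \<open>a\<close> is
  orthogonal to the image of the product and the second factor has rank two. So \<open>B\<close> takes the same value on \<open>\<kappa> w\<close> and on the
  image of \<open>u\<close> under the second factor, and \<open>B\<close> is injective.
\<close>

lemma koszul_solve:
  fixes a1 a2 a3 :: "'r::idom"
  assumes a: "a1 \<noteq> 0 \<or> a2 \<noteq> 0 \<or> a3 \<noteq> 0"
    and r1: "p1 * x1 + q1 * y1 = 0" "p1 * x2 + q1 * y2 = - a3" "p1 * x3 + q1 * y3 = a2"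
    and r2: "p2 * x1 + q2 * y1 = a3" "p2 * x2 + q2 * y2 = 0" "p2 * x3 + q2 * y3 = - a1"
    and r3: "p3 * x1 + q3 * y1 = - a2" "p3 * x2 + q3 * y2 = a1" "p3 * x3 + q3 * y3 = 0"
  shows "\<exists>u1 u2 u3. x1 * u1 + x2 * u2 + x3 * u3 = (c1 * a1 + c2 * a2 + c3 * a3) * w1 \<and>
    y1 * u1 + y2 * u2 + y3 * u3 = (c1 * a1 + c2 * a2 + c3 * a3) * w2"
proof -
  define P where "P = a1 * p1 + a2 * p2 + a3 * p3"
  define Q where "Q = a1 * q1 + a2 * q2 + a3 * q3"
  have "P * x + Q * y = a1 * (p1 * x + q1 * y) + a2 * (p2 * x + q2 * y) + a3 * (p3 * x + q3 * y)" for x y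
    by (simp add: P_def Q_def algebra_simps)
  note PQ_eq = this
  have "P * x1 + Q * y1 = 0" "P * x2 + Q * y2 = 0" "P * x3 + Q * y3 = 0"
    unfolding PQ_eq r1 r2 r3 by (simp_all add: mult.commute)
  then have PQ: "P = 0 \<and> Q = 0" by (rule koszul_factor_right[OF a r1 r2 r3])
  define e1 e2 e3 where "e1 = p1 * w1 + q1 * w2" and "e2 = p2 * w1 + q2 * w2" and "e3 = p3 * w1 + q3 * w2"
  have orth: "a1 * e1 + a2 * e2 + a3 * e3 = 0"
    using PQ_eq[of w1 w2] PQ by (simp add: e1_def e2_def e3_def)
  define u1 u2 u3 where "u1 = e2 * c3 - e3 * c2" and "u2 = e3 * c1 - e1 * c3" and "u3 = e1 * c2 - e2 * c1"
  define \<kappa> where "\<kappa> = c1 * a1 + c2 * a2 + c3 * a3"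
  define z1 where "z1 = x1 * u1 + x2 * u2 + x3 * u3 - \<kappa> * w1"
  define z2 where "z2 = y1 * u1 + y2 * u2 + y3 * u3 - \<kappa> * w2"
  have z_eq: "p * z1 + q * z2 = (p * x1 + q * y1) * u1 + (p * x2 + q * y2) * u2 + (p * x3 + q * y3) * u3
      - \<kappa> * (p * w1 + q * w2)" for p q
    by (simp add: z1_def z2_def algebra_simps)
  have 1: "p1 * z1 + q1 * z2 = - c1 * (a1 * e1 + a2 * e2 + a3 * e3)"
    unfolding z_eq r1 e1_def[symmetric] u2_def u3_def \<kappa>_def by (simp add: algebra_simps)
  have 2: "p2 * z1 + q2 * z2 = - c2 * (a1 * e1 + a2 * e2 + a3 * e3)"
    unfolding z_eq r2 e2_def[symmetric] u1_def u3_def \<kappa>_def by (simp add: algebra_simps)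
  have 3: "p3 * z1 + q3 * z2 = - c3 * (a1 * e1 + a2 * e2 + a3 * e3)"
    unfolding z_eq r3 e3_def[symmetric] u1_def u2_def \<kappa>_def by (simp add: algebra_simps)
  have "z1 = 0 \<and> z2 = 0"
    by (rule koszul_factor_left[OF a r1 r2 r3]) (simp_all only: 1 2 3 orth mult_zero_right)
  then show ?thesis
    unfolding \<kappa>_def[symmetric] by (intro exI[of _ u1] exI[of _ u2] exI[of _ u3]) (simp add: z1_def z2_def)
qed

lemma koszul_kernel:
  fixes a1 a2 a3 :: "'r::comm_ring_1"
  assumes u: "x1 * u1 + x2 * u2 + x3 * u3 = 0" "y1 * u1 + y2 * u2 + y3 * u3 = 0"
    and r1: "p1 * x1 + q1 * y1 = 0" "p1 * x2 + q1 * y2 = - a3" "p1 * x3 + q1 * y3 = a2"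
    and r2: "p2 * x1 + q2 * y1 = a3" "p2 * x2 + q2 * y2 = 0" "p2 * x3 + q2 * y3 = - a1"
    and r3: "p3 * x1 + q3 * y1 = - a2" "p3 * x2 + q3 * y2 = a1" "p3 * x3 + q3 * y3 = 0"
  shows "(c1 * a1 + c2 * a2 + c3 * a3) * u1 = (c1 * u1 + c2 * u2 + c3 * u3) * a1"
    "(c1 * a1 + c2 * a2 + c3 * a3) * u2 = (c1 * u1 + c2 * u2 + c3 * u3) * a2"
    "(c1 * a1 + c2 * a2 + c3 * a3) * u3 = (c1 * u1 + c2 * u2 + c3 * u3) * a3"
proof -
  have "(p * x1 + q * y1) * u1 + (p * x2 + q * y2) * u2 + (p * x3 + q * y3) * u3 =
      p * (x1 * u1 + x2 * u2 + x3 * u3) + q * (y1 * u1 + y2 * u2 + y3 * u3)" for p q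
    by (simp add: algebra_simps)
  then have eq: "(p * x1 + q * y1) * u1 + (p * x2 + q * y2) * u2 + (p * x3 + q * y3) * u3 = 0" for p q
    by (simp add: u)
  have k1: "a2 * u3 = a3 * u2" using eq[of p1 q1] unfolding r1 by simp
  have k2: "a3 * u1 = a1 * u3" using eq[of p2 q2] unfolding r2 by simp
  have k3: "a1 * u2 = a2 * u1" using eq[of p3 q3] unfolding r3 by simp
  have "(c1 * a1 + c2 * a2 + c3 * a3) * u1 - (c1 * u1 + c2 * u2 + c3 * u3) * a1 =
      c2 * (a2 * u1 - a1 * u2) + c3 * (a3 * u1 - a1 * u3)" by (simp add: algebra_simps)
  then show "(c1 * a1 + c2 * a2 + c3 * a3) * u1 = (c1 * u1 + c2 * u2 + c3 * u3) * a1"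
    by (simp add: k1 k2 k3)
  have "(c1 * a1 + c2 * a2 + c3 * a3) * u2 - (c1 * u1 + c2 * u2 + c3 * u3) * a2 =
      c1 * (a1 * u2 - a2 * u1) + c3 * (a3 * u2 - a2 * u3)" by (simp add: algebra_simps)
  then show "(c1 * a1 + c2 * a2 + c3 * a3) * u2 = (c1 * u1 + c2 * u2 + c3 * u3) * a2"
    by (simp add: k1 k2 k3)
  have "(c1 * a1 + c2 * a2 + c3 * a3) * u3 - (c1 * u1 + c2 * u2 + c3 * u3) * a3 =
      c1 * (a1 * u3 - a3 * u1) + c2 * (a2 * u3 - a3 * u2)" by (simp add: algebra_simps)
  then show "(c1 * a1 + c2 * a2 + c3 * a3) * u3 = (c1 * u1 + c2 * u2 + c3 * u3) * a3"
    by (simp add: k1 k2 k3)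
qed

definition lin :: "'a::comm_ring_1 ^ 'n \<Rightarrow> ('n::finite, 'a) mpoly"
  where "lin u = (\<Sum>i\<in>UNIV. Var i * Const (u $ i))"

lemma vars_mult_eq_lin: "vars_mult A j = lin (column j A)"
  by (simp add: vars_mult_def lin_def column_def)

lemma lin_smult: "lin (r *s u) = Const r * lin u"
  by (simp add: lin_def sum_distrib_left Const_mult mult_ac)

lemma lin_add: "lin (u + v) = lin u + lin v"
  by (simp add: lin_def Const_add distrib_left sum.distrib)

lemma lin_0 [simp]: "lin 0 = 0"
  by (simp add: lin_def)

lemma lin_sum: "lin (sum h I) = (\<Sum>i\<in>I. lin (h i))"
  by (induction I rule: infinite_finite_induct) (simp_all add: lin_add)

lemma lin_axis: "lin (axis j 1) = Var j"
proof -
  have "lin (axis j 1) = (\<Sum>i\<in>UNIV. if i = j then Var i else 0 :: ('a, 'b) mpoly)"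
    unfolding lin_def by (rule sum.cong) (auto simp: axis_def)
  then show ?thesis by simp
qed

lemma lin_bigraded:
  fixes u :: "('x, 'a::comm_ring_1) mpoly ^ 'n::finite"
  assumes "\<And>j. u $ j \<in> forms (e - s j)"
  shows "lin u \<in> bigraded s e 1"
  unfolding lin_def
proof (rule bigraded_sum)
  fix j
  show "Var j * Const (u $ j) \<in> bigraded s e 1"
    using bigraded_mult[OF bigraded_Var[of j s] bigraded_Const[OF assms, of j s]] by simp
qed

lemma coef_lin: "coef (lin u) (Poly_Mapping.single j 1) = u $ j"
proof -
  have "coef (lin u) (Poly_Mapping.single j 1) =
      (\<Sum>i\<in>UNIV. if i = j then u $ i else 0)"
    unfolding lin_def lookup_sum
    by (rule sum.cong)
      (auto simp: Var_def mult.commute[of "Monom _"] Const_Monom lookup_single when_def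
        dest!: arg_cong[where f = Poly_Mapping.keys])
  then show ?thesis by simp
qed

lemma lin_eq_0_iff: "lin u = 0 \<longleftrightarrow> u = 0"
  by (metis coef_lin lin_0 lookup_zero vec_eq_iff zero_index)

lemma eval_lin:
  assumes "coeff_hom c"
  shows "mpoly_eval c t (lin u) = (\<Sum>i\<in>UNIV. t i * c (u $ i))"
proof -
  interpret coeff_hom c by fact
  show ?thesis by (simp add: lin_def eval_sum eval_mult)
qed

lemma matrix_vector_mult_smult: "A *v (r *s u) = r *s (A *v u)" for r :: "'a::comm_ring_1"
  by (simp add: vec_eq_iff matrix_vector_mult_def sum_distrib_left mult_ac)

lemma eval_vars_mult_lin: "mpoly_eval Const (vars_mult A) (lin u) = lin (A *v u)"
proof -
  have "mpoly_eval Const (vars_mult A) (lin u) =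
      (\<Sum>j\<in>UNIV. \<Sum>i\<in>UNIV. Var i * Const (A $ i $ j * u $ j))"
    by (simp add: eval_lin[OF coeff_hom_Const] vars_mult_def sum_distrib_right Const_mult mult.assoc)
  also have "\<dots> = lin (A *v u)"
    unfolding lin_def matrix_vector_mult_def
    by (subst sum.swap) (simp add: Const_sum sum_distrib_left)
  finally show ?thesis .
qed

text \<open>
  The column \<open>a\<close> presents \<open>E = R\<^sup>3 / R a\<close>, which is torsionfree because the entries of \<open>a\<close> are coprime, and the rows of \<open>\<xi>\<close>
  generate the module of all linear forms on \<open>E\<close>.
\<close>

locale presentation =
  fixes a :: "'k::field polR ^ 3" and \<xi> :: "'k polR ^ 3 ^ 2" and d1 :: nat and \<sigma> :: "2 \<Rightarrow> nat"
  assumes a_nonzero: "a \<noteq> 0"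
    and a_forms: "\<And>j. a $ j \<in> forms (int d1)"
    and a_coprime: "\<And>G. (\<And>j. G dvd a $ j) \<Longrightarrow> G dvd 1"
    and \<xi>_forms: "\<And>i j. \<xi> $ i $ j \<in> forms (int (\<sigma> i))"
    and \<xi>_a: "\<xi> *v a = 0"
    and \<xi>_rows: "\<And>l. (\<Sum>j\<in>UNIV. l $ j * a $ j) = 0 \<Longrightarrow>
      \<exists>b1 b2. \<forall>j. l $ j = b1 * \<xi> $ 1 $ j + b2 * \<xi> $ 2 $ j"
begin

lemma a_cases: "a $ 1 \<noteq> 0 \<or> a $ 2 \<noteq> 0 \<or> a $ 3 \<noteq> 0"
  using a_nonzero by (auto simp: vec_eq_iff forall_3)

lemma a_Var_power: "\<exists>N. \<exists>c :: 3 \<Rightarrow> 'k polR. c 1 * a $ 1 + c 2 * a $ 2 + c 3 * a $ 3 = Var v ^ N"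
proof -
  obtain j where "a $ j \<noteq> 0" using a_cases by blast
  then have "\<exists>N c. (\<Sum>j\<in>UNIV. c j * a $ j) = Var v ^ N"
    using coprime_forms_Var_power[of "\<lambda>j. a $ j" "\<lambda>_. int d1" j v] a_forms a_coprime by blast
  then show ?thesis by (simp add: sum_3)
qed

lemma mult_\<xi>: "(\<xi> *v u) $ i = \<xi> $ i $ 1 * u $ 1 + \<xi> $ i $ 2 * u $ 2 + \<xi> $ i $ 3 * u $ 3"
  by (simp add: matrix_vector_mult_def sum_3)

lemma koszul_rows:
  obtains p1 q1 p2 q2 p3 q3 where
    "p1 * \<xi> $ 1 $ 1 + q1 * \<xi> $ 2 $ 1 = 0" "p1 * \<xi> $ 1 $ 2 + q1 * \<xi> $ 2 $ 2 = - a $ 3" "p1 * \<xi> $ 1 $ 3 + q1 * \<xi> $ 2 $ 3 = a $ 2"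
    "p2 * \<xi> $ 1 $ 1 + q2 * \<xi> $ 2 $ 1 = a $ 3" "p2 * \<xi> $ 1 $ 2 + q2 * \<xi> $ 2 $ 2 = 0" "p2 * \<xi> $ 1 $ 3 + q2 * \<xi> $ 2 $ 3 = - a $ 1"
    "p3 * \<xi> $ 1 $ 1 + q3 * \<xi> $ 2 $ 1 = - a $ 2" "p3 * \<xi> $ 1 $ 2 + q3 * \<xi> $ 2 $ 2 = a $ 1" "p3 * \<xi> $ 1 $ 3 + q3 * \<xi> $ 2 $ 3 = 0"
proof -
  have row: "\<exists>b1 b2. b1 * \<xi> $ 1 $ 1 + b2 * \<xi> $ 2 $ 1 = l1 \<and> b1 * \<xi> $ 1 $ 2 + b2 * \<xi> $ 2 $ 2 = l2 \<and>
      b1 * \<xi> $ 1 $ 3 + b2 * \<xi> $ 2 $ 3 = l3"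
    if "l1 * a $ 1 + l2 * a $ 2 + l3 * a $ 3 = 0" for l1 l2 l3
  proof -
    define l :: "'k polR ^ 3" where "l = (\<chi> j. if j = 1 then l1 else if j = 2 then l2 else l3)"
    have l: "l $ 1 = l1" "l $ 2 = l2" "l $ 3 = l3" by (simp_all add: l_def)
    have "(\<Sum>j\<in>UNIV. l $ j * a $ j) = 0" using that by (simp add: sum_3 l)
    from \<xi>_rows[OF this] show ?thesis unfolding forall_3 l by metis
  qed
  have "0 * a $ 1 + - a $ 3 * a $ 2 + a $ 2 * a $ 3 = 0" by (simp add: mult.commute)
  from row[OF this] obtain p1 q1 where 1: "p1 * \<xi> $ 1 $ 1 + q1 * \<xi> $ 2 $ 1 = 0"
      "p1 * \<xi> $ 1 $ 2 + q1 * \<xi> $ 2 $ 2 = - a $ 3" "p1 * \<xi> $ 1 $ 3 + q1 * \<xi> $ 2 $ 3 = a $ 2"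
    by blast
  have "a $ 3 * a $ 1 + 0 * a $ 2 + - a $ 1 * a $ 3 = 0" by (simp add: mult.commute)
  from row[OF this] obtain p2 q2 where 2: "p2 * \<xi> $ 1 $ 1 + q2 * \<xi> $ 2 $ 1 = a $ 3"
      "p2 * \<xi> $ 1 $ 2 + q2 * \<xi> $ 2 $ 2 = 0" "p2 * \<xi> $ 1 $ 3 + q2 * \<xi> $ 2 $ 3 = - a $ 1"
    by blast
  have "- a $ 2 * a $ 1 + a $ 1 * a $ 2 + 0 * a $ 3 = 0" by (simp add: mult.commute)
  from row[OF this] obtain p3 q3 where 3: "p3 * \<xi> $ 1 $ 1 + q3 * \<xi> $ 2 $ 1 = - a $ 2"
      "p3 * \<xi> $ 1 $ 2 + q3 * \<xi> $ 2 $ 2 = a $ 1" "p3 * \<xi> $ 1 $ 3 + q3 * \<xi> $ 2 $ 3 = 0"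
    by blast
  show thesis by (rule that[OF 1 2 3])
qed

text \<open>
  The rows of the Koszul matrix of \<open>a\<close> are linear forms on \<open>E\<close>, hence combinations of the rows of \<open>\<xi>\<close>. Since a power of each
  variable has the form \<open>c \<cdot> a\<close>, it annihilates \<open>F/E\<close>.
\<close>

lemma coker_\<xi>_finite: "\<exists>N. \<forall>w. \<exists>u. \<xi> *v u = Var v ^ N *s w"
proof -
  obtain N and c :: "3 \<Rightarrow> 'k polR" where c: "c 1 * a $ 1 + c 2 * a $ 2 + c 3 * a $ 3 = Var v ^ N"
    using a_Var_power by blast
  have "\<exists>u. \<xi> *v u = Var v ^ N *s w" for w
  proof -
    obtain u1 u2 u3 where u: "\<xi> $ 1 $ 1 * u1 + \<xi> $ 1 $ 2 * u2 + \<xi> $ 1 $ 3 * u3 = Var v ^ N * w $ 1"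
        "\<xi> $ 2 $ 1 * u1 + \<xi> $ 2 $ 2 * u2 + \<xi> $ 2 $ 3 * u3 = Var v ^ N * w $ 2"
      by (rule koszul_rows) (use koszul_solve[OF a_cases, where ?c1.0 = "c 1" and ?c2.0 = "c 2" and ?c3.0 = "c 3", unfolded c] in blast)
    define u :: "'k polR ^ 3" where "u = (\<chi> j. if j = 1 then u1 else if j = 2 then u2 else u3)"
    have "u $ 1 = u1" "u $ 2 = u2" "u $ 3 = u3" by (simp_all add: u_def)
    then have "\<xi> *v u = Var v ^ N *s w"
      using u unfolding vec_eq_iff forall_2 mult_\<xi> by simp
    then show ?thesis by blast
  qed
  then show ?thesis by blast
qed

lemma ker_\<xi>:
  assumes "\<xi> *v u = 0"
  shows "\<exists>t. u = t *s a"
proof -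
  have u: "\<xi> $ 1 $ 1 * u $ 1 + \<xi> $ 1 $ 2 * u $ 2 + \<xi> $ 1 $ 3 * u $ 3 = 0"
      "\<xi> $ 2 $ 1 * u $ 1 + \<xi> $ 2 $ 2 * u $ 2 + \<xi> $ 2 $ 3 * u $ 3 = 0"
    using assms mult_\<xi>[of u 1] mult_\<xi>[of u 2] by simp_all
  have multiples: "\<exists>N r. \<forall>j. Var v ^ N * u $ j = r * a $ j" for v
  proof -
    obtain N and c :: "3 \<Rightarrow> 'k polR" where c: "c 1 * a $ 1 + c 2 * a $ 2 + c 3 * a $ 3 = Var v ^ N"
      using a_Var_power by blast
    show ?thesis
    proof (rule koszul_rows)
      fix p1 q1 p2 q2 p3 q3
      assume pq:
    "p1 * \<xi> $ 1 $ 1 + q1 * \<xi> $ 2 $ 1 = 0" "p1 * \<xi> $ 1 $ 2 + q1 * \<xi> $ 2 $ 2 = - a $ 3" "p1 * \<xi> $ 1 $ 3 + q1 * \<xi> $ 2 $ 3 = a $ 2"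
    "p2 * \<xi> $ 1 $ 1 + q2 * \<xi> $ 2 $ 1 = a $ 3" "p2 * \<xi> $ 1 $ 2 + q2 * \<xi> $ 2 $ 2 = 0" "p2 * \<xi> $ 1 $ 3 + q2 * \<xi> $ 2 $ 3 = - a $ 1"
    "p3 * \<xi> $ 1 $ 1 + q3 * \<xi> $ 2 $ 1 = - a $ 2" "p3 * \<xi> $ 1 $ 2 + q3 * \<xi> $ 2 $ 2 = a $ 1" "p3 * \<xi> $ 1 $ 3 + q3 * \<xi> $ 2 $ 3 = 0"
      show ?thesis
        using koszul_kernel[OF u pq, where ?c1.0 = "c 1" and ?c2.0 = "c 2" and ?c3.0 = "c 3"]
        unfolding c forall_3 by blast
    qed
  qed
  obtain M r N s where "\<forall>j. Var 0 ^ M * u $ j = r * a $ j" "\<forall>j. Var 1 ^ N * u $ j = s * a $ j"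
    using multiples[of 0] multiples[of 1] by blast
  then show ?thesis
    using multiple_of_Var_multiples[of 0 1 a M u r N s] a_nonzero by simp
qed

abbreviation \<psi> :: "'k polS \<Rightarrow> 'k polF"
  where "\<psi> \<equiv> to_ReesF \<xi>"

abbreviation g1 :: "'k polS"
  where "g1 \<equiv> lin a"

lemma \<psi>_coeff_hom: "coeff_hom \<psi>"
  unfolding to_ReesF_def by (rule coeff_hom.eval_hom[OF coeff_hom_Const])

sublocale psi: coeff_hom \<psi>
  by (rule \<psi>_coeff_hom)

lemma \<psi>_Const [simp]: "\<psi> (Const r) = Const r"
  unfolding to_ReesF_def by (rule coeff_hom.eval_Const[OF coeff_hom_Const])

lemma \<psi>_lin: "\<psi> (lin u) = lin (\<xi> *v u)"
  by (simp add: to_ReesF_def eval_vars_mult_lin)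

lemma \<psi>_Var: "\<psi> (Var j) = lin (\<xi> *v axis j 1)"
  using \<psi>_lin[of "axis j 1"] by (simp add: lin_axis)

lemma \<psi>_g1: "\<psi> g1 = 0"
  by (simp add: \<psi>_lin \<xi>_a)

lemma vars_mult_\<xi>_bigraded: "vars_mult \<xi> j \<in> F_comp \<sigma> 0 1"
  unfolding vars_mult_eq_lin by (rule lin_bigraded) (simp add: column_def \<xi>_forms)

lemma \<psi>_bigraded: "h \<in> S_comp i q \<Longrightarrow> \<psi> h \<in> F_comp \<sigma> i q"
  unfolding to_ReesF_def by (rule bigraded_eval[OF vars_mult_\<xi>_bigraded])

lemma part_\<psi>: "part (\<lambda>i. - int (\<sigma> i)) P (\<psi> h) = \<psi> (part (\<lambda>_. 0) P h)"
  unfolding to_ReesF_def by (rule part_eval[OF vars_mult_\<xi>_bigraded])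

lemma g1_bigraded: "g1 \<in> S_comp (int d1) 1"
  by (rule lin_bigraded) (simp add: a_forms)

text \<open>
  After inverting a variable \<open>x\<close> of \<open>R\<close> the sequence \<open>0 \<rightarrow> R \<rightarrow> R\<^sup>3 \<rightarrow> F \<rightarrow> 0\<close> given by \<open>a\<close> and \<open>\<xi>\<close> is split exact;
  \<open>\<eta>\<close> is the map of symmetric algebras induced by \<open>x\<^sup>N\<close> times a splitting.
\<close>

lemma splitting:
  "\<exists>\<eta> N. (\<forall>i q. \<forall>s\<in>F_comp \<sigma> i q. \<psi> (\<eta> s) = Const (Var v ^ (N * q)) * s) \<and>
    (\<forall>q h. (\<forall>m\<in>supp h. mdeg m = q) \<longrightarrow> g1 dvd \<eta> (\<psi> h) - Const (Var v ^ (N * q)) * h)"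
proof -
  obtain N where "\<forall>w. \<exists>u. \<xi> *v u = Var v ^ N *s w" using coker_\<xi>_finite by blast
  from choice[OF this] obtain u where u: "\<forall>w. \<xi> *v u w = Var v ^ N *s w" by blast
  define U where "U i = u (axis i 1)" for i
  have U: "\<xi> *v U i = Var v ^ N *s axis i 1" for i using u by (simp add: U_def)
  define \<eta> :: "'k polF \<Rightarrow> 'k polS" where "\<eta> = mpoly_eval Const (\<lambda>i. lin (U i))"
  have \<psi>_\<eta>: "\<psi> (\<eta> s) = Const (Var v ^ (N * q)) * s" if "s \<in> F_comp \<sigma> i q" for s i q
  proof -
    have "\<psi> (\<eta> s) = mpoly_eval Const (\<lambda>i. Const (Var v ^ N) * Var i) s"
      unfolding \<eta>_def hom_mpoly_eval[OF \<psi>_coeff_hom coeff_hom_Const]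
      by (simp add: \<psi>_lin U lin_smult lin_axis)
    also have "\<dots> = Const (Var v ^ N) ^ q * s"
      using that by (subst coeff_hom.eval_scale[OF coeff_hom_Const]) (auto dest: bigraded_mdeg)
    finally show ?thesis by (simp add: Const_power power_mult)
  qed
  have \<eta>_lin: "\<eta> (lin w) = lin (\<Sum>i\<in>UNIV. w $ i *s U i)" for w
    unfolding \<eta>_def by (simp add: eval_lin[OF coeff_hom_Const] lin_sum lin_smult mult.commute)
  have dvd_T: "g1 dvd \<eta> (\<psi> (Var j)) - Const (Var v ^ N) * Var j" for j
  proof -
    define z where "z = (\<Sum>i\<in>UNIV. (\<xi> *v axis j 1) $ i *s U i) + (- (Var v ^ N)) *s axis j 1"
    have "\<xi> *v z = (\<Sum>i\<in>UNIV. (\<xi> *v axis j 1) $ i *s (\<xi> *v U i)) + (- (Var v ^ N)) *s (\<xi> *v axis j 1)"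
      unfolding z_def sum_2
      by (simp only: matrix_vector_right_distrib matrix_vector_mult_smult)
    also have "\<dots> = 0"
      unfolding U sum_2 by (auto simp: vec_eq_iff forall_2 axis_def mult.commute)
    finally obtain t where t: "z = t *s a" using ker_\<xi> by blast
    have "\<eta> (\<psi> (Var j)) - Const (Var v ^ N) * Var j = lin z"
      unfolding \<psi>_Var \<eta>_lin z_def lin_add lin_smult lin_axis by (simp add: Const_uminus)
    also have "\<dots> = Const t * g1" unfolding t lin_smult ..
    finally show ?thesis by simp
  qed
  have "g1 dvd \<eta> (\<psi> h) - Const (Var v ^ (N * q)) * h" if h: "\<And>m. m \<in> supp h \<Longrightarrow> mdeg m = q" for h q
  proof -
    have \<eta>: "coeff_hom \<eta>" unfolding \<eta>_def by (rule coeff_hom.eval_hom[OF coeff_hom_Const])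
    have "\<eta> (Const r) = Const r" for r
      unfolding \<eta>_def by (rule coeff_hom.eval_Const[OF coeff_hom_Const])
    then have "\<eta> (\<psi> h) = mpoly_eval Const (\<lambda>j. \<eta> (\<psi> (Var j))) h"
      using hom_mpoly_eval[OF coeff_hom_comp[OF \<eta> \<psi>_coeff_hom] coeff_hom_Const, of Var h] by simp
    moreover have "mpoly_eval Const (\<lambda>j. Const (Var v ^ N) * Var j) h = Const (Var v ^ N) ^ q * h"
      using h by (subst coeff_hom.eval_scale[OF coeff_hom_Const]) auto
    moreover have "g1 dvd mpoly_eval Const (\<lambda>j. \<eta> (\<psi> (Var j))) h -
        mpoly_eval Const (\<lambda>j. Const (Var v ^ N) * Var j) h"
      by (rule eval_cong_dvd[OF coeff_hom_Const]) (rule dvd_T)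
    ultimately show ?thesis by (simp only: Const_power power_mult)
  qed
  with \<psi>_\<eta> show ?thesis by blast
qed

lemma ker_\<psi>_homogeneous:
  assumes h: "\<And>m. m \<in> supp h \<Longrightarrow> mdeg m = q" and "\<psi> h = 0"
  shows "g1 dvd h"
proof -
  have dvd: "\<exists>M. g1 dvd Const (Var v ^ M) * h" for v
  proof -
    obtain \<eta> N where \<eta>: "\<And>h q. \<forall>m\<in>supp h. mdeg m = q \<Longrightarrow> g1 dvd \<eta> (\<psi> h) - Const (Var v ^ (N * q)) * h"
      using splitting[of v] by blast
    have "g1 dvd \<eta> 0" using \<eta>[of 0 0] by simp
    moreover have "g1 dvd \<eta> 0 - Const (Var v ^ (N * q)) * h" using \<eta>[of h q] h assms(2) by simp
    ultimately have "g1 dvd \<eta> 0 - (\<eta> 0 - Const (Var v ^ (N * q)) * h)" by (rule dvd_diff)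
    then show ?thesis by auto
  qed
  from dvd[of 0] dvd[of 1] obtain M N where "g1 dvd Const (Var 0 ^ M) * h" "g1 dvd Const (Var 1 ^ N) * h"
    by blast
  then show ?thesis by (rule dvd_of_dvd_Var_multiples[rotated]) simp
qed

lemma sum_of_parts:
  "(\<Sum>q\<in>mdeg ` supp h. part s (\<lambda>_ q'. q' = q) h) = h" for h :: "('v, ('x, 'a::comm_ring_1) mpoly) mpoly"
proof (rule coef_coef_eqI)
  fix m k
  show "coef (coef (\<Sum>q\<in>mdeg ` supp h. part s (\<lambda>_ q'. q' = q) h) m) k = coef (coef h m) k"
  proof (cases "m \<in> supp h")
    case False
    then have "coef h m = 0" by (simp add: in_keys_iff)
    then show ?thesis by (simp add: lookup_sum coef_part)
  qed (simp add: lookup_sum coef_part)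
qed

text \<open>So \<open>S / (g\<^sub>1)\<close> is the Rees algebra of \<open>E\<close>.\<close>

lemma ker_\<psi>: "\<psi> h = 0 \<longleftrightarrow> g1 dvd h"
proof
  assume h: "\<psi> h = 0"
  have "g1 dvd part (\<lambda>_. 0) (\<lambda>_ q'. q' = q) h" for q
  proof (rule ker_\<psi>_homogeneous)
    fix m assume "m \<in> supp (part (\<lambda>_. 0) (\<lambda>_ q'. q' = q) h)"
    then have "coef (part (\<lambda>_. 0) (\<lambda>_ q'. q' = q) h) m \<noteq> 0" by (simp add: in_keys_iff)
    then obtain k where "coef (coef (part (\<lambda>_. 0) (\<lambda>_ q'. q' = q) h) m) k \<noteq> 0"
      by (metis lookup_zero poly_mapping_eqI)
    then show "mdeg m = q" by (simp add: coef_part split: if_splits)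
  next
    show "\<psi> (part (\<lambda>_. 0) (\<lambda>_ q'. q' = q) h) = 0" unfolding part_\<psi>[symmetric] h by simp
  qed
  then show "g1 dvd h" by (subst sum_of_parts[symmetric]) (rule dvd_sum)
qed (auto simp: psi.c_mult \<psi>_g1)

end

section \<open>Generators of the rows of the Rees algebra of \<open>F\<close>\<close>

lemma module_of_coeff_hom:
  assumes "coeff_hom e"
  shows "Modules.module (\<lambda>u s. e u * s)"
proof -
  interpret coeff_hom e by fact
  show ?thesis
    by standard (simp_all add: c_add c_mult algebra_simps)
qed

lemma high_degree_form_split:
  fixes r :: "'k::comm_ring_1 polR"
  assumes "\<And>m. m \<in> supp r \<Longrightarrow> 2 * M \<le> mdeg m + 1"
  shows "\<exists>r0 r1. r = Var 1 ^ M * r1 - Var 0 ^ M * r0"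
proof (induction r rule: mpoly_induct)
  case (monom c m)
  from assms[OF monom(1)] have "M \<le> coef m 1 \<or> M \<le> coef m 0" by (auto simp: mdeg_2)
  then show ?case
  proof
    assume "M \<le> coef m 1"
    then have "Var 1 ^ M dvd Const c * Monom m" by (simp add: Var_power_dvd_iff supp_monom)
    then obtain r1 where "Const c * Monom m = Var 1 ^ M * r1" by (elim dvdE)
    then have "Const c * Monom m = Var 1 ^ M * r1 - Var 0 ^ M * 0" by simp
    then show ?thesis by blast
  next
    assume "M \<le> coef m 0"
    then have "Var 0 ^ M dvd Const c * Monom m" by (simp add: Var_power_dvd_iff supp_monom)
    then obtain r0 where "Const c * Monom m = Var 0 ^ M * r0" by (elim dvdE)
    then have "Const c * Monom m = Var 1 ^ M * 0 - Var 0 ^ M * (- r0)" by simp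
    then show ?thesis by blast
  qed
next
  case (add p q)
  then obtain p0 p1 q0 q1 where e: "p = Var 1 ^ M * p1 - Var 0 ^ M * p0" "q = Var 1 ^ M * q1 - Var 0 ^ M * q0"
    by blast
  have "p + q = Var 1 ^ M * (p1 + q1) - Var 0 ^ M * (p0 + q0)" unfolding e by (simp add: algebra_simps)
  then show ?case by blast
next
  case zero
  have "0 = Var 1 ^ M * 0 - Var 0 ^ M * (0 :: 'k polR)" by simp
  then show ?case by blast
qed

lemma high_degree_row_split:
  fixes t :: "'k::comm_ring_1 polS"
  assumes t: "t \<in> full_row (\<lambda>_. 0) i" and i: "2 * int M \<le> i + 1"
  shows "\<exists>t0 t1. t = Const (Var 1 ^ M) * t1 - Const (Var 0 ^ M) * t0"
proof (induction t rule: mpoly_induct)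
  case (monom r m)
  have "\<exists>r0 r1. r = Var 1 ^ M * r1 - Var 0 ^ M * r0"
  proof (rule high_degree_form_split)
    fix k assume "k \<in> supp r"
    then have "int (mdeg k) = i" using t monom by (auto simp: homog_def)
    then show "2 * M \<le> mdeg k + 1" using i by simp
  qed
  then obtain r0 r1 where r: "r = Var 1 ^ M * r1 - Var 0 ^ M * r0" by blast
  have "Const r * Monom m = Const (Var 1 ^ M) * (Const r1 * Monom m) - Const (Var 0 ^ M) * (Const r0 * Monom m)"
    unfolding r by (simp add: Const_diff Const_mult left_diff_distrib mult.assoc)
  then show ?case by blast
next
  case (add p q)
  then obtain p0 p1 q0 q1 where e: "p = Const (Var 1 ^ M) * p1 - Const (Var 0 ^ M) * p0"
      "q = Const (Var 1 ^ M) * q1 - Const (Var 0 ^ M) * q0"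
    by blast
  have "p + q = Const (Var 1 ^ M) * (p1 + q1) - Const (Var 0 ^ M) * (p0 + q0)"
    unfolding e by (simp add: algebra_simps)
  then show ?case by blast
next
  case zero
  have "0 = Const (Var 1 ^ M) * 0 - Const (Var 0 ^ M) * (0 :: 'k polS)" by simp
  then show ?case by blast
qed

lemma Const_Var_dvd_cancel:
  fixes p q :: "('v, 'k::field polR) mpoly"
  assumes "Const (Var 1 ^ M) * p = Const (Var 0 ^ M) * q"
  shows "\<exists>h. p = Const (Var 0 ^ M) * h"
proof -
  have "Var 0 ^ M dvd coef p m" for m
  proof (rule Var_power_dvd_cancel)
    show "Var 1 ^ M * coef p m = Var 0 ^ M * coef q m"
      using arg_cong[OF assms, of "\<lambda>p. coef p m"] by simp
  qed simp
  then have "Const (Var 0 ^ M) dvd p" by (simp add: Const_dvd_iff)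
  then show ?thesis by (elim dvdE) blast
qed

lemma bigraded_Const_Var: "Const (Var v ^ M :: 'k::comm_ring_1 polR) \<in> bigraded s (int M) 0"
  by (rule bigraded_Const[OF forms_Var_power])

abbreviation emb :: "'k::comm_ring_1 polU \<Rightarrow> 'k polS"
  where "emb \<equiv> mpoly_eval (\<lambda>a. Const (Const a)) Var"

lemma coeff_hom_Const_Const:
  "coeff_hom (\<lambda>a :: 'k::comm_ring_1. Const (Const a :: 'k polR) :: ('w, 'k polR) mpoly)"
  by (rule coeff_hom_comp[OF coeff_hom_Const coeff_hom_Const])

lemma emb_hom: "coeff_hom (emb :: 'k::comm_ring_1 polU \<Rightarrow> 'k polS)"
  by (rule coeff_hom.eval_hom[OF coeff_hom_Const_Const])

lemma emb_Const: "emb (Const a) = Const (Const a)"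
  by (rule coeff_hom.eval_Const[OF coeff_hom_Const_Const])

lemma emb_Monom: "emb (Monom m) = Monom m"
  using coeff_hom.eval_Monom[OF coeff_hom_Const_Const, of Var m] by (simp add: mon_Var)

context presentation
begin

definition U_act :: "'k polU \<Rightarrow> 'k polF \<Rightarrow> 'k polF"
  where "U_act u s = \<psi> (emb u) * s"

sublocale FU: Modules.module U_act
  unfolding U_act_def by (rule module_of_coeff_hom[OF coeff_hom_comp[OF \<psi>_coeff_hom emb_hom]])

lemma span_Monom: "s \<in> FU.span B \<Longrightarrow> \<psi> (Monom m) * s \<in> FU.span B"
  using FU.span_scale[of s B "Monom m"] by (simp add: U_act_def emb_Monom)

lemma span_Const_Const: "s \<in> FU.span B \<Longrightarrow> Const (Const b) * s \<in> FU.span B"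
  using FU.span_scale[of s B "Const b"] by (simp add: U_act_def emb_Const)

lemma lift_multiple:
  assumes s: "s \<in> F_comp \<sigma> l q"
  shows "\<exists>N. \<forall>M\<ge>N. \<exists>h\<in>S_comp (l + int M) q. \<psi> h = Const (Var v ^ M) * s"
proof -
  obtain \<eta> N where \<eta>: "\<And>i q s. s \<in> F_comp \<sigma> i q \<Longrightarrow> \<psi> (\<eta> s) = Const (Var v ^ (N * q)) * s"
    using splitting[of v] by blast
  have "\<exists>h\<in>S_comp (l + int M) q. \<psi> h = Const (Var v ^ M) * s" if M: "N * q \<le> M" for M
  proof -
    define P where "P i' q' \<longleftrightarrow> i' = l + int M \<and> q' = q" for i' q'
    define h where "h = Const (Var v ^ (M - N * q)) * \<eta> s"
    have "Var v ^ (M - N * q) * Var v ^ (N * q) = (Var v ^ M :: 'k polR)"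
      using M by (simp flip: power_add)
    then have h: "\<psi> h = Const (Var v ^ M) * s"
      unfolding h_def by (simp add: psi.c_mult \<eta>[OF s] mult.assoc[symmetric] Const_mult[symmetric])
    have "Const (Var v ^ M) * s \<in> F_comp \<sigma> (l + int M) q"
      using bigraded_mult[OF bigraded_Const_Var s, of v M] by (simp add: add.commute)
    then have "\<psi> (part (\<lambda>_. 0) P h) = Const (Var v ^ M) * s"
      unfolding part_\<psi>[symmetric] h P_def by (intro part_id) (simp add: bigraded_eq_homog)
    moreover have "part (\<lambda>_. 0) P h \<in> S_comp (l + int M) q"
      unfolding bigraded_eq_homog P_def by (rule part_homog)
    ultimately show ?thesis by blast
  qed
  then show ?thesis by blast
qed

text \<open>
  The multiples \<open>x\<^sub>0\<^sup>M s\<close> and \<open>x\<^sub>1\<^sup>M s\<close> lift to \<open>h\<^sub>0\<close> and \<open>h\<^sub>1\<close> in \<open>S\<close>, and the two lifts of \<open>x\<^sub>0\<^sup>M x\<^sub>1\<^sup>M s\<close> differ by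
  \<open>g\<^sub>1 t\<close>. Modulo \<open>(x\<^sub>0\<^sup>M, x\<^sub>1\<^sup>M)\<close> the polynomial \<open>t\<close> is the obstruction to lifting \<open>s\<close> itself: it represents the image of
  the class of \<open>s\<close> under the embedding of \<open>\<R>(F)/\<R>(E)\<close> into the second local cohomology of \<open>S(-d\<^sub>1, -1)\<close>.
\<close>

lemma obstruction:
  assumes s: "s \<in> F_comp \<sigma> l q"
  obtains M h0 h1 t where "h0 \<in> S_comp (l + int M) q" "\<psi> h0 = Const (Var 0 ^ M) * s"
    "Const (Var 1 ^ M) * h0 - Const (Var 0 ^ M) * h1 = g1 * t" "t \<in> full_row (\<lambda>_. 0) (l + 2 * int M - int d1)"
proof -
  obtain N0 N1 where N: "\<forall>M\<ge>N0. \<exists>h\<in>S_comp (l + int M) q. \<psi> h = Const (Var 0 ^ M) * s"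
      "\<forall>M\<ge>N1. \<exists>h\<in>S_comp (l + int M) q. \<psi> h = Const (Var 1 ^ M) * s"
    using lift_multiple[OF s] by blast
  define M where "M = max N0 N1"
  obtain h0 h1 where h0: "h0 \<in> S_comp (l + int M) q" "\<psi> h0 = Const (Var 0 ^ M) * s"
      and h1: "h1 \<in> S_comp (l + int M) q" "\<psi> h1 = Const (Var 1 ^ M) * s"
    using N[rule_format, of M] by (auto simp: M_def)
  have "\<psi> (Const (Var 1 ^ M) * h0 - Const (Var 0 ^ M) * h1) = 0"
    using psi.c_add[of "Const (Var 1 ^ M) * h0" "- (Const (Var 0 ^ M) * h1)"]
    by (simp add: psi.c_uminus psi.c_mult h0 h1 mult.left_commute)
  then obtain t where t: "Const (Var 1 ^ M) * h0 - Const (Var 0 ^ M) * h1 = g1 * t"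
    unfolding ker_\<psi> by (elim dvdE)
  have "Const (Var v ^ M) * h \<in> S_comp (l + 2 * int M) q" if "h \<in> S_comp (l + int M) q" for h :: "'k polS" and v
    using bigraded_mult[OF bigraded_Const_Var that, of v M] by (simp add: algebra_simps)
  then have "g1 * t \<in> S_comp (l + 2 * int M) q"
    unfolding t[symmetric] using h0(1) h1(1) by (intro bigraded_diff)
  then have "g1 * t \<in> full_row (\<lambda>_. 0) (l + 2 * int M)" by (rule bigraded_row)
  then obtain t' where "t' \<in> homog (\<lambda>_. 0) (\<lambda>i' _. i' + int d1 = l + 2 * int M)" "g1 * t = g1 * t'"
    by (rule homog_multE[OF g1_bigraded])
  then have "t' \<in> full_row (\<lambda>_. 0) (l + 2 * int M - int d1)" by (elim homog_mono) simp
  with t \<open>g1 * t = g1 * t'\<close> show thesis by (intro that[OF h0]) simp_all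
qed

text \<open>
  Here the coefficients of the obstruction have degree at least \<open>2 M - 1\<close>, so all their monomials are divisible by
  \<open>x\<^sub>0\<^sup>M\<close> or \<open>x\<^sub>1\<^sup>M\<close>.
\<close>

lemma \<psi>_surj_high_rows:
  assumes s: "s \<in> F_comp \<sigma> l q" and "int d1 \<le> l + 1"
  shows "\<exists>h\<in>S_comp l q. \<psi> h = s"
proof -
  obtain M h0 h1 t where h0: "h0 \<in> S_comp (l + int M) q" "\<psi> h0 = Const (Var 0 ^ M) * s"
    and t: "Const (Var 1 ^ M) * h0 - Const (Var 0 ^ M) * h1 = g1 * t"
    and t_row: "t \<in> full_row (\<lambda>_. 0) (l + 2 * int M - int d1)"
    by (rule obstruction[OF s])
  obtain t0 t1 where t01: "t = Const (Var 1 ^ M) * t1 - Const (Var 0 ^ M) * t0"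
    using high_degree_row_split[OF t_row] assms(2) by force
  have "Const (Var 1 ^ M) * (h0 - g1 * t1) = Const (Var 0 ^ M) * (h1 - g1 * t0)"
    using t unfolding t01 by (simp add: algebra_simps)
  then obtain h where h: "h0 - g1 * t1 = Const (Var 0 ^ M) * h" using Const_Var_dvd_cancel by blast
  have "Const (Var 0 ^ M) * \<psi> h = \<psi> (h0 - g1 * t1)" unfolding h by (simp add: psi.c_mult)
  also have "\<dots> = \<psi> h0"
    using psi.c_add[of h0 "- (g1 * t1)"] by (simp add: psi.c_uminus psi.c_mult \<psi>_g1)
  finally have "\<psi> h = s" using h0 by simp
  then have "\<psi> (part (\<lambda>_. 0) (\<lambda>i' q'. i' = l \<and> q' = q) h) = s"
    unfolding part_\<psi>[symmetric] using s by (simp add: bigraded_eq_homog part_id)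
  then show ?thesis unfolding bigraded_eq_homog using part_homog by blast
qed

text \<open>
  Every obstruction of degree 0 in the \<open>T\<^sub>j\<close> that can occur in a row \<open>l \<ge> 0\<close> comes from an element of \<open>F\<^sub>l\<close>, because
  \<open>g\<^sub>1\<close> maps it to a polynomial with coefficients of degree \<open>l + 2 M\<close>, and these are in the ideal \<open>(x\<^sub>0\<^sup>M, x\<^sub>1\<^sup>M)\<close>.
  Multiples by monomials in the \<open>T\<^sub>j\<close> then absorb the obstructions of higher degree.
\<close>

lemma obstruction_realized:
  assumes r: "r \<in> forms (l + 2 * int M - int d1)" and l: "0 \<le> l"
  shows "\<exists>k0 k1 s. k0 \<in> S_comp (l + int M) 1 \<and> s \<in> F_comp \<sigma> l 1 \<and> \<psi> k0 = Const (Var 0 ^ M) * s \<and>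
    Const (Var 1 ^ M) * k0 - Const (Var 0 ^ M) * k1 = g1 * Const r"
proof -
  have g: "g1 * Const r \<in> S_comp (l + 2 * int M) 1"
    using bigraded_mult[OF g1_bigraded bigraded_Const[OF r]] by simp
  obtain k0 k1 where k: "g1 * Const r = Const (Var 1 ^ M) * k0 - Const (Var 0 ^ M) * k1"
    using high_degree_row_split[OF bigraded_row[OF g], of M] l by auto
  define P where "P i q \<longleftrightarrow> i + int M = l + 2 * int M \<and> q + 0 = 1" for i :: int and q :: nat
  let ?part = "part (\<lambda>_. 0) (\<lambda>i' q'. i' = l + 2 * int M \<and> q' = 1)"
  have "?part (Const (Var v ^ M) * k) = Const (Var v ^ M) * part (\<lambda>_. 0) P k" for v and k :: "'k polS"
    unfolding P_def by (rule part_mult[OF bigraded_Const_Var])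
  moreover have "?part (p - p') = ?part p - ?part p'" for p p' :: "'k polS"
    by (rule coef_coef_eqI) (simp add: coef_part lookup_minus)
  ultimately have eq: "g1 * Const r = Const (Var 1 ^ M) * part (\<lambda>_. 0) P k0 - Const (Var 0 ^ M) * part (\<lambda>_. 0) P k1"
    using part_id[OF g[unfolded bigraded_eq_homog]] k by metis
  have P: "part (\<lambda>_. 0) P k0 \<in> S_comp (l + int M) 1"
    unfolding bigraded_eq_homog by (rule homog_mono[OF part_homog]) (simp add: P_def)
  have "Const (Var 1 ^ M) * \<psi> (part (\<lambda>_. 0) P k0) - Const (Var 0 ^ M) * \<psi> (part (\<lambda>_. 0) P k1) = 0"
    using arg_cong[OF eq, of \<psi>]
      psi.c_add[of "Const (Var 1 ^ M) * part (\<lambda>_. 0) P k0" "- (Const (Var 0 ^ M) * part (\<lambda>_. 0) P k1)"]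
    by (simp add: psi.c_mult psi.c_uminus \<psi>_g1)
  then obtain s where s: "\<psi> (part (\<lambda>_. 0) P k0) = Const (Var 0 ^ M) * s"
    using Const_Var_dvd_cancel[of M "\<psi> (part (\<lambda>_. 0) P k0)"] by auto
  have "Const (Var 0 ^ M) * s \<in> homog (\<lambda>i. - int (\<sigma> i)) (\<lambda>i' q'. i' = l + int M \<and> q' = 1)"
    using \<psi>_bigraded[OF P] unfolding s bigraded_eq_homog .
  then obtain s' where s': "s' \<in> homog (\<lambda>i. - int (\<sigma> i)) (\<lambda>i q. i + int M = l + int M \<and> q + 0 = 1)"
      "Const (Var 0 ^ M) * s = Const (Var 0 ^ M) * s'"
    by (rule homog_multE[OF bigraded_Const_Var])
  have "s' \<in> F_comp \<sigma> l 1"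
    unfolding bigraded_eq_homog by (rule homog_mono[OF s'(1)]) simp
  then show ?thesis
    using P s s'(2) eq by (intro exI[of _ "part (\<lambda>_. 0) P k0"] exI[of _ "part (\<lambda>_. 0) P k1"] exI[of _ s']) simp
qed

lemma row_obstruction_realized:
  assumes t: "t \<in> full_row (\<lambda>_. 0) (l + 2 * int M - int d1)" and l: "0 \<le> l"
  shows "\<exists>k0 k1 s. k0 \<in> full_row (\<lambda>_. 0) (l + int M) \<and> s \<in> FU.span (F_comp \<sigma> l 1) \<and>
    \<psi> k0 = Const (Var 0 ^ M) * s \<and> Const (Var 1 ^ M) * k0 - Const (Var 0 ^ M) * k1 = g1 * t"
proof (induction t rule: mpoly_induct)
  case (monom r m)
  have "r \<in> forms (l + 2 * int M - int d1)"
    using t monom by (auto simp: homog_def forms_def)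
  from obstruction_realized[OF this l] obtain k0 k1 s where k: "k0 \<in> S_comp (l + int M) 1"
      "s \<in> F_comp \<sigma> l 1" "\<psi> k0 = Const (Var 0 ^ M) * s"
      "Const (Var 1 ^ M) * k0 - Const (Var 0 ^ M) * k1 = g1 * Const r" by blast
  have "k0 * Monom m \<in> S_comp (l + int M) (1 + mdeg m)"
    using bigraded_mult[OF k(1) bigraded_Monom[of m]] by simp
  then have "k0 * Monom m \<in> full_row (\<lambda>_. 0) (l + int M)" by (rule bigraded_row)
  moreover have "\<psi> (Monom m) * s \<in> FU.span (F_comp \<sigma> l 1)"
    by (rule span_Monom[OF FU.span_base[OF k(2)]])
  moreover have "\<psi> (k0 * Monom m) = Const (Var 0 ^ M) * (\<psi> (Monom m) * s)"
    by (simp add: psi.c_mult k(3) mult_ac)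
  moreover have "Const (Var 1 ^ M) * (k0 * Monom m) - Const (Var 0 ^ M) * (k1 * Monom m) = g1 * (Const r * Monom m)"
    using arg_cong[OF k(4), of "\<lambda>z. z * Monom m"] by (simp add: left_diff_distrib mult.assoc)
  ultimately show ?case by blast
next
  case (add t t')
  then obtain k0 k1 s k0' k1' s' where k: "k0 \<in> full_row (\<lambda>_. 0) (l + int M)" "s \<in> FU.span (F_comp \<sigma> l 1)"
      "\<psi> k0 = Const (Var 0 ^ M) * s" "Const (Var 1 ^ M) * k0 - Const (Var 0 ^ M) * k1 = g1 * t"
      "k0' \<in> full_row (\<lambda>_. 0) (l + int M)" "s' \<in> FU.span (F_comp \<sigma> l 1)"
      "\<psi> k0' = Const (Var 0 ^ M) * s'" "Const (Var 1 ^ M) * k0' - Const (Var 0 ^ M) * k1' = g1 * t'"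
    by blast
  have "Const (Var 1 ^ M) * (k0 + k0') - Const (Var 0 ^ M) * (k1 + k1') = g1 * (t + t')"
    using k(4,8) by (simp add: algebra_simps)
  moreover have "\<psi> (k0 + k0') = Const (Var 0 ^ M) * (s + s')"
    by (simp add: psi.c_add k(3,7) distrib_left)
  ultimately show ?case using homog_add[OF k(1,5)] FU.span_add[OF k(2,6)] by blast
next
  case zero
  have "\<psi> 0 = Const (Var 0 ^ M) * 0"
    "Const (Var 1 ^ M) * 0 - Const (Var 0 ^ M) * 0 = g1 * 0" by simp_all
  then show ?case using FU.span_zero homog_0 by blast
qed

lemma \<psi>_row_in_span:
  assumes h: "h \<in> full_row (\<lambda>_. 0) l"
  shows "\<psi> h \<in> FU.span (Const ` forms l)"
proof (induction h rule: mpoly_induct)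
  case (monom r m)
  have "r \<in> forms l" using h monom by (auto simp: homog_def forms_def)
  then have "\<psi> (Monom m) * Const r \<in> FU.span (Const ` forms l)"
    by (intro span_Monom FU.span_base) simp
  then show ?case by (simp add: psi.c_mult mult.commute)
qed (auto simp: psi.c_add intro: FU.span_add FU.span_zero)

text \<open>
  Subtracting a \<open>U\<close>-combination of elements of \<open>F\<^sub>l\<close> with the same obstruction leaves an element of the image of \<open>S\<close>.
\<close>

lemma nonneg_row_generators:
  assumes s: "s \<in> F_comp \<sigma> l q" and l: "0 \<le> l"
  shows "s \<in> FU.span (Const ` forms l \<union> F_comp \<sigma> l 1)"
proof -
  obtain M h0 h1 t where h0: "h0 \<in> S_comp (l + int M) q" "\<psi> h0 = Const (Var 0 ^ M) * s"
    and t: "Const (Var 1 ^ M) * h0 - Const (Var 0 ^ M) * h1 = g1 * t"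
    and t_row: "t \<in> full_row (\<lambda>_. 0) (l + 2 * int M - int d1)"
    by (rule obstruction[OF s])
  from row_obstruction_realized[OF t_row l] obtain k0 k1 s' where k: "k0 \<in> full_row (\<lambda>_. 0) (l + int M)"
    "s' \<in> FU.span (F_comp \<sigma> l 1)" "\<psi> k0 = Const (Var 0 ^ M) * s'"
    "Const (Var 1 ^ M) * k0 - Const (Var 0 ^ M) * k1 = g1 * t" by blast
  have "Const (Var 1 ^ M) * (h0 - k0) = Const (Var 0 ^ M) * (h1 - k1)"
    using t k(4) by (simp add: algebra_simps)
  then obtain h where h: "h0 - k0 = Const (Var 0 ^ M) * h" using Const_Var_dvd_cancel by blast
  have "h0 - k0 \<in> full_row (\<lambda>_. 0) (l + int M)" using bigraded_row[OF h0(1)] k(1) by (rule homog_diff)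
  then obtain h' where h': "h' \<in> homog (\<lambda>_. 0) (\<lambda>i q. i + int M = l + int M)"
      "Const (Var 0 ^ M) * h = Const (Var 0 ^ M) * h'"
    unfolding h by (rule homog_multE[OF bigraded_Const_Var])
  have row: "h' \<in> full_row (\<lambda>_. 0) l" using h'(1) by simp
  have "Const (Var 0 ^ M) * \<psi> h' = \<psi> (h0 - k0)" unfolding h h'(2) by (simp add: psi.c_mult)
  also have "\<dots> = Const (Var 0 ^ M) * (s - s')"
    using psi.c_add[of h0 "- k0"] by (simp add: psi.c_uminus h0 k right_diff_distrib)
  finally have "s = \<psi> h' + s'" by simp
  moreover have "\<psi> h' \<in> FU.span (Const ` forms l \<union> F_comp \<sigma> l 1)"
    using \<psi>_row_in_span[OF row] FU.span_mono[of "Const ` forms l"] by blast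
  moreover have "s' \<in> FU.span (Const ` forms l \<union> F_comp \<sigma> l 1)"
    using k(2) FU.span_mono[of "F_comp \<sigma> l 1"] by blast
  ultimately show ?thesis by (simp add: FU.span_add)
qed

end

section \<open>The index set\<close>

lemma wdot_eq_wt: "wt (\<lambda>i. - int (\<sigma> i)) \<alpha> = - wdot \<alpha> \<sigma>"
proof -
  have "wt (\<lambda>i. - int (\<sigma> i)) \<alpha> = (\<Sum>i\<in>UNIV. int (coef \<alpha> i) * - int (\<sigma> i))"
    by (rule wt_superset) simp_all
  then show ?thesis by (simp add: sum_2 wdot_def)
qed

lemma wdot_add: "wdot (\<alpha> + \<beta>) \<sigma> = wdot \<alpha> \<sigma> + wdot \<beta> \<sigma>"
  by (simp add: wdot_def lookup_add algebra_simps)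

lemma Omega_wdot: "\<alpha> \<in> Omega \<sigma> c \<Longrightarrow> c \<le> wdot \<alpha> \<sigma>"
  by (auto simp: Omega_def Omega_part_def wdot_def split: if_splits)

lemma least_multiple:
  fixes c :: int and s :: nat
  assumes "0 < c" "c \<le> int (n * s)"
  obtains k where "0 < k" "k \<le> n" "c \<le> int (k * s)" "int (k * s) < c + int s"
proof -
  define k where "k = (LEAST k. c \<le> int (k * s))"
  have k: "c \<le> int (k * s)" unfolding k_def by (rule LeastI) (rule assms(2))
  have le: "k \<le> n" unfolding k_def by (rule Least_le) (rule assms(2))
  have pos: "0 < k" using k assms(1) by (cases k) auto
  then have "\<not> c \<le> int ((k - 1) * s)"
    using not_less_Least[of "k - 1" "\<lambda>k. c \<le> int (k * s)", folded k_def] by simp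
  moreover have "int (k * s) = int ((k - 1) * s) + int s" using pos by (cases k) auto
  ultimately show thesis using that[OF pos le k] by simp
qed

text \<open>
  For \<open>c > 0\<close>: fill up the weight \<open>c\<close> with factors \<open>w\<^sub>1\<close>, as far as there are any, and then with factors \<open>w\<^sub>2\<close>.
\<close>

lemma Omega_factor:
  assumes "c \<le> wdot \<alpha> \<sigma>"
  shows "\<exists>\<beta>\<in>Omega \<sigma> c. \<exists>\<gamma>. \<alpha> = \<beta> + \<gamma>"
proof (cases "c \<le> 0")
  case True
  then have "0 \<in> Omega \<sigma> c" by (simp add: Omega_def)
  then show ?thesis by (intro bexI[of _ 0] exI[of _ \<alpha>]) simp_all
next
  case False
  then have c: "0 < c" by simp
  let ?single = Poly_Mapping.single
  have \<alpha>: "\<alpha> = ?single 1 (coef \<alpha> 1) + ?single 2 (coef \<alpha> 2)"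
  proof (rule poly_mapping_eqI)
    fix k :: 2
    show "coef \<alpha> k = coef (?single 1 (coef \<alpha> 1) + ?single 2 (coef \<alpha> 2)) k"
      using exhaust_2[of k] by (auto simp: lookup_add lookup_single when_def)
  qed
  show ?thesis
  proof (cases "c \<le> int (coef \<alpha> 1 * \<sigma> 1)")
    case True
    from least_multiple[OF c True] obtain k where k: "0 < k" "k \<le> coef \<alpha> 1" "c \<le> int (k * \<sigma> 1)"
        "int (k * \<sigma> 1) < c + int (\<sigma> 1)" .
    have "?single 1 k \<in> Omega_part \<sigma> c 1"
      using k by (simp add: Omega_part_def wdot_def lookup_single)
    then have "?single 1 k \<in> Omega \<sigma> c" by (auto simp: Omega_def)
    moreover have "\<alpha> = ?single 1 k + (?single 1 (coef \<alpha> 1 - k) + ?single 2 (coef \<alpha> 2))"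
      using k(2) by (subst \<alpha>) (simp add: single_add[symmetric] add.assoc[symmetric])
    ultimately show ?thesis by blast
  next
    case False
    then have "0 < c - int (coef \<alpha> 1 * \<sigma> 1)" "c - int (coef \<alpha> 1 * \<sigma> 1) \<le> int (coef \<alpha> 2 * \<sigma> 2)"
      using assms by (simp_all add: wdot_def)
    from least_multiple[OF this] obtain k where k: "0 < k" "k \<le> coef \<alpha> 2"
      "c - int (coef \<alpha> 1 * \<sigma> 1) \<le> int (k * \<sigma> 2)"
      "int (k * \<sigma> 2) < c - int (coef \<alpha> 1 * \<sigma> 1) + int (\<sigma> 2)" .
    then have "0 < \<sigma> 2" by (cases "\<sigma> 2") auto
    moreover have "?single 1 (coef \<alpha> 1) + ?single 2 k \<in> Omega_part \<sigma> c 2"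
      using k by (simp add: Omega_part_def wdot_def lookup_add lookup_single)
    ultimately have "?single 1 (coef \<alpha> 1) + ?single 2 k \<in> Omega \<sigma> c" by (auto simp: Omega_def)
    moreover have "\<alpha> = (?single 1 (coef \<alpha> 1) + ?single 2 k) + ?single 2 (coef \<alpha> 2 - k)"
      using k(2) by (subst \<alpha>) (simp add: single_add[symmetric] add.assoc)
    ultimately show ?thesis by blast
  qed
qed

lemma Monom_2: "Monom k = (Var 0 ^ coef k 0 * Var 1 ^ coef k 1 :: 'k::comm_ring_1 polR)"
proof -
  have "Poly_Mapping.single 0 (coef k 0) + Poly_Mapping.single 1 (coef k 1) = k"
  proof (rule poly_mapping_eqI)
    fix j :: 2
    show "coef (Poly_Mapping.single 0 (coef k 0) + Poly_Mapping.single 1 (coef k 1)) j = coef k j"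
      using index_2_cases[of j] by (auto simp: lookup_add lookup_single when_def)
  qed
  then show ?thesis by (metis Monom_add Var_power)
qed

context presentation
begin

text \<open>The last family of generators in the theorem, without the factor \<open>g\<^sub>2\<close>.\<close>

abbreviation Pset :: "(nat \<Rightarrow> nat \<Rightarrow> 'k polF) \<Rightarrow> int \<Rightarrow> 'k polF set"
  where "Pset p c \<equiv> {p (nat (wdot \<alpha> \<sigma> - c)) j * Monom \<alpha> | \<alpha> j.
    \<alpha> \<in> Omega \<sigma> c \<and> 1 \<le> j \<and> int j \<le> int d1 - wdot \<alpha> \<sigma> + c - 1}"

lemma mult_span:
  assumes "\<And>x. x \<in> B \<Longrightarrow> w * x \<in> FU.span V" "z \<in> FU.span B"
  shows "w * z \<in> FU.span V"
  using assms(2)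
proof (induction rule: FU.span_induct_alt)
  case base
  then show ?case by (simp add: FU.span_zero)
next
  case (step u x y)
  have "w * (U_act u x + y) = U_act u (w * x) + w * y"
    by (simp add: U_act_def algebra_simps)
  then show ?case using step assms(1) by (simp add: FU.span_add FU.span_scale)
qed

text \<open>
  The row of \<open>z\<close> is generated by \<open>R\<^sub>l\<close> and \<open>F\<^sub>l\<close>, and \<open>F\<^sub>l\<close> is spanned over \<open>k\<close> by the \<open>p\<^sub>l\<^sub>,\<^sub>j\<close> and the image of \<open>S\<close>, which is in the
  \<open>U\<close>-span of \<open>R\<^sub>l\<close>. For \<open>l \<ge> d\<^sub>1 - 1\<close> that image is all of \<open>F\<^sub>l\<close>.
\<close>

lemma Omega_multiple_in_span:
  assumes p: "\<And>l. l + 2 \<le> d1 \<Longrightarrow>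
      basis_mod (F_comp \<sigma> (int l) 1) (\<psi> ` S_comp (int l) 1) (d1 - l - 1) (p l)"
    and \<beta>: "\<beta> \<in> Omega \<sigma> c" and z: "z \<in> F_comp \<sigma> (wdot \<beta> \<sigma> - c) q"
  shows "Monom \<beta> * z \<in> FU.span (Bset \<sigma> c \<union> Pset p c)"
proof -
  define l where "l = nat (wdot \<beta> \<sigma> - c)"
  have l: "int l = wdot \<beta> \<sigma> - c" using Omega_wdot[OF \<beta>] by (simp add: l_def)
  let ?V = "FU.span (Bset \<sigma> c \<union> Pset p c)"
  have const: "Monom \<beta> * x \<in> ?V" if x: "x \<in> Const ` forms (int l)" for x :: "'k polF"
  proof -
    from x obtain r where r: "x = Const r" "r \<in> forms (int l)" by blast
    have "Monom \<beta> * Const r \<in> ?V"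
    proof (induction r rule: mpoly_induct)
      case (monom c' k)
      have k: "mdeg k = l" using r(2) monom by (auto simp: forms_def)
      have "Const (Var 0 ^ coef k 0 * Var 1 ^ coef k 1) * Monom \<beta> \<in> Bset \<sigma> c"
        unfolding Bset_def using \<beta> k l
        by (intro CollectI exI[of _ \<beta>] exI[of _ "coef k 0"] exI[of _ "coef k 1"]) (auto simp: mdeg_2)
      then have "Const (Const c') * (Const (Var 0 ^ coef k 0 * Var 1 ^ coef k 1) * Monom \<beta>) \<in> ?V"
        by (intro span_Const_Const FU.span_base) blast
      then show ?case unfolding Monom_2[symmetric] by (simp add: Const_mult mult_ac)
    qed (simp_all add: Const_add distrib_left FU.span_add FU.span_zero)
    then show ?thesis using r by simp
  qed
  have image: "Monom \<beta> * \<psi> h \<in> ?V" if "h \<in> S_comp (int l) 1" for h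
    using mult_span[OF const \<psi>_row_in_span[OF bigraded_row[OF that]]] .
  have deg1: "Monom \<beta> * y \<in> ?V" if y: "y \<in> F_comp \<sigma> (int l) 1" for y
  proof (cases "d1 \<le> l + 1")
    case True
    then show ?thesis using \<psi>_surj_high_rows[OF y] image by auto
  next
    case False
    then have "l + 2 \<le> d1" by simp
    from p[OF this] y obtain b where "y - (\<Sum>j\<in>{1..d1 - l - 1}. Const (Const (b j)) * p l j) \<in> \<psi> ` S_comp (int l) 1"
      unfolding basis_mod_def by blast
    then obtain h where h: "h \<in> S_comp (int l) 1"
      "y = \<psi> h + (\<Sum>j\<in>{1..d1 - l - 1}. Const (Const (b j)) * p l j)" by (auto simp: diff_eq_eq)
    have "Const (Const (b j)) * (p l j * Monom \<beta>) \<in> ?V" if "j \<in> {1..d1 - l - 1}" for j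
    proof -
      have "int j \<le> int d1 - wdot \<beta> \<sigma> + c - 1" "1 \<le> j" using that l False by auto
      then have "p l j * Monom \<beta> \<in> Pset p c" using \<beta> unfolding l_def by blast
      then show ?thesis by (intro span_Const_Const FU.span_base) blast
    qed
    then have "(\<Sum>j\<in>{1..d1 - l - 1}. Const (Const (b j)) * (p l j * Monom \<beta>)) \<in> ?V"
      by (rule FU.span_sum)
    moreover have "Monom \<beta> * y = Monom \<beta> * \<psi> h + (\<Sum>j\<in>{1..d1 - l - 1}. Const (Const (b j)) * (p l j * Monom \<beta>))"
      unfolding h(2) by (simp add: distrib_left sum_distrib_left mult_ac)
    ultimately show ?thesis using image[OF h(1)] by (simp add: FU.span_add)
  qed
  have "z \<in> FU.span (Const ` forms (int l) \<union> F_comp \<sigma> (int l) 1)"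
    by (rule nonneg_row_generators) (use z l in simp_all)
  then show ?thesis using mult_span[of "Const ` forms (int l) \<union> F_comp \<sigma> (int l) 1"] const deg1 by blast
qed

text \<open>
  Each monomial of row \<open>-c\<close> has a factor \<open>w\<^sup>\<beta>\<close> with \<open>\<beta>\<close> in the index set, and the cofactor lies in the row
  \<open>\<beta> \<cdot> \<sigma> - c \<ge> 0\<close>.
\<close>

lemma row_generators:
  assumes p: "\<And>l. l + 2 \<le> d1 \<Longrightarrow>
      basis_mod (F_comp \<sigma> (int l) 1) (\<psi> ` S_comp (int l) 1) (d1 - l - 1) (p l)"
    and s: "s \<in> full_row (\<lambda>i. - int (\<sigma> i)) (- c)"
  shows "s \<in> FU.span (Bset \<sigma> c \<union> Pset p c)"
proof (induction s rule: mpoly_induct)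
  case (monom r \<alpha>)
  have r: "int (mdeg k) = wdot \<alpha> \<sigma> - c" if "k \<in> supp r" for k
    using s monom that by (force simp: homog_def wdot_eq_wt)
  show ?case
  proof (cases "r = 0")
    case True
    then show ?thesis by (simp add: FU.span_zero)
  next
    case False
    then obtain k where "k \<in> supp r" by (metis all_not_in_conv keys_eq_empty)
    then have "c \<le> wdot \<alpha> \<sigma>" using r[of k] by simp
    then obtain \<beta> \<gamma> where \<beta>: "\<beta> \<in> Omega \<sigma> c" "\<alpha> = \<beta> + \<gamma>" using Omega_factor by blast
    have "r \<in> forms (wdot \<alpha> \<sigma> - c)" using r by (simp add: forms_def)
    then have "Const r * Monom \<gamma> \<in> F_comp \<sigma> (wdot \<beta> \<sigma> - c) (mdeg \<gamma>)"
      by (rule bigraded_Const_Monom) (simp_all add: wdot_eq_wt \<beta>(2) wdot_add)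
    from Omega_multiple_in_span[OF p \<beta>(1) this]
    show ?thesis unfolding \<beta>(2) by (simp add: Monom_add mult_ac)
  qed
qed (simp_all add: FU.span_add FU.span_zero)

end

section \<open>The equation \<open>g\<^sub>2\<close> on the Rees algebra of \<open>F\<close>\<close>

abbreviation value_at :: "('v \<Rightarrow> 'a::comm_ring_1) \<Rightarrow> ('v, 'a) mpoly \<Rightarrow> 'a"
  where "value_at \<equiv> mpoly_eval (\<lambda>x. x)"

text \<open>
  Here \<open>b\<close> is the extension \<open>F \<rightarrow> R\<close> of the map \<open>E \<rightarrow> I(d)\<close> induced by \<open>f\<close>, and \<open>e\<close> is the image of the second column
  of \<open>\<phi>\<close> in \<open>F\<close>.
\<close>

locale presentation_of_ideal = presentation a \<xi> d1 \<sigma>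
  for a :: "'k::field polR ^ 3" and \<xi> d1 \<sigma> +
  fixes b e :: "'k polR ^ 2" and d2 :: nat
  assumes e_forms: "\<And>i. e $ i \<in> forms (int d2 + int (\<sigma> i))"
    and e_nonzero: "e \<noteq> 0" and b_nonzero: "b \<noteq> 0"
    and b_e: "b $ 1 * e $ 1 + b $ 2 * e $ 2 = 0"
    and ker_b: "\<And>v. b $ 1 * v $ 1 + b $ 2 * v $ 2 = 0 \<Longrightarrow> \<exists>t. v = t *s e"
begin

lemma e_coprime:
  assumes "\<And>i. G dvd e $ i"
  shows "G dvd 1"
proof -
  have "\<forall>i. \<exists>y. e $ i = G * y" using assms by (auto simp: dvd_def)
  then obtain y where y: "\<And>i. e $ i = G * y i" by metis
  define e' :: "'k polR ^ 2" where "e' = (\<chi> i. y i)"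
  have e': "e $ i = G * e' $ i" for i by (simp add: e'_def y)
  have G: "G \<noteq> 0" using e_nonzero e' by (auto simp: vec_eq_iff)
  have "G * (b $ 1 * e' $ 1 + b $ 2 * e' $ 2) = 0" using b_e unfolding e' by (simp add: algebra_simps)
  then have "b $ 1 * e' $ 1 + b $ 2 * e' $ 2 = 0" using G by simp
  from ker_b[OF this] obtain t where t: "e' = t *s e" by blast
  obtain i where i: "e $ i \<noteq> 0" using e_nonzero by (auto simp: vec_eq_iff)
  have "e $ i * (G * t) = e $ i * 1" using e'[of i] by (simp add: t mult_ac)
  then have "1 = G * t" using i by (metis mult_left_cancel)
  then show ?thesis by (rule dvdI)
qed

lemma e_Var_power: "\<exists>N c1 c2. c1 * e $ 1 + c2 * e $ 2 = Var v ^ N"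
proof -
  obtain i where "e $ i \<noteq> 0" using e_nonzero by (auto simp: vec_eq_iff)
  then have "\<exists>N c. (\<Sum>j\<in>UNIV. c j * e $ j) = Var v ^ N"
    using coprime_forms_Var_power[of "\<lambda>j. e $ j" "\<lambda>j. int d2 + int (\<sigma> j)" i v] e_forms e_coprime by blast
  then show ?thesis by (auto simp: sum_2)
qed

lemma lin_e_bigraded: "lin e \<in> F_comp \<sigma> (int d2) 1"
  by (rule lin_bigraded) (simp add: e_forms)

lemma lin_e_nonzero: "lin e \<noteq> 0"
  by (simp add: lin_eq_0_iff e_nonzero)

text \<open>
  After inverting a variable \<open>x\<close> of \<open>R\<close> the vectors \<open>b\<close> and \<open>(e\<^sub>2, -e\<^sub>1)\<close> are proportional and the latter is unimodular. So
  the linear form \<open>e\<^sub>1 w\<^sub>1 + e\<^sub>2 w\<^sub>2\<close> can be completed to a system of coordinates, and a homogeneous polynomial that vanishes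
  at \<open>b\<close> vanishes at \<open>(e\<^sub>2, -e\<^sub>1)\<close>, that is, modulo this form.
\<close>

lemma value_at_b_eq_0_imp_dvd:
  assumes s: "s \<in> F_comp \<sigma> l q" and 0: "value_at (\<lambda>i. b $ i) s = 0"
  shows "lin e dvd s"
proof -
  have dvd: "\<exists>M. lin e dvd Const (Var v ^ M) * s" for v
  proof -
    obtain N c1 c2 where c: "c1 * e $ 1 + c2 * e $ 2 = Var v ^ N" using e_Var_power by blast
    define \<kappa> where "\<kappa> = c1 * e $ 1 + c2 * e $ 2"
    \<comment> \<open>Cramer's rule for \<open>c \<cdot> e = \<kappa>\<close> and \<open>b \<cdot> e = 0\<close> gives \<open>\<kappa> b = z (e\<^sub>2, -e\<^sub>1)\<close>.\<close>
    define z where "z = c2 * b $ 1 - c1 * b $ 2"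
    define b' where "b' i = (if i = 1 then e $ 2 else - e $ 1)" for i :: 2
    have "\<kappa> * b $ 1 - z * b' 1 = c1 * (b $ 1 * e $ 1 + b $ 2 * e $ 2)"
      "\<kappa> * b $ 2 - z * b' 2 = c2 * (b $ 1 * e $ 1 + b $ 2 * e $ 2)"
      unfolding \<kappa>_def z_def b'_def by (simp_all add: algebra_simps)
    then have "\<kappa> * b $ 1 = z * b' 1" "\<kappa> * b $ 2 = z * b' 2"
      by (simp_all only: b_e mult_zero_right right_minus_eq)
    then have prop_b: "\<kappa> * b $ i = z * b' i" for i using exhaust_2[of i] by auto
    have "\<kappa> \<noteq> 0" using c by (simp add: \<kappa>_def)
    have "z \<noteq> 0"
    proof
      assume "z = 0"
      then have "b $ i = 0" for i using prop_b[of i] \<open>\<kappa> \<noteq> 0\<close> by simp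
      then show False using b_nonzero by (simp add: vec_eq_iff)
    qed
    have "z ^ q * value_at b' s = value_at (\<lambda>i. z * b' i) s"
      by (rule coeff_hom.eval_scale[OF coeff_hom_id bigraded_mdeg[OF s], symmetric])
    also have "\<dots> = \<kappa> ^ q * value_at (\<lambda>i. b $ i) s"
      unfolding prop_b[symmetric] by (rule coeff_hom.eval_scale[OF coeff_hom_id bigraded_mdeg[OF s]])
    finally have b': "value_at b' s = 0" using 0 \<open>z \<noteq> 0\<close> by simp
    \<comment> \<open>\<open>L\<close> is the complementary coordinate: \<open>\<kappa> w\<close> is congruent to \<open>L (e\<^sub>2, -e\<^sub>1)\<close> modulo \<open>e\<^sub>1 w\<^sub>1 + e\<^sub>2 w\<^sub>2\<close>.\<close>
    define L :: "'k polF" where "L = Const c2 * Var 1 - Const c1 * Var 2"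
    have "mpoly_eval Const (\<lambda>i. L * Const (b' i)) s = L ^ q * mpoly_eval Const (\<lambda>i. Const (b' i)) s"
      by (rule coeff_hom.eval_scale[OF coeff_hom_Const bigraded_mdeg[OF s]])
    also have "mpoly_eval Const (\<lambda>i. Const (b' i)) s = Const (value_at b' s)"
      by (rule hom_mpoly_eval[OF coeff_hom_Const coeff_hom_id, symmetric])
    finally have zero: "mpoly_eval Const (\<lambda>i. L * Const (b' i)) s = 0" using b' by simp
    have lin_e: "lin e = Var 1 * Const (e $ 1) + Var 2 * Const (e $ 2)" by (simp add: lin_def sum_2)
    have "Const \<kappa> * Var 1 - L * Const (b' 1) = lin e * Const c1"
      "Const \<kappa> * Var 2 - L * Const (b' 2) = lin e * Const c2"
      unfolding lin_e L_def \<kappa>_def b'_def by (simp_all add: Const_add Const_mult Const_uminus algebra_simps)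
    then have cong: "lin e dvd Const \<kappa> * Var i - L * Const (b' i)" for i
      using exhaust_2[of i] by auto
    have "lin e dvd mpoly_eval Const (\<lambda>i. Const \<kappa> * Var i) s - mpoly_eval Const (\<lambda>i. L * Const (b' i)) s"
      by (rule eval_cong_dvd[OF coeff_hom_Const]) (rule cong)
    moreover have "mpoly_eval Const (\<lambda>i. Const \<kappa> * Var i) s = Const \<kappa> ^ q * mpoly_eval Const Var s"
      by (rule coeff_hom.eval_scale[OF coeff_hom_Const bigraded_mdeg[OF s]])
    ultimately have "lin e dvd Const (Var v ^ (N * q)) * s"
      using c by (simp add: zero \<kappa>_def Const_power power_mult)
    then show ?thesis by blast
  qed
  from dvd[of 0] dvd[of 1] obtain M N where "lin e dvd Const (Var 0 ^ M) * s" "lin e dvd Const (Var 1 ^ N) * s"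
    by blast
  then show ?thesis by (rule dvd_of_dvd_Var_multiples[rotated]) simp
qed

end

section \<open>The reflexive hull of \<open>E\<close>\<close>

lemma coset_eq: "im_col1 \<phi> +>\<^bsub>R3\<^esub> v = range (\<lambda>r. r *s column 1 \<phi> + v)"
  by (auto simp: a_r_coset_def' im_col1_def R3_def free_gmod_def)

lemma carrier_E: "carrier (E_mod \<phi>) = range (\<lambda>v. im_col1 \<phi> +>\<^bsub>R3\<^esub> v)"
  by (auto simp: E_mod_def quot_gmod_def A_RCOSETS_def' R3_def free_gmod_def)

lemma coset_in_E: "im_col1 \<phi> +>\<^bsub>R3\<^esub> v \<in> carrier (E_mod \<phi>)"
  by (simp add: carrier_E)

lemma coset_shift: "im_col1 \<phi> +>\<^bsub>R3\<^esub> (r *s column 1 \<phi> + v) = im_col1 \<phi> +>\<^bsub>R3\<^esub> v"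
proof -
  have "s *s column 1 \<phi> + (r *s column 1 \<phi> + v) = (s + r) *s column 1 \<phi> + v" for s
    by (simp add: vec_eq_iff algebra_simps)
  moreover have "s *s column 1 \<phi> + v = (s - r) *s column 1 \<phi> + (r *s column 1 \<phi> + v)" for s
    by (simp add: vec_eq_iff algebra_simps)
  ultimately show ?thesis unfolding coset_eq
    by (intro equalityI image_subsetI) (blast intro: range_eqI)+
qed

lemma add_E: "(im_col1 \<phi> +>\<^bsub>R3\<^esub> v) \<oplus>\<^bsub>E_mod \<phi>\<^esub> (im_col1 \<phi> +>\<^bsub>R3\<^esub> w) = im_col1 \<phi> +>\<^bsub>R3\<^esub> (v + w)"
proof -
  let ?C = "\<lambda>u. range (\<lambda>r. r *s column 1 \<phi> + u)"
  have 1: "(r *s column 1 \<phi> + v) + (s *s column 1 \<phi> + w) = (r + s) *s column 1 \<phi> + (v + w)" for r s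
    by (simp add: vec_eq_iff algebra_simps)
  have 2: "r *s column 1 \<phi> + (v + w) = (r *s column 1 \<phi> + v) + (0 *s column 1 \<phi> + w)" for r
    by (simp add: vec_eq_iff algebra_simps)
  have "(\<Union>x\<in>?C v. \<Union>y\<in>?C w. {x + y}) = ?C (v + w)"
  proof (intro equalityI subsetI)
    fix z assume "z \<in> (\<Union>x\<in>?C v. \<Union>y\<in>?C w. {x + y})"
    then obtain r s where "z = (r *s column 1 \<phi> + v) + (s *s column 1 \<phi> + w)" by blast
    then show "z \<in> ?C (v + w)" unfolding 1 by blast
  next
    fix z assume "z \<in> ?C (v + w)"
    then obtain r where "z = (r *s column 1 \<phi> + v) + (0 *s column 1 \<phi> + w)" unfolding 2 by blast
    then show "z \<in> (\<Union>x\<in>?C v. \<Union>y\<in>?C w. {x + y})" by blast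
  qed
  then show ?thesis
    unfolding coset_eq by (simp only: E_mod_def quot_gmod_def set_add_def' R3_def free_gmod_def ring.simps)
qed

lemma smult_E: "r \<odot>\<^bsub>E_mod \<phi>\<^esub> (im_col1 \<phi> +>\<^bsub>R3\<^esub> v) = im_col1 \<phi> +>\<^bsub>R3\<^esub> (r *s v)"
proof -
  have "im_col1 \<phi> +>\<^bsub>R3\<^esub> (r *s (s *s column 1 \<phi> + v)) = im_col1 \<phi> +>\<^bsub>R3\<^esub> (r *s v)" for s
  proof -
    have "r *s (s *s column 1 \<phi> + v) = (r * s) *s column 1 \<phi> + r *s v"
      by (simp add: vec_eq_iff algebra_simps)
    then show ?thesis using coset_shift by metis
  qed
  then have "(\<Union>x\<in>range (\<lambda>s. s *s column 1 \<phi> + v). im_col1 \<phi> +>\<^bsub>R3\<^esub> (r *s x)) = im_col1 \<phi> +>\<^bsub>R3\<^esub> (r *s v)"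
    by simp
  then show ?thesis
    unfolding coset_eq[of \<phi> v, symmetric] by (simp add: E_mod_def quot_gmod_def R3_def free_gmod_def)
qed

lemma carrier_hom: "h \<in> carrier (hom_gmod M N) \<longleftrightarrow> h \<in> carrier M \<rightarrow>\<^sub>E carrier N \<and>
    (\<forall>x\<in>carrier M. \<forall>y\<in>carrier M. h (x \<oplus>\<^bsub>M\<^esub> y) = h x \<oplus>\<^bsub>N\<^esub> h y) \<and>
    (\<forall>r. \<forall>x\<in>carrier M. h (r \<odot>\<^bsub>M\<^esub> x) = r \<odot>\<^bsub>N\<^esub> h x)"
  by (simp add: hom_gmod_def Let_def)

lemma grade_hom: "h \<in> grade (hom_gmod M N) e \<longleftrightarrow> h \<in> carrier (hom_gmod M N) \<and>
    (\<forall>n. \<forall>x\<in>grade M n. h x \<in> grade N (n + e))"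
  by (simp add: hom_gmod_def Let_def)

lemma add_dual: "x \<in> carrier M \<Longrightarrow> (g \<oplus>\<^bsub>dual M\<^esub> h) x = g x + h x"
  by (simp add: dual_def hom_gmod_def Let_def base_gmod_def)

lemma smult_dual: "x \<in> carrier M \<Longrightarrow> (r \<odot>\<^bsub>dual M\<^esub> h) x = r * h x"
  by (simp add: dual_def hom_gmod_def Let_def base_gmod_def)

text \<open>
  The linear form on \<open>E\<close> induced by a row vector; its value on a coset does not depend on the chosen representative if the
  row is orthogonal to the first column of \<open>\<phi>\<close>.
\<close>

definition row_form :: "'k::comm_ring_1 polR ^ 2 ^ 3 \<Rightarrow> 'k polR ^ 3 \<Rightarrow> ('k polR ^ 3) set \<Rightarrow> 'k polR"
  where "row_form \<phi> l = (\<lambda>C\<in>carrier (E_mod \<phi>). \<Sum>j\<in>UNIV. l $ j * (SOME v. v \<in> C) $ j)"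

lemma row_form_coset:
  fixes l :: "'k::comm_ring_1 polR ^ 3" and \<phi> :: "'k polR ^ 2 ^ 3"
  assumes "(\<Sum>j\<in>UNIV. l $ j * \<phi> $ j $ 1) = 0"
  shows "row_form \<phi> l (im_col1 \<phi> +>\<^bsub>R3\<^esub> v) = (\<Sum>j\<in>UNIV. l $ j * v $ j)"
proof -
  define u where "u = (SOME u. u \<in> im_col1 \<phi> +>\<^bsub>R3\<^esub> v)"
  have "0 *s column 1 \<phi> + v \<in> im_col1 \<phi> +>\<^bsub>R3\<^esub> v" unfolding coset_eq by (rule rangeI)
  then have "u \<in> im_col1 \<phi> +>\<^bsub>R3\<^esub> v" unfolding u_def by (rule someI)
  then obtain r where r: "u = r *s column 1 \<phi> + v" unfolding coset_eq by blast
  have "(\<Sum>j\<in>UNIV. l $ j * u $ j) = r * (\<Sum>j\<in>UNIV. l $ j * \<phi> $ j $ 1) + (\<Sum>j\<in>UNIV. l $ j * v $ j)"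
    by (simp add: r column_def sum.distrib sum_distrib_left distrib_left mult_ac)
  then show ?thesis using assms by (simp add: row_form_def coset_in_E u_def)
qed

lemma row_form_dual:
  fixes l :: "'k::comm_ring_1 polR ^ 3" and \<phi> :: "'k polR ^ 2 ^ 3"
  assumes "(\<Sum>j\<in>UNIV. l $ j * \<phi> $ j $ 1) = 0"
  shows "row_form \<phi> l \<in> carrier (dual (E_mod \<phi>))"
  unfolding dual_def carrier_hom
proof (intro conjI ballI allI)
  show "row_form \<phi> l \<in> carrier (E_mod \<phi>) \<rightarrow>\<^sub>E carrier base_gmod"
    by (auto simp: row_form_def base_gmod_def)
next
  fix x y assume "x \<in> carrier (E_mod \<phi>)" "y \<in> carrier (E_mod \<phi>)"
  then show "row_form \<phi> l (x \<oplus>\<^bsub>E_mod \<phi>\<^esub> y) = row_form \<phi> l x \<oplus>\<^bsub>base_gmod\<^esub> row_form \<phi> l y"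
    by (auto simp: carrier_E add_E row_form_coset[OF assms] base_gmod_def distrib_left sum.distrib)
next
  fix r x assume "x \<in> carrier (E_mod \<phi>)"
  then show "row_form \<phi> l (r \<odot>\<^bsub>E_mod \<phi>\<^esub> x) = r \<odot>\<^bsub>base_gmod\<^esub> row_form \<phi> l x"
    by (auto simp: carrier_E smult_E row_form_coset[OF assms] base_gmod_def sum_distrib_left mult_ac)
qed

text \<open>
  A linear form on \<open>E\<close> extends to \<open>E\<^sup>*\<^sup>*\<close> by evaluation, and in the basis of \<open>E\<^sup>*\<^sup>*\<close> given by \<open>\<theta>\<close> the extension is
  multiplication by a row. So every linear form on \<open>E\<close> is a combination of the rows of \<open>\<xi>\<close>.
\<close>

lemma bidual_presentation:
  fixes \<phi> :: "'k::comm_ring_1 polR ^ 2 ^ 3" and \<xi> :: "'k polR ^ 3 ^ 2" and l :: "'k polR ^ 3"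
  assumes \<theta>: "gmod_iso (free_gmod (\<lambda>j. int (\<sigma> j))) (dual (dual (E_mod \<phi>))) \<theta>"
    and \<xi>: "\<And>v. \<theta> (\<xi> *v v) = bidual_map (E_mod \<phi>) (im_col1 \<phi> +>\<^bsub>R3\<^esub> v)"
  shows bidual_kernel: "\<xi> *v column 1 \<phi> = 0"
    and bidual_rows: "(\<Sum>j\<in>UNIV. l $ j * \<phi> $ j $ 1) = 0 \<Longrightarrow>
      \<exists>b1 b2. \<forall>j. l $ j = b1 * \<xi> $ 1 $ j + b2 * \<xi> $ 2 $ j"
    and bidual_forms: "\<xi> $ i $ j \<in> forms (int (\<sigma> i))"
proof -
  let ?F = "free_gmod (\<lambda>j. int (\<sigma> j)) :: ('k polR, 'k polR ^ 2) gmodule"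
  let ?E = "E_mod \<phi>"
  have \<theta>_hom: "\<theta> \<in> carrier (hom_gmod ?F (dual (dual ?E)))" and \<theta>_bij: "bij_betw \<theta> (carrier ?F) (carrier (dual (dual ?E)))"
    and \<theta>_grade: "\<theta> ` grade ?F e = grade (dual (dual ?E)) e" for e
    using \<theta> by (auto simp: gmod_iso_def)
  have F: "carrier ?F = UNIV" "x \<oplus>\<^bsub>?F\<^esub> y = x + y" "r \<odot>\<^bsub>?F\<^esub> x = r *s x"
    "grade ?F e = {v. \<forall>j. v $ j \<in> forms (e + int (\<sigma> j))}" for x y r e
    by (simp_all add: free_gmod_def)
  have inj: "x = y" if "\<theta> x = \<theta> y" for x y
    using \<theta>_bij that unfolding bij_betw_def F by (auto dest: injD)
  have "im_col1 \<phi> +>\<^bsub>R3\<^esub> column 1 \<phi> = im_col1 \<phi> +>\<^bsub>R3\<^esub> 0"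
    using coset_shift[of \<phi> 1 0] by simp
  then have "\<theta> (\<xi> *v column 1 \<phi>) = \<theta> (\<xi> *v 0)" unfolding \<xi> by simp
  then show "\<xi> *v column 1 \<phi> = 0" by (metis inj matrix_vector_mult_0_right)
  show "\<exists>b1 b2. \<forall>j. l $ j = b1 * \<xi> $ 1 $ j + b2 * \<xi> $ 2 $ j" if l: "(\<Sum>j\<in>UNIV. l $ j * \<phi> $ j $ 1) = 0"
  proof -
    note L = row_form_dual[OF l]
    define \<beta> where "\<beta> v = \<theta> v (row_form \<phi> l)" for v
    have add: "\<beta> (x + y) = \<beta> x + \<beta> y" for x y
      using \<theta>_hom add_dual[OF L] by (simp add: \<beta>_def carrier_hom F)
    have smult: "\<beta> (r *s x) = r * \<beta> x" for r x
      using \<theta>_hom smult_dual[OF L] by (simp add: \<beta>_def carrier_hom F)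
    have "\<beta> v = v $ 1 * \<beta> (axis 1 1) + v $ 2 * \<beta> (axis 2 1)" for v
    proof -
      have "v = v $ 1 *s axis 1 1 + v $ 2 *s axis 2 1"
        by (simp add: vec_eq_iff forall_2 axis_def)
      then have "\<beta> v = \<beta> (v $ 1 *s axis 1 1 + v $ 2 *s axis 2 1)" by simp
      then show ?thesis by (simp only: add smult)
    qed
    moreover have "\<beta> (\<xi> *v axis j 1) = l $ j" for j
    proof -
      have "\<beta> (\<xi> *v axis j 1) = row_form \<phi> l (im_col1 \<phi> +>\<^bsub>R3\<^esub> axis j 1)"
        using L by (simp add: \<beta>_def \<xi> bidual_map_def)
      also have "\<dots> = (\<Sum>i\<in>UNIV. l $ i * axis j 1 $ i)" by (rule row_form_coset[OF l])
      also have "\<dots> = l $ j" by (simp add: axis_def if_distrib cong: if_cong)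
      finally show ?thesis .
    qed
    moreover have "(\<xi> *v axis j 1) $ i = \<xi> $ i $ j" for i j
      by (simp add: matrix_vector_mult_def axis_def if_distrib cong: if_cong)
    ultimately have "l $ j = \<beta> (axis 1 1) * \<xi> $ 1 $ j + \<beta> (axis 2 1) * \<xi> $ 2 $ j" for j
      by (metis mult.commute)
    then show ?thesis by blast
  qed
  show "\<xi> $ i $ j \<in> forms (int (\<sigma> i))"
  proof -
    let ?C = "im_col1 \<phi> +>\<^bsub>R3\<^esub> axis j 1"
    have "(axis j 1 :: 'k polR ^ 3) \<in> grade R3 0"
      by (auto simp: R3_def free_gmod_def axis_def forms_def)
    then have C: "?C \<in> grade ?E 0" by (simp add: E_mod_def quot_gmod_def imageI)
    have "\<theta> (\<xi> *v axis j 1) \<in> grade (dual (dual ?E)) 0"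
      unfolding dual_def[of "dual ?E"] grade_hom
    proof (intro conjI allI ballI)
      show "\<theta> (\<xi> *v axis j 1) \<in> carrier (hom_gmod (dual ?E) base_gmod)"
        using \<theta>_bij unfolding dual_def[symmetric] bij_betw_def F by blast
    next
      fix n l assume l: "l \<in> grade (dual ?E) n"
      then have "l \<in> carrier (dual ?E)" "l ?C \<in> grade base_gmod (0 + n)"
        using C unfolding dual_def grade_hom by blast+
      then show "\<theta> (\<xi> *v axis j 1) l \<in> grade base_gmod (n + 0)"
        by (simp add: \<xi> bidual_map_def)
    qed
    then obtain x where "x \<in> grade ?F 0" "\<theta> (\<xi> *v axis j 1) = \<theta> x" unfolding \<theta>_grade[symmetric] by blast
    then have "(\<xi> *v axis j 1) $ i \<in> forms (int (\<sigma> i))" using inj unfolding F by auto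
    then show ?thesis
      by (simp add: matrix_vector_mult_def axis_def if_distrib cong: if_cong)
  qed
qed

section \<open>The Rees ideal\<close>

lemma module_times: "Modules.module ((*) :: 'a::comm_ring_1 \<Rightarrow> _)"
  by standard (simp_all add: algebra_simps)

lemmas value_simps = coeff_hom.eval_add[OF coeff_hom_id] coeff_hom.eval_diff[OF coeff_hom_id]
  coeff_hom.eval_mult[OF coeff_hom_id] coeff_hom.eval_Var[OF coeff_hom_id] coeff_hom.eval_Const[OF coeff_hom_id]
  coeff_hom.eval_0[OF coeff_hom_id]

lemma value_at_span_eq_0:
  fixes B :: "('v, 'a::comm_ring_1) mpoly set"
  assumes B: "\<And>x. x \<in> B \<Longrightarrow> value_at t x = 0" and h: "h \<in> Modules.module.span (*) B"
  shows "value_at t h = 0"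
  using h
proof (induction rule: Modules.module.span_induct_alt[OF module_times, consumes 1, case_names base step])
  case base
  show ?case by (rule value_simps)
next
  case (step u x y)
  show ?case unfolding value_simps B[OF step.hyps(1)] step.IH by simp
qed

lemma sym_ideal_value:
  fixes h :: "('k::comm_ring_1 polR, 'k polR) mpoly"
  assumes "h \<in> sym_ideal (base_gmod\<lparr>carrier := I\<rparr>)"
  shows "value_at (\<lambda>x. x) h = 0"
proof (rule value_at_span_eq_0)
  show "h \<in> Modules.module.span (*)
    ({Var (x \<oplus>\<^bsub>base_gmod\<lparr>carrier := I\<rparr>\<^esub> y) - Var x - Var y | x y. x \<in> I \<and> y \<in> I} \<union>
     {Var (r \<odot>\<^bsub>base_gmod\<lparr>carrier := I\<rparr>\<^esub> x) - Const r * Var x | r x. x \<in> I})"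
    using assms unfolding sym_ideal_def by simp
next
  fix z :: "('k polR, 'k polR) mpoly"
  assume "z \<in> {Var (x \<oplus>\<^bsub>base_gmod\<lparr>carrier := I\<rparr>\<^esub> y) - Var x - Var y | x y. x \<in> I \<and> y \<in> I} \<union>
     {Var (r \<odot>\<^bsub>base_gmod\<lparr>carrier := I\<rparr>\<^esub> x) - Const r * Var x | r x. x \<in> I}"
  then show "value_at (\<lambda>x. x) z = 0"
  proof (elim UnE CollectE exE conjE)
    fix p q :: "'k polR" assume "z = Var (p \<oplus>\<^bsub>base_gmod\<lparr>carrier := I\<rparr>\<^esub> q) - Var p - Var q"
    then have z: "z = Var (p + q) - Var p - Var q" by (simp add: base_gmod_def)
    show ?thesis unfolding z value_simps by simp
  next
    fix r p :: "'k polR" assume "z = Var (r \<odot>\<^bsub>base_gmod\<lparr>carrier := I\<rparr>\<^esub> p) - Const r * Var p"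
    then have z: "z = Var (r * p) - Const r * Var p" by (simp add: base_gmod_def)
    show ?thesis unfolding z value_simps by simp
  qed
qed
lemma rees_kernel_imp_value:
  fixes f :: "'k::field polR ^ 3"
  assumes "h \<in> rees_kernel f"
  shows "value_at (\<lambda>i. f $ i) h = 0"
proof -
  let ?H = "mpoly_eval Const (\<lambda>i. Var (f $ i)) h"
  obtain r where r: "r \<noteq> 0" "Const r * ?H \<in> sym_ideal (base_gmod\<lparr>carrier := ideal3 f\<rparr>)"
    using assms by (auto simp: rees_kernel_def rees_ideal_def)
  have "value_at (\<lambda>x. x) ?H =
      mpoly_eval (\<lambda>x. value_at (\<lambda>x. x) (Const x)) (\<lambda>i. value_at (\<lambda>x. x) (Var (f $ i))) h"
    by (rule hom_mpoly_eval[OF coeff_hom.eval_hom[OF coeff_hom_id] coeff_hom_Const])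
  then have "value_at (\<lambda>x. x) ?H = value_at (\<lambda>i. f $ i) h"
    by (simp only: value_simps)
  then have "r * value_at (\<lambda>i. f $ i) h = 0"
    using sym_ideal_value[OF r(2)] by (simp only: value_simps)
  then show ?thesis using r(1) by simp
qed

lemma ideal3_closed:
  fixes f :: "'k::field polR ^ 3"
  shows "f $ i \<in> ideal3 f" "x \<in> ideal3 f \<Longrightarrow> y \<in> ideal3 f \<Longrightarrow> x + y \<in> ideal3 f"
    "x \<in> ideal3 f \<Longrightarrow> r * x \<in> ideal3 f"
proof -
  let ?R = "ring_of_type_algebra :: 'k polR ring"
  interpret R: ring ?R by (rule ring_from_type_algebra)
  have sub: "range (\<lambda>i. f $ i) \<subseteq> carrier ?R" by (simp add: ring_of_type_algebra_def)
  interpret I: ideal "ideal3 f" ?R unfolding ideal3_def by (rule R.genideal_ideal[OF sub])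
  show "f $ i \<in> ideal3 f" using R.genideal_self[OF sub] unfolding ideal3_def by blast
  show "x + y \<in> ideal3 f" if "x \<in> ideal3 f" "y \<in> ideal3 f"
    using I.a_closed[OF that] by (simp add: ring_of_type_algebra_def)
  show "r * x \<in> ideal3 f" if "x \<in> ideal3 f"
    using I.I_l_closed[OF that, of r] by (simp add: ring_of_type_algebra_def)
qed

text \<open>
  Under the substitution \<open>T\<^sub>j \<mapsto> X\<close> with index \<open>f\<^sub>j\<close> the linear form of a syzygy becomes a relation of the symmetric algebra.
\<close>

lemma syzygy_in_sym_ideal:
  fixes f u :: "'k::field polR ^ 3"
  assumes "(\<Sum>j\<in>UNIV. u $ j * f $ j) = 0"
  shows "(\<Sum>j\<in>UNIV. Var (f $ j) * Const (u $ j)) \<in> sym_ideal (base_gmod\<lparr>carrier := ideal3 f\<rparr>)"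
proof -
  let ?I = "base_gmod\<lparr>carrier := ideal3 f\<rparr>"
  interpret M: Modules.module "(*) :: ('k polR, 'k polR) mpoly \<Rightarrow> _"
    by (rule module_times)
  define S where "S = sym_ideal ?I"
  have add: "Var (x + y) - Var x - Var y \<in> S" if "x \<in> ideal3 f" "y \<in> ideal3 f" for x y
    unfolding S_def sym_ideal_def using that
    by (intro M.span_base UnI1 CollectI exI[of _ x] exI[of _ y]) (simp add: base_gmod_def)
  have smult: "Var (r * x) - Const r * Var x \<in> S" if "x \<in> ideal3 f" for r x
    unfolding S_def sym_ideal_def using that
    by (intro M.span_base UnI2 CollectI exI[of _ r] exI[of _ x]) (simp add: base_gmod_def)
  have plus: "x + y \<in> S" if "x \<in> S" "y \<in> S" for x y
    using that unfolding S_def sym_ideal_def by (rule M.span_add)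
  have uminus: "- x \<in> S" if "x \<in> S" for x
    using that unfolding S_def sym_ideal_def by (rule M.span_neg)
  define v where "v j = u $ j * f $ j" for j
  have v: "v j \<in> ideal3 f" for j unfolding v_def by (intro ideal3_closed)
  have "Var 0 \<in> S" using smult[OF ideal3_closed(1)[of f 1], of 0] by simp
  moreover have "v 1 + v 2 + v 3 = 0" using assms by (simp add: sum_3 v_def)
  ultimately have v123: "Var (v 1 + v 2 + v 3) \<in> S" by simp
  have "Var (v 1 + v 2 + v 3) - Var (v 1 + v 2) - Var (v 3) \<in> S" "Var (v 1 + v 2) - Var (v 1) - Var (v 2) \<in> S"
    by (intro add ideal3_closed(2) v)+
  from plus[OF v123 uminus[OF plus[OF this]]] have vs: "Var (v 1) + Var (v 2) + Var (v 3) \<in> S"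
    by (simp add: algebra_simps)
  have s: "- (Var (v j) - Const (u $ j) * Var (f $ j)) \<in> S" for j
    unfolding v_def by (intro uminus smult ideal3_closed)
  have "Var (v 1) + Var (v 2) + Var (v 3) + - (Var (v 1) - Const (u $ 1) * Var (f $ 1))
      + - (Var (v 2) - Const (u $ 2) * Var (f $ 2)) + - (Var (v 3) - Const (u $ 3) * Var (f $ 3)) \<in> S"
    by (rule plus[OF plus[OF plus[OF vs s] s] s])
  then show ?thesis unfolding S_def[symmetric] by (simp add: sum_3 algebra_simps)
qed

lemma rees_kernelI:
  fixes f :: "'k::field polR ^ 3"
  assumes "Const r * h = lin u * s + lin v * t" "r \<noteq> 0"
    and "(\<Sum>j\<in>UNIV. u $ j * f $ j) = 0" "(\<Sum>j\<in>UNIV. v $ j * f $ j) = 0"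
  shows "h \<in> rees_kernel f"
proof -
  interpret C: coeff_hom "Const :: 'k polR \<Rightarrow> ('k polR, 'k polR) mpoly" by (rule coeff_hom_Const)
  interpret M: Modules.module "(*) :: ('k polR, 'k polR) mpoly \<Rightarrow> _"
    by (rule module_times)
  let ?H = "mpoly_eval Const (\<lambda>i. Var (f $ i)) :: 'k polS \<Rightarrow> ('k polR, 'k polR) mpoly"
  have H_lin: "?H (lin w) \<in> sym_ideal (base_gmod\<lparr>carrier := ideal3 f\<rparr>)" if "(\<Sum>j\<in>UNIV. w $ j * f $ j) = 0" for w
    using syzygy_in_sym_ideal[OF that] by (simp add: eval_lin[OF coeff_hom_Const])
  have "Const r * ?H h = ?H (Const r * h)" by (simp add: C.eval_mult)
  also have "\<dots> = ?H s * ?H (lin u) + ?H t * ?H (lin v)"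
    unfolding assms(1) by (simp add: C.eval_add C.eval_mult mult.commute)
  also have "\<dots> \<in> sym_ideal (base_gmod\<lparr>carrier := ideal3 f\<rparr>)"
    using H_lin[OF assms(3)] H_lin[OF assms(4)] unfolding sym_ideal_def
    by (intro M.span_add M.span_scale)
  finally show ?thesis using assms(2) by (auto simp: rees_kernel_def rees_ideal_def)
qed

section \<open>Generators of the rows of the Rees ideal\<close>

lemma U_smult_eq: "U_smult = (\<lambda>u s. emb u * s)"
  by (intro ext) (simp add: U_smult_def)

lemma module_U_smult: "Modules.module (U_smult :: 'k::comm_ring_1 polU \<Rightarrow> _)"
  unfolding U_smult_eq by (rule module_of_coeff_hom[OF emb_hom])

lemma S_rowI:
  assumes "h \<in> K" "h \<in> S_comp i q" "0 \<in> K"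
  shows "h \<in> S_row K i"
proof -
  have "h = (\<Sum>j\<le>q. if j = q then h else 0)" by simp
  moreover have "\<forall>j\<le>q. (if j = q then h else 0) \<in> K \<inter> S_comp i j" using assms by simp
  ultimately show ?thesis unfolding S_row_def by blast
qed

lemma S_row_add:
  assumes K: "0 \<in> K" "\<And>x y. x \<in> K \<Longrightarrow> y \<in> K \<Longrightarrow> x + y \<in> K"
    and "x \<in> S_row K i" "y \<in> S_row K i"
  shows "x + y \<in> S_row K i"
proof -
  obtain g M h N where g: "x = (\<Sum>j\<le>M. g j)" "\<forall>j\<le>M. g j \<in> K \<inter> S_comp i j"
    and h: "y = (\<Sum>j\<le>N. h j)" "\<forall>j\<le>N. h j \<in> K \<inter> S_comp i j"
    using assms(3,4) unfolding S_row_def by blast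
  define k where "k j = (if j \<le> M then g j else 0) + (if j \<le> N then h j else 0)" for j
  have 1: "(\<Sum>j\<le>max M N. if j \<le> M then g j else 0) = x"
    unfolding g(1) by (rule sum.mono_neutral_cong_right) auto
  have 2: "(\<Sum>j\<le>max M N. if j \<le> N then h j else 0) = y"
    unfolding h(1) by (rule sum.mono_neutral_cong_right) auto
  have "x + y = (\<Sum>j\<le>max M N. k j)" unfolding k_def sum.distrib 1 2 ..
  moreover have "k j \<in> K \<inter> S_comp i j" for j
  proof -
    have "(if j \<le> M then g j else 0) \<in> K \<inter> S_comp i j" "(if j \<le> N then h j else 0) \<in> K \<inter> S_comp i j"
      using g(2) h(2) K(1) by auto
    then show ?thesis unfolding k_def using K(2) bigraded_add by blast
  qed
  ultimately show ?thesis unfolding S_row_def by blast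
qed

lemma S_row_minimal:
  assumes "x \<in> S_row K i" "\<And>h q. h \<in> K \<Longrightarrow> h \<in> S_comp i q \<Longrightarrow> h \<in> V"
    and "0 \<in> V" "\<And>x y. x \<in> V \<Longrightarrow> y \<in> V \<Longrightarrow> x + y \<in> V"
  shows "x \<in> V"
proof -
  obtain h N where h: "x = (\<Sum>j\<le>N. h j)" "\<forall>j\<le>N. h j \<in> K \<inter> S_comp i j"
    using assms(1) unfolding S_row_def by blast
  have "(\<Sum>j\<in>J. h j) \<in> V" if "J \<subseteq> {..N}" for J
    using finite_subset[OF that finite_atMost] that
  proof (induction J rule: finite_induct)
    case (insert j J)
    then have "h j \<in> V" using h(2) assms(2) by auto
    then show ?case using insert by (simp add: assms(4))
  qed (simp add: assms(3))
  then show ?thesis unfolding h(1) by blast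
qed

locale rees_setup = presentation_of_ideal a \<xi> d1 \<sigma> b e d2
  for a :: "'k::field polR ^ 3" and \<xi> :: "'k polR ^ 3 ^ 2" and d1 \<sigma> and b e :: "'k polR ^ 2" and d2 +
  fixes f a2 :: "'k polR ^ 3"
  assumes f_b: "\<And>j. f $ j = b $ 1 * \<xi> $ 1 $ j + b $ 2 * \<xi> $ 2 $ j"
    and e_a2: "e = \<xi> *v a2"
begin

abbreviation value_f :: "'k polS \<Rightarrow> 'k polR"
  where "value_f \<equiv> value_at (\<lambda>j. f $ j)"

abbreviation value_b :: "'k polF \<Rightarrow> 'k polR"
  where "value_b \<equiv> value_at (\<lambda>i. b $ i)"

lemma \<psi>_a2: "\<psi> (lin a2) = lin e"
  by (simp add: \<psi>_lin e_a2)

lemma f_mult: "(\<Sum>j\<in>UNIV. u $ j * f $ j) = b $ 1 * (\<xi> *v u) $ 1 + b $ 2 * (\<xi> *v u) $ 2"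
  for u :: "'k polR ^ 3"
  by (simp add: f_b matrix_vector_mult_def sum_distrib_left sum.distrib[symmetric] algebra_simps)

lemma f_a: "(\<Sum>j\<in>UNIV. a $ j * f $ j) = 0"
  unfolding f_mult \<xi>_a by simp

lemma f_a2: "(\<Sum>j\<in>UNIV. a2 $ j * f $ j) = 0"
  unfolding f_mult e_a2[symmetric] by (rule b_e)

lemma value_f_eq: "value_f h = value_b (\<psi> h)"
proof -
  have "value_b (vars_mult \<xi> j) = f $ j" for j
    unfolding vars_mult_eq_lin eval_lin[OF coeff_hom_id] by (simp add: sum_2 column_def f_b)
  moreover have "value_b (\<psi> h) = mpoly_eval (\<lambda>x. value_b (Const x)) (\<lambda>j. value_b (vars_mult \<xi> j)) h"
    unfolding to_ReesF_def by (rule hom_mpoly_eval[OF coeff_hom.eval_hom[OF coeff_hom_id] coeff_hom_Const])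
  ultimately show ?thesis by (simp only: value_simps)
qed

lemma value_b_lin_e: "value_b (lin e * z) = 0"
proof -
  have "value_b (lin e) = 0"
    unfolding eval_lin[OF coeff_hom_id] sum_2 by (rule b_e)
  then show ?thesis by (simp only: value_simps mult_zero_left)
qed

lemma value_f_zero_imp_multiple:
  assumes h: "h \<in> S_comp i q" and 0: "value_f h = 0"
  obtains t where "\<psi> h = lin e * t" "t \<in> F_comp \<sigma> (i - int d2) (q - 1)"
proof -
  note \<psi>h = \<psi>_bigraded[OF h]
  have "lin e dvd \<psi> h"
    by (rule value_at_b_eq_0_imp_dvd[OF \<psi>h]) (use 0 in \<open>simp only: value_f_eq\<close>)
  then obtain s where s: "\<psi> h = lin e * s" by (elim dvdE)
  from \<psi>h have "lin e * s \<in> homog (\<lambda>i. - int (\<sigma> i)) (\<lambda>i' q'. i' = i \<and> q' = q)"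
    unfolding s bigraded_eq_homog .
  then obtain t where t: "t \<in> homog (\<lambda>i. - int (\<sigma> i)) (\<lambda>i' q'. i' + int d2 = i \<and> q' + 1 = q)"
    "lin e * s = lin e * t" by (rule homog_multE[OF lin_e_bigraded])
  have "t \<in> F_comp \<sigma> (i - int d2) (q - 1)"
    unfolding bigraded_eq_homog by (rule homog_mono[OF t(1)]) auto
  with s t(2) show thesis by (intro that[of t]) simp_all
qed

text \<open>
  The Rees ideal consists of the polynomials that vanish at \<open>f\<close>: if \<open>h\<close> does, then \<open>\<psi> h\<close> is a multiple of
  \<open>e\<^sub>1 w\<^sub>1 + e\<^sub>2 w\<^sub>2\<close> in \<open>\<R>(F)\<close>, and \<open>x\<^sub>0\<^sup>M\<close> moves the cofactor into the image of \<open>S\<close>.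
\<close>

lemma bihomogeneous_rees_kernel_iff:
  assumes h: "h \<in> S_comp i q"
  shows "h \<in> rees_kernel f \<longleftrightarrow> value_f h = 0"
proof
  assume 0: "value_f h = 0"
  obtain t where t: "\<psi> h = lin e * t" "t \<in> F_comp \<sigma> (i - int d2) (q - 1)"
    by (rule value_f_zero_imp_multiple[OF h 0])
  obtain M t0 where t0: "\<psi> t0 = Const (Var 0 ^ M) * t"
    using lift_multiple[OF t(2), of 0] by blast
  have "\<psi> (Const (Var 0 ^ M) * h - lin a2 * t0) = 0"
    using psi.c_add[of "Const (Var 0 ^ M) * h" "- (lin a2 * t0)"]
    by (simp add: psi.c_uminus psi.c_mult t0 t(1) \<psi>_a2 mult_ac)
  then obtain t1 where "Const (Var 0 ^ M) * h - lin a2 * t0 = g1 * t1" unfolding ker_\<psi> by (elim dvdE)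
  then have "Const (Var 0 ^ M) * h = g1 * t1 + lin a2 * t0" by (simp add: diff_eq_eq)
  then show "h \<in> rees_kernel f" by (rule rees_kernelI) (simp_all add: f_a f_a2)
qed (rule rees_kernel_imp_value)

lemma S_row_rees_kernel: "S_row (rees_kernel f) i = S_row {h. value_f h = 0} i"
proof -
  have "rees_kernel f \<inter> S_comp i j = {h. value_f h = 0} \<inter> S_comp i j" for j
    using bihomogeneous_rees_kernel_iff by blast
  then show ?thesis unfolding S_row_def by presburger
qed

abbreviation vanishing :: "'k polS set"
  where "vanishing \<equiv> {h. value_f h = 0}"

lemma vanishing_closed: "0 \<in> vanishing" "x \<in> vanishing \<Longrightarrow> y \<in> vanishing \<Longrightarrow> x + y \<in> vanishing"
  "y \<in> vanishing \<Longrightarrow> x * y \<in> vanishing"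
  unfolding mem_Collect_eq value_simps by simp_all

lemma S_row_vanishing_add:
  "x \<in> S_row vanishing i \<Longrightarrow> y \<in> S_row vanishing i \<Longrightarrow> x + y \<in> S_row vanishing i"
  by (rule S_row_add[OF vanishing_closed(1)]) (rule vanishing_closed(2))

sublocale SU: Modules.module "U_smult :: 'k polU \<Rightarrow> 'k polS \<Rightarrow> 'k polS"
  by (rule module_U_smult)

lemma S_row_subspace: "SU.subspace (S_row vanishing i)"
proof (rule SU.subspaceI)
  show zero: "0 \<in> S_row vanishing i"
    by (rule S_rowI[of _ _ _ 0]) (simp_all add: value_simps)
  show "x + y \<in> S_row vanishing i" if "x \<in> S_row vanishing i" "y \<in> S_row vanishing i" for x y
    using that by (rule S_row_vanishing_add)
  show "U_smult u x \<in> S_row vanishing i" if x: "x \<in> S_row vanishing i" for u x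
  proof (induction u rule: mpoly_induct)
    case (monom c m)
    have "x \<in> {h. Const (Const c) * Monom m * h \<in> S_row vanishing i}"
      using x
    proof (rule S_row_minimal)
      fix h q assume h: "h \<in> vanishing" "h \<in> S_comp i q"
      have "Const (Const c) * Monom m * h \<in> S_comp (0 + i) (mdeg m + q)"
        by (rule bigraded_mult[OF bigraded_Const_Monom h(2)]) simp_all
      then show "h \<in> {h. Const (Const c) * Monom m * h \<in> S_row vanishing i}"
        using S_rowI[OF vanishing_closed(3)[OF h(1)] _ vanishing_closed(1)] by simp
    next
      show "0 \<in> {h. Const (Const c) * Monom m * h \<in> S_row vanishing i}" using zero by simp
    next
      fix y z assume "y \<in> {h. Const (Const c) * Monom m * h \<in> S_row vanishing i}"
        "z \<in> {h. Const (Const c) * Monom m * h \<in> S_row vanishing i}"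
      then show "y + z \<in> {h. Const (Const c) * Monom m * h \<in> S_row vanishing i}"
        using S_row_vanishing_add by (simp add: distrib_left)
    qed
    moreover have "U_smult (Const c * Monom m) x = Const (Const c) * Monom m * x"
      by (simp add: U_smult_def coeff_hom.c_mult[OF emb_hom] emb_Const emb_Monom)
    ultimately show ?case by simp
  next
    case (add u v)
    then show ?case using S_row_vanishing_add by (simp add: SU.scale_left_distrib)
  next
    case zero
    then show ?case using \<open>0 \<in> S_row vanishing i\<close> by simp
  qed
qed

lemma SU_span_Monom: "s \<in> SU.span B \<Longrightarrow> Monom m * s \<in> SU.span B"
  using SU.span_scale[of s B "Monom m"] by (simp add: U_smult_def emb_Monom)

lemma SU_span_Const: "s \<in> SU.span B \<Longrightarrow> Const (Const c) * s \<in> SU.span B"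
  using SU.span_scale[of s B "Const c"] by (simp add: U_smult_def emb_Const)

lemma g1_multiple_in_span:
  assumes t: "t \<in> homog (\<lambda>_. 0) (\<lambda>i' _. i' + int d1 = int i)"
    and B: "\<And>j k. j + k + d1 = i \<Longrightarrow> g1 * Const (Var 0 ^ j * Var 1 ^ k) \<in> SU.span B"
  shows "g1 * t \<in> SU.span B"
proof (induction t rule: mpoly_induct)
  case (monom r m)
  have "Monom m * (g1 * Const r) \<in> SU.span B"
  proof (induction r rule: mpoly_induct)
    case inner: (monom c k)
    have "int (mdeg k) + int d1 = int i" using t monom inner by (force simp: homog_def)
    then have "Monom m * (Const (Const c) * (g1 * Const (Monom k))) \<in> SU.span B"
      unfolding Monom_2[of k] by (intro SU_span_Monom SU_span_Const B) (simp add: mdeg_2)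
    then show ?case by (simp add: Const_mult mult_ac)
  qed (simp_all add: Const_add distrib_left SU.span_add SU.span_zero)
  then show ?case by (simp add: mult_ac)
qed (simp_all add: distrib_left SU.span_add SU.span_zero)

lemma span_lift:
  assumes "\<And>y. y \<in> Y \<Longrightarrow> \<psi> (lift y) = y" "s \<in> FU.span Y"
  shows "\<exists>h\<in>SU.span (lift ` Y). \<psi> h = s"
  using assms(2)
proof (induction rule: FU.span_induct_alt)
  case base
  show ?case using SU.span_zero psi.c_0 by blast
next
  case (step u x y)
  then obtain h where h: "h \<in> SU.span (lift ` Y)" "\<psi> h = y" by blast
  have "U_smult u (lift x) + h \<in> SU.span (lift ` Y)"
    by (rule SU.span_add[OF SU.span_scale[OF SU.span_base[OF imageI[OF step.hyps(1)]]] h(1)])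
  moreover have "\<psi> (U_smult u (lift x) + h) = U_act u x + y"
    using assms(1)[OF step.hyps(1)] h(2) by (simp add: U_smult_def U_act_def psi.c_add psi.c_mult)
  ultimately show ?case by blast
qed

text \<open>
  Lifts are only required to be bihomogeneous of some bidegree. It is the right one, because the generators in \<open>\<R>(F)\<close> do not
  vanish: a lift of 0 could be a multiple of \<open>g\<^sub>1\<close> in any row.
\<close>

lemma nonzero_bidegree:
  assumes "y \<in> bigraded s i q" "y \<in> bigraded s i' q'" "y \<noteq> 0"
  shows "i = i'"
proof -
  obtain m k where "coef (coef y m) k \<noteq> 0"
    using assms(3) coef_coef_eqI[of y 0] by auto
  then show ?thesis using assms(1,2) unfolding bigraded_eq_homog homog_iff by blast
qed

lemma basis_mod_member:
  assumes "basis_mod V W n p" "j \<in> {1..n}"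
  shows "p j \<in> V"
  using assms by (simp add: basis_mod_def)

lemma basis_mod_nonzero:
  fixes p :: "nat \<Rightarrow> 'k polF"
  assumes p: "basis_mod V W n p" and j: "j \<in> {1..n}" and "0 \<in> V" "0 \<in> W"
  shows "p j \<noteq> 0"
proof
  assume 0: "p j = 0"
  define c :: "'k \<Rightarrow> nat \<Rightarrow> 'k" where "c x = (\<lambda>l\<in>{1..n}. if l = j then x else 0)" for x
  have "(\<Sum>l\<in>{1..n}. Const (Const (c x l)) * p l) = 0" for x
    by (rule sum.neutral) (simp add: c_def 0)
  then have c: "c x \<in> {1..n} \<rightarrow>\<^sub>E UNIV \<and> 0 - (\<Sum>l\<in>{1..n}. Const (Const (c x l)) * p l) \<in> W" for x
    using \<open>0 \<in> W\<close> by (simp add: c_def)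
  have "\<exists>!u. u \<in> {1..n} \<rightarrow>\<^sub>E UNIV \<and> 0 - (\<Sum>l\<in>{1..n}. Const (Const (u l)) * p l) \<in> W"
    using p \<open>0 \<in> V\<close> unfolding basis_mod_def by blast
  then have "c 0 = c 1" using c by blast
  then have "c 0 j = c 1 j" by simp
  then show False using j by (simp add: c_def)
qed

lemma generator_bidegree:
  assumes p: "\<And>l. l + 2 \<le> d1 \<Longrightarrow>
      basis_mod (F_comp \<sigma> (int l) 1) (\<psi> ` S_comp (int l) 1) (d1 - l - 1) (p l)"
    and z: "z \<in> Bset \<sigma> c \<union> Pset p c"
  shows "(\<exists>q. z \<in> F_comp \<sigma> (- c) q) \<and> z \<noteq> 0"
  using z
proof
  assume "z \<in> Bset \<sigma> c"
  then obtain \<alpha> j k where z: "z = Const (Var 0 ^ j * Var 1 ^ k) * Monom \<alpha>" "int j + int k = wdot \<alpha> \<sigma> - c"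
    unfolding Bset_def by blast
  have "(Const (Var 0 ^ j * Var 1 ^ k) * Monom \<alpha> :: 'k polF) \<in> F_comp \<sigma> (- c) (mdeg \<alpha>)"
    by (rule bigraded_Const_Monom[OF forms_mult[OF forms_Var_power forms_Var_power]])
      (simp_all add: z(2) wdot_eq_wt)
  then show ?thesis unfolding z(1) by auto
next
  assume "z \<in> Pset p c"
  then obtain \<alpha> j where z: "z = p (nat (wdot \<alpha> \<sigma> - c)) j * Monom \<alpha>"
    and \<alpha>: "\<alpha> \<in> Omega \<sigma> c" "1 \<le> j" "int j \<le> int d1 - wdot \<alpha> \<sigma> + c - 1" by blast
  define l where "l = nat (wdot \<alpha> \<sigma> - c)"
  have l: "int l = wdot \<alpha> \<sigma> - c" using Omega_wdot[OF \<alpha>(1)] by (simp add: l_def)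
  have "l + 2 \<le> d1" and j: "j \<in> {1..d1 - l - 1}" using \<alpha> l by auto
  note p_l = p[OF \<open>l + 2 \<le> d1\<close>]
  have "0 \<in> \<psi> ` S_comp (int l) 1" using psi.c_0 bigraded_0 by (metis imageI)
  then have nz: "p l j \<noteq> 0" by (rule basis_mod_nonzero[OF p_l j bigraded_0])
  have "p l j * Monom \<alpha> \<in> F_comp \<sigma> (- c) (1 + mdeg \<alpha>)"
    using bigraded_mult[OF basis_mod_member[OF p_l j] bigraded_Monom[of \<alpha>]]
    by (simp add: l wdot_eq_wt)
  then show ?thesis unfolding z l_def[symmetric] using nz by auto
qed

text \<open>
  Modulo \<open>g\<^sub>1\<close> an element of the row is a multiple \<open>(e\<^sub>1 w\<^sub>1 + e\<^sub>2 w\<^sub>2) t\<close> with \<open>t\<close> in row \<open>-c\<close>. A \<open>U\<close>-combination of generators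
  of that row lifts to a \<open>U\<close>-combination of the chosen lifts, and the difference is a multiple of \<open>g\<^sub>1\<close> in row \<open>i\<close>.
\<close>

lemma row_of_rees_ideal_generators:
  fixes i :: nat and c :: int
  defines "c \<equiv> int d2 - int i"
  assumes i: "d1 \<le> i + 1"
    and p: "\<And>l. l + 2 \<le> d1 \<Longrightarrow>
      basis_mod (F_comp \<sigma> (int l) 1) (\<psi> ` S_comp (int l) 1) (d1 - l - 1) (p l)"
    and A: "A = {g1 * Const (Var 0 ^ j * Var 1 ^ k) | j k. j + k + d1 = i}"
    and Y: "Y = (\<lambda>z. lin e * z) ` (Bset \<sigma> c \<union> Pset p c)"
  shows "\<forall>y\<in>Y. \<exists>h s q. h \<in> S_comp s q \<and> \<psi> h = y"
    and "\<forall>y\<in>Y. (\<exists>s q. lift y \<in> S_comp s q) \<and> \<psi> (lift y) = y \<Longrightarrow>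
      SU.span (A \<union> lift ` Y) = S_row (rees_kernel f) (int i)"
proof -
  have Y_comp: "(\<exists>q. y \<in> F_comp \<sigma> (int i) q) \<and> y \<noteq> 0" if y: "y \<in> Y" for y
  proof -
    from y obtain z where z: "z \<in> Bset \<sigma> c \<union> Pset p c" "y = lin e * z" unfolding Y by blast
    from generator_bidegree[OF p z(1)] obtain q where q: "z \<in> F_comp \<sigma> (- c) q" and "z \<noteq> 0" by blast
    have "lin e * z \<in> F_comp \<sigma> (int i) (1 + q)"
      using bigraded_mult[OF lin_e_bigraded q] by (simp add: c_def)
    moreover have "lin e * z \<noteq> 0" using lin_e_nonzero \<open>z \<noteq> 0\<close> by simp
    ultimately show ?thesis unfolding z(2) by blast
  qed
  show "\<forall>y\<in>Y. \<exists>h s q. h \<in> S_comp s q \<and> \<psi> h = y"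
  proof
    fix y assume "y \<in> Y"
    then obtain q where "y \<in> F_comp \<sigma> (int i) q" using Y_comp by blast
    from \<psi>_surj_high_rows[OF this] show "\<exists>h s q. h \<in> S_comp s q \<and> \<psi> h = y" using i by auto
  qed
  assume lift: "\<forall>y\<in>Y. (\<exists>s q. lift y \<in> S_comp s q) \<and> \<psi> (lift y) = y"
  show "SU.span (A \<union> lift ` Y) = S_row (rees_kernel f) (int i)"
    unfolding S_row_rees_kernel
  proof (rule equalityI)
    show sub: "SU.span (A \<union> lift ` Y) \<subseteq> S_row vanishing (int i)"
    proof (rule SU.span_minimal[OF _ S_row_subspace], rule subsetI)
      fix x assume "x \<in> A \<union> lift ` Y"
      then show "x \<in> S_row vanishing (int i)"
      proof
        assume "x \<in> A"
        then obtain j k where x: "x = g1 * Const (Var 0 ^ j * Var 1 ^ k)" "j + k + d1 = i" unfolding A by blast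
        have "x \<in> S_comp (int d1 + (int j + int k)) (1 + 0)"
          unfolding x(1)
          by (intro bigraded_mult g1_bigraded bigraded_Const forms_mult forms_Var_power)
        moreover have "int d1 + (int j + int k) = int i" using x(2) by simp
        moreover have "x \<in> vanishing"
        proof -
          have "value_f x = value_b (\<psi> g1) * value_b (Const (Var 0 ^ j * Var 1 ^ k))"
            unfolding x(1) value_f_eq psi.c_mult \<psi>_Const by (simp only: value_simps)
          then show ?thesis by (simp add: \<psi>_g1 value_simps)
        qed
        ultimately show ?thesis using S_rowI[OF _ _ vanishing_closed(1)] by metis
      next
        assume "x \<in> lift ` Y"
        then obtain y where y: "y \<in> Y" "x = lift y" by blast
        then obtain s q where sq: "x \<in> S_comp s q" and \<psi>x: "\<psi> x = y" using lift by blast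
        obtain q' where "y \<in> F_comp \<sigma> (int i) q'" "y \<noteq> 0" using Y_comp[OF y(1)] by blast
        then have "s = int i" using nonzero_bidegree[OF \<psi>_bigraded[OF sq]] unfolding \<psi>x by blast
        moreover obtain z where "y = lin e * z" using y(1) unfolding Y by blast
        then have "x \<in> vanishing" unfolding mem_Collect_eq value_f_eq \<psi>x by (simp only: value_b_lin_e)
        ultimately show ?thesis using sq S_rowI[OF _ _ vanishing_closed(1)] by blast
      qed
    qed
    have "S_row vanishing (int i) \<subseteq> full_row (\<lambda>_. 0) (int i)"
      by (rule subsetI, erule S_row_minimal) (simp_all add: bigraded_row homog_add)
    with sub have span_row: "SU.span (A \<union> lift ` Y) \<subseteq> full_row (\<lambda>_. 0) (int i)" by blast
    show "S_row vanishing (int i) \<subseteq> SU.span (A \<union> lift ` Y)"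
    proof (rule subsetI, erule S_row_minimal)
      fix h q assume h: "h \<in> vanishing" "h \<in> S_comp (int i) q"
      obtain t where t: "\<psi> h = lin e * t" "t \<in> F_comp \<sigma> (int i - int d2) (q - 1)"
        by (rule value_f_zero_imp_multiple[OF h(2)]) (use h(1) in simp)
      have "t \<in> full_row (\<lambda>i. - int (\<sigma> i)) (- c)" using bigraded_row[OF t(2)] by (simp add: c_def)
      from row_generators[OF p this] have "t \<in> FU.span (Bset \<sigma> c \<union> Pset p c)" .
      then have "lin e * t \<in> FU.span Y"
        by (rule mult_span[rotated]) (auto simp: Y intro: FU.span_base)
      with span_lift[of Y lift] lift obtain h' where h': "h' \<in> SU.span (lift ` Y)" "\<psi> h' = lin e * t"
        by blast
      then have h'_span: "h' \<in> SU.span (A \<union> lift ` Y)" using SU.span_mono[of "lift ` Y"] by blast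
      have "\<psi> (h - h') = 0" using psi.c_add[of h "- h'"] by (simp add: psi.c_uminus t(1) h'(2))
      then obtain t1 where t1: "h - h' = g1 * t1" unfolding ker_\<psi> by (elim dvdE)
      have "h - h' \<in> full_row (\<lambda>_. 0) (int i)"
        using bigraded_row[OF h(2)] span_row h'_span by (blast intro: homog_diff)
      then obtain t2 where t2: "t2 \<in> homog (\<lambda>_. 0) (\<lambda>i' _. i' + int d1 = int i)" "g1 * t1 = g1 * t2"
        unfolding t1 by (rule homog_multE[OF g1_bigraded])
      have "h - h' \<in> SU.span (A \<union> lift ` Y)"
        unfolding t1 t2(2) by (rule g1_multiple_in_span[OF t2(1)]) (rule SU.span_base, use A in blast)
      then have "h' + (h - h') \<in> SU.span (A \<union> lift ` Y)" by (rule SU.span_add[OF h'_span])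
      then show "h \<in> SU.span (A \<union> lift ` Y)" by simp
    qed (auto intro: SU.span_zero SU.span_add)
  qed
qed

end

section \<open>The presentation obtained from the Hilbert-Burch matrix\<close>

theorem theorem4p8:
  fixes f :: "'k::field polR ^ 3"
    and \<phi> :: "'k polR ^ 2 ^ 3"
    and d d1 d2 i :: nat
    and \<sigma> :: "2 \<Rightarrow> nat"
    and \<theta> :: "'k polR ^ 2 \<Rightarrow> ((('k polR ^ 3) set \<Rightarrow> 'k polR) \<Rightarrow> 'k polR)"
    and \<xi> :: "'k polR ^ 3 ^ 2"
    and p :: "nat \<Rightarrow> nat \<Rightarrow> 'k polF"
    and g1 g2 :: "'k polS"
    and c :: int
  assumes f_forms: "\<And>j. f $ j \<in> forms (int d)"
    and f_minimal: "\<And>j. genideal ring_of_type_algebra ((\<lambda>i. f $ i) ` (UNIV - {j})) \<noteq> ideal3 f"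
    and height_two: "height ring_of_type_algebra (ideal3 f) = 2"
    and d1_d2: "1 \<le> d1" "d1 \<le> d2"
    and \<phi>_forms: "\<And>j. \<phi> $ j $ 1 \<in> forms (int d1)" "\<And>j. \<phi> $ j $ 2 \<in> forms (int d2)"
    and \<phi>_inj: "inj (\<lambda>v. \<phi> *v v)"
    and \<phi>_exact: "range (\<lambda>v. \<phi> *v v) = {u. (\<Sum>j\<in>UNIV. u $ j * f $ j) = 0}"
    and g1: "g1 = vars_mult \<phi> 1"
    and g2: "g2 = vars_mult \<phi> 2"
    and \<sigma>: "\<sigma> 2 \<le> \<sigma> 1"
    and \<theta>: "gmod_iso (free_gmod (\<lambda>j. int (\<sigma> j))) (dual (dual (E_mod \<phi>))) \<theta>"
    and \<xi>: "\<And>v. \<theta> (\<xi> *v v) = bidual_map (E_mod \<phi>) (im_col1 \<phi> +>\<^bsub>R3\<^esub> v)"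
    and i: "i \<ge> d1 - 1"
    and c: "c = int d2 - int i"
    and p: "\<And>l. l + 2 \<le> d1 \<Longrightarrow>
      basis_mod (F_comp \<sigma> (int l) 1) (to_ReesF \<xi> ` S_comp (int l) 1) (d1 - l - 1) (p l)"
  defines "A \<equiv> {g1 * Const (Var 0 ^ a * Var 1 ^ b) | a b. a + b + d1 = i}"
    and "Y \<equiv> {to_ReesF \<xi> g2 * b | b. b \<in> Bset \<sigma> c} \<union>
      {to_ReesF \<xi> g2 * p (nat (wdot \<alpha> \<sigma> - c)) j * Monom \<alpha> | \<alpha> j.
        \<alpha> \<in> Omega \<sigma> c \<and> 1 \<le> j \<and> int j \<le> int d1 - wdot \<alpha> \<sigma> + c - 1}"
  shows "(\<forall>y\<in>Y. \<exists>h a q. h \<in> S_comp a q \<and> to_ReesF \<xi> h = y) \<and>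
    (\<forall>lift. (\<forall>y\<in>Y. (\<exists>a q. lift y \<in> S_comp a q) \<and> to_ReesF \<xi> (lift y) = y) \<longrightarrow>
      Modules.module.span U_smult (A \<union> lift ` Y) = S_row (rees_kernel f) (int i))"
proof -
  define a a2 where "a = column 1 \<phi>" and "a2 = column 2 \<phi>"
  define e where "e = \<xi> *v a2"
  have a_nth: "a $ j = \<phi> $ j $ 1" and a2_nth: "a2 $ j = \<phi> $ j $ 2" for j
    by (simp_all add: a_def a2_def column_def)
  have \<phi>_mult: "\<phi> *v v = v $ 1 *s a + v $ 2 *s a2" for v
    by (simp add: vec_eq_iff matrix_vector_mult_def sum_2 a_nth a2_nth mult.commute)
  have syzygy: "\<exists>s t. u = s *s a + t *s a2" if "(\<Sum>j\<in>UNIV. u $ j * f $ j) = 0" for u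
  proof -
    from that have "u \<in> range (\<lambda>v. \<phi> *v v)" unfolding \<phi>_exact by simp
    then show ?thesis unfolding \<phi>_mult by blast
  qed
  have f_\<phi>: "(\<Sum>j\<in>UNIV. (\<phi> *v v) $ j * f $ j) = 0" for v
  proof -
    have "\<phi> *v v \<in> {u. (\<Sum>j\<in>UNIV. u $ j * f $ j) = 0}" unfolding \<phi>_exact[symmetric] by (rule rangeI)
    then show ?thesis by simp
  qed
  have axis: "\<phi> *v axis 1 1 = a" "\<phi> *v axis 2 1 = a2"
    by (simp_all add: \<phi>_mult vec_eq_iff axis_def)
  have f_a: "(\<Sum>j\<in>UNIV. a $ j * f $ j) = 0" and f_a2: "(\<Sum>j\<in>UNIV. a2 $ j * f $ j) = 0"
    using f_\<phi>[of "axis 1 1"] f_\<phi>[of "axis 2 1"] by (simp_all only: axis)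
  have \<phi>_eqD: "v = w" if "\<phi> *v v = \<phi> *v w" for v w
    using \<phi>_inj that by (rule injD)
  \<comment> \<open>If \<open>f = 0\<close>, then the ideal would be generated by two of the three forms.\<close>
  have f_nonzero: "f \<noteq> 0"
  proof
    assume "f = 0"
    then have "(\<lambda>i. f $ i) ` (UNIV - {1}) = range (\<lambda>i. f $ i)" by (auto simp: image_iff intro!: exI[of _ 2])
    then show False using f_minimal[of 1] by (simp add: ideal3_def)
  qed
  have a_nonzero: "a \<noteq> 0"
  proof
    assume "a = 0"
    then have "\<phi> *v axis 1 1 = \<phi> *v 0" by (simp add: axis)
    from \<phi>_eqD[OF this] show False by (simp add: vec_eq_iff axis_def forall_2)
  qed
  \<comment> \<open>A common divisor can be cancelled from the syzygy \<open>a\<close>; the quotient is a syzygy again, hence in the image of \<open>\<phi>\<close>, and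
    injectivity of \<open>\<phi>\<close> forces the divisor to be a unit.\<close>
  have a_coprime: "G dvd 1" if G: "\<And>j. G dvd a $ j" for G
  proof -
    have "\<forall>j. \<exists>y. a $ j = G * y" using G by (auto simp: dvd_def)
    from choice[OF this] obtain y where y: "\<forall>j. a $ j = G * y j" by blast
    define u :: "'k polR ^ 3" where "u = (\<chi> j. y j)"
    have u: "a = G *s u" using y by (simp add: vec_eq_iff u_def)
    have "G \<noteq> 0" using u a_nonzero by auto
    have "G * (\<Sum>j\<in>UNIV. u $ j * f $ j) = (\<Sum>j\<in>UNIV. a $ j * f $ j)"
      unfolding u by (simp add: sum_distrib_left mult.assoc)
    then have "(\<Sum>j\<in>UNIV. u $ j * f $ j) = 0" using f_a \<open>G \<noteq> 0\<close> by simp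
    then have "u \<in> range (\<lambda>v. \<phi> *v v)" unfolding \<phi>_exact by simp
    then obtain v where "u = \<phi> *v v" by blast
    then have "\<phi> *v (G *s v) = \<phi> *v axis 1 1" unfolding matrix_vector_mult_smult axis u by simp
    from \<phi>_eqD[OF this] have "(G *s v) $ 1 = axis 1 1 $ 1" by simp
    then have "1 = G * v $ 1" by (simp add: axis_def)
    then show ?thesis by (rule dvdI)
  qed
  interpret presentation a \<xi> d1 \<sigma>
  proof
    show "\<xi> *v a = 0" unfolding a_def by (rule bidual_kernel[OF \<theta> \<xi>])
    show "\<exists>b1 b2. \<forall>j. l $ j = b1 * \<xi> $ 1 $ j + b2 * \<xi> $ 2 $ j"
      if "(\<Sum>j\<in>UNIV. l $ j * a $ j) = 0" for l
      by (rule bidual_rows[OF \<theta> \<xi>]) (use that in \<open>simp add: a_nth\<close>)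
  qed (use a_nonzero a_coprime \<phi>_forms bidual_forms[OF \<theta> \<xi>] in \<open>simp_all add: a_nth\<close>)
  \<comment> \<open>The row \<open>f\<close> is a linear form on \<open>E\<close>; \<open>b\<close> is its extension to \<open>F\<close>.\<close>
  have "(\<Sum>j\<in>UNIV. f $ j * a $ j) = 0" using f_a by (simp add: mult.commute)
  from \<xi>_rows[OF this] obtain b1 b2 where b12: "\<forall>j. f $ j = b1 * \<xi> $ 1 $ j + b2 * \<xi> $ 2 $ j" by blast
  define b :: "'k polR ^ 2" where "b = (\<chi> i. if i = 1 then b1 else b2)"
  have b: "b $ 1 = b1" "b $ 2 = b2" by (simp_all add: b_def)
  have f_mult: "(\<Sum>j\<in>UNIV. u $ j * f $ j) = b $ 1 * (\<xi> *v u) $ 1 + b $ 2 * (\<xi> *v u) $ 2" for u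
    by (simp add: b12 b matrix_vector_mult_def sum_distrib_left sum.distrib[symmetric] algebra_simps)
  have e_nonzero: "e \<noteq> 0"
  proof
    assume "e = 0"
    then obtain t where t: "a2 = t *s a" using ker_\<xi> unfolding e_def by blast
    have "\<phi> *v (\<chi> i. if i = 1 then - t else 1) = \<phi> *v 0"
      by (simp add: \<phi>_mult t vec_eq_iff)
    from \<phi>_eqD[OF this] have "(\<chi> i. if i = 1 then - t else 1) $ (2 :: 2) = (0 :: 'k polR ^ 2) $ 2" by simp
    then show False by simp
  qed
  interpret rees_setup a \<xi> d1 \<sigma> b e d2 f a2
  proof
    fix i
    have "(\<Sum>j\<in>UNIV. \<xi> $ i $ j * a2 $ j) \<in> forms (int (\<sigma> i) + int d2)"
      by (intro forms_sum forms_mult \<xi>_forms) (simp add: a2_nth \<phi>_forms)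
    then show "e $ i \<in> forms (int d2 + int (\<sigma> i))"
      by (simp add: e_def matrix_vector_mult_def add.commute)
  next
    show "b \<noteq> 0"
    proof
      assume "b = 0"
      then have "f $ j = 0" for j using b12 b by simp
      then show False using f_nonzero by (simp add: vec_eq_iff)
    qed
    show "b $ 1 * e $ 1 + b $ 2 * e $ 2 = 0" using f_mult[of a2] f_a2 by (simp add: e_def)
  next
    \<comment> \<open>A multiple \<open>x\<^sup>N v\<close> lies in \<open>E\<close>, where the kernel of \<open>b\<close> is generated by the class of the second column.\<close>
    fix v :: "'k polR ^ 2" assume v: "b $ 1 * v $ 1 + b $ 2 * v $ 2 = 0"
    have multiples: "\<exists>N r. \<forall>i. Var x ^ N * v $ i = r * e $ i" for x
    proof -
      obtain N where "\<forall>w. \<exists>u. \<xi> *v u = Var x ^ N *s w" using coker_\<xi>_finite by blast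
      then obtain u where u: "\<xi> *v u = Var x ^ N *s v" by blast
      have "(\<Sum>j\<in>UNIV. u $ j * f $ j) = Var x ^ N * (b $ 1 * v $ 1 + b $ 2 * v $ 2)"
        unfolding f_mult u by (simp add: algebra_simps)
      then have "(\<Sum>j\<in>UNIV. u $ j * f $ j) = 0" by (simp add: v)
      from syzygy[OF this] obtain s t where "u = s *s a + t *s a2" by blast
      then have "\<xi> *v u = t *s e"
        by (simp add: matrix_vector_right_distrib matrix_vector_mult_smult \<xi>_a e_def)
      then have "\<forall>i. Var x ^ N * v $ i = t * e $ i" using u by (simp add: vec_eq_iff)
      then show ?thesis by blast
    qed
    obtain M r N s where "\<forall>i. Var 0 ^ M * v $ i = r * e $ i" "\<forall>i. Var 1 ^ N * v $ i = s * e $ i"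
      using multiples[of 0] multiples[of 1] by blast
    then show "\<exists>t. v = t *s e"
      using multiple_of_Var_multiples[of 0 1 e M v r N s] e_nonzero by simp
  qed (use e_nonzero b12 b in \<open>simp_all add: e_def\<close>)
  have A_eq: "A = {lin a * Const (Var 0 ^ j * Var 1 ^ k) | j k. j + k + d1 = i}"
    unfolding A_def g1 vars_mult_eq_lin a_def ..
  have g2_eq: "to_ReesF \<xi> g2 = lin e"
    unfolding g2 vars_mult_eq_lin using \<psi>_a2 by (simp add: a2_def)
  have Y_eq: "Y = (\<lambda>z. lin e * z) ` (Bset \<sigma> c \<union> Pset p c)"
    unfolding Y_def g2_eq image_Un mult.assoc by blast
  have "d1 \<le> i + 1" using i by linarith
  note generators = row_of_rees_ideal_generators[OF this p A_eq Y_eq[unfolded c]]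
  show ?thesis using generators by blast
qed

end
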